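(* There are universal constants $C_1,C_2>0$ and an algorithm that takes as input $\kappa\ge2$, $t\ge1$, and $M$ elements from $\{1,\dots,N\}$ and outputs a sequence of elements from $\{1,\dots,N\}$ such that: (1) the running time is $M\cdot\mathrm{poly}(\log N,\kappa,t)$; (2) each $i\in\{1,\dots,N\}$ appears at least as often in the input as in the output; and (3) if the input consists of $M\ge 4\kappa^4t^2/\max_i p_i$ independent samples from the distribution assigning probability $p_i>0$ to element $i$ (where $\sum_i p_i=1$), with $t\ge\max_{i,j}p_i/p_j$, then the output is within statistical distance $C_1MN\log N\exp(-C_2\kappa)$ of $m$ independent samples from the distribution $\sqrt{\vec{p}}$, where $m=M/(16\kappa^3t^{3/2})$.
   Context: For $\vec{p}\in[0,1]^N$ with $\sum_i p_i=1$, $\sqrt{\vec{p}}$ denotes the probability vector $(\sqrt{p_1}/p_{\mathrm{sqrt}},\dots,\sqrt{p_N}/p_{\mathrm{sqrt}})$ where $p_{\mathrm{sqrt}}=\sum_i\sqrt{p_i}$. *)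

theory Defs
  imports "HOL-Probability.Probability" "HOL-Computational_Algebra.Polynomial"
begin

section \<open>A randomized real RAM\<close>

text \<open>
  The algorithm receives two real parameters besides a list of natural numbers, so the model of
  computation is a random access machine with two sorts of cells, holding natural numbers and
  real numbers respectively. Every program uses finitely many memory banks, each an array of cells
  indexed by naturals; a scalar variable is a cell at a constant address. The primitive operations are

  \<^item> on naturals: literals, reading (indirect addressing), addition, truncated subtraction, comparison;
  \<^item> on reals: reading, conversion of a natural to a real, the field operations, comparison;
  \<^item> tossing a fair coin, and appending a natural number to the write-only output.

  Real literals are available only as values of expressions over natural literals, and there is no
  rounding of reals to naturals. Multiplication of naturals is not a primitive, because at unit cost
  it would create natural numbers of exponential bit length.
\<close>

datatype nexp =
    NLit nat
  | NRead nat nexp  \<comment> \<open>bank, address\<close>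
  | NAdd nexp nexp
  | NSub nexp nexp

datatype rexp =
    RNat nexp
  | RRead nat nexp  \<comment> \<open>bank, address\<close>
  | RAdd rexp rexp
  | RSub rexp rexp
  | RMul rexp rexp
  | RDiv rexp rexp

datatype bexp =
    NLess nexp nexp
  | RLess rexp rexp
  | BNot bexp
  | BAnd bexp bexp

datatype com =
    Skip
  | NStore nat nexp nexp  \<comment> \<open>bank, address, value\<close>
  | RStore nat nexp rexp  \<comment> \<open>bank, address, value\<close>
  | Toss nat nexp         \<comment> \<open>bank and address of the natural cell receiving the coin\<close>
  | Emit nexp
  | Seq com com
  | Cond bexp com com
  | While bexp com

record state =
  nmem :: "nat \<Rightarrow> nat \<Rightarrow> nat"
  rmem :: "nat \<Rightarrow> nat \<Rightarrow> real"
  emitted :: "nat list"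

primrec nval :: "nexp \<Rightarrow> state \<Rightarrow> nat" where
  "nval (NLit n) s = n"
| "nval (NRead b e) s = nmem s b (nval e s)"
| "nval (NAdd e f) s = nval e s + nval f s"
| "nval (NSub e f) s = nval e s - nval f s"

primrec rval :: "rexp \<Rightarrow> state \<Rightarrow> real" where
  "rval (RNat e) s = real (nval e s)"
| "rval (RRead b e) s = rmem s b (nval e s)"
| "rval (RAdd e f) s = rval e s + rval f s"
| "rval (RSub e f) s = rval e s - rval f s"
| "rval (RMul e f) s = rval e s * rval f s"
| "rval (RDiv e f) s = rval e s / rval f s"

primrec bval :: "bexp \<Rightarrow> state \<Rightarrow> bool" where
  "bval (NLess e f) s = (nval e s < nval f s)"
| "bval (RLess e f) s = (rval e s < rval f s)"
| "bval (BNot b) s = (\<not> bval b s)"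
| "bval (BAnd b c) s = (bval b s \<and> bval c s)"

definition nstore :: "nat \<Rightarrow> nat \<Rightarrow> nat \<Rightarrow> state \<Rightarrow> state" where
  "nstore b i v s = s\<lparr>nmem := (nmem s)(b := (nmem s b)(i := v))\<rparr>"

definition rstore :: "nat \<Rightarrow> nat \<Rightarrow> real \<Rightarrow> state \<Rightarrow> state" where
  "rstore b i v s = s\<lparr>rmem := (rmem s)(b := (rmem s b)(i := v))\<rparr>"

text \<open>
  One step of computation. An expression is evaluated within a single step: its number of
  operators is a constant of the program, so this affects running times by a constant factor only.
\<close>

primrec step :: "com \<Rightarrow> state \<Rightarrow> (com \<times> state) pmf" where
  "step Skip s = return_pmf (Skip, s)"
| "step (NStore b a e) s = return_pmf (Skip, nstore b (nval a s) (nval e s) s)"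
| "step (RStore b a e) s = return_pmf (Skip, rstore b (nval a s) (rval e s) s)"
| "step (Toss b a) s =
     map_pmf (\<lambda>c. (Skip, nstore b (nval a s) (if c then 1 else 0) s)) (bernoulli_pmf (1 / 2))"
| "step (Emit e) s = return_pmf (Skip, s\<lparr>emitted := emitted s @ [nval e s]\<rparr>)"
| "step (Seq c d) s =
     (if c = Skip then return_pmf (d, s)
      else map_pmf (\<lambda>(c', s'). (Seq c' d, s')) (step c s))"
| "step (Cond b c d) s = return_pmf (if bval b s then c else d, s)"
| "step (While b c) s = return_pmf (if bval b s then Seq c (While b c) else Skip, s)"

primrec steps :: "nat \<Rightarrow> com \<Rightarrow> state \<Rightarrow> (com \<times> state) pmf" where
  "steps 0 c s = return_pmf (c, s)"
| "steps (Suc n) c s = bind_pmf (steps n c s) (\<lambda>(c', s'). step c' s')"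

definition halts_within :: "nat \<Rightarrow> com \<Rightarrow> state \<Rightarrow> bool" where
  "halts_within n c s \<longleftrightarrow> (\<forall>(c', s') \<in> set_pmf (steps n c s). c' = Skip)"

definition halts :: "com \<Rightarrow> state \<Rightarrow> bool" where
  "halts c s \<longleftrightarrow> (\<exists>n. halts_within n c s)"

text \<open>The worst case over all coin tosses; meaningful only if the program halts.\<close>

definition running_time :: "com \<Rightarrow> state \<Rightarrow> nat" where
  "running_time c s = (LEAST n. halts_within n c s)"

definition output_dist :: "com \<Rightarrow> state \<Rightarrow> nat list pmf" where
  "output_dist c s = map_pmf (\<lambda>(c', s'). emitted s') (steps (running_time c s) c s)"

text \<open>
  Natural bank 0 holds the input list, cell 0 of natural bank 1 its length, and cells 0 and 1 of real
  bank 0 the two real parameters. All other cells are zero.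
\<close>

definition init_state :: "real \<Rightarrow> real \<Rightarrow> nat list \<Rightarrow> state" where
  "init_state \<kappa> t xs =
     \<lparr>nmem = (\<lambda>b i. if b = 0 \<and> i < length xs then xs ! i
                    else if b = 1 \<and> i = 0 then length xs else 0),
      rmem = (\<lambda>b i. if b = 0 \<and> i = 0 then \<kappa> else if b = 0 \<and> i = 1 then t else 0),
      emitted = []\<rparr>"

section \<open>Trivariate polynomials, statistical distance, and the square root distribution\<close>

definition poly3 :: "real poly poly poly \<Rightarrow> real \<Rightarrow> real \<Rightarrow> real \<Rightarrow> real" where
  "poly3 P x y z = poly (poly (poly P [:[:x:]:]) [:y:]) z"

definition stat_dist :: "'a pmf \<Rightarrow> 'a pmf \<Rightarrow> real" where
  "stat_dist p q = (SUP A. \<bar>measure_pmf.prob p A - measure_pmf.prob q A\<bar>)"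

definition sqrt_pmf :: "'a pmf \<Rightarrow> 'a pmf" where
  "sqrt_pmf p = embed_pmf (\<lambda>i. sqrt (pmf p i) / (\<Sum>j\<in>set_pmf p. sqrt (pmf p j)))"

text \<open>For finite support, the function passed to \<^const>\<open>embed_pmf\<close> is indeed a probability vector.\<close>

lemma pmf_sqrt_pmf:
  assumes "finite (set_pmf p)"
  shows "pmf (sqrt_pmf p) i = sqrt (pmf p i) / (\<Sum>j\<in>set_pmf p. sqrt (pmf p j))"
proof -
  let ?S = "\<Sum>j\<in>set_pmf p. sqrt (pmf p j)"
  let ?f = "\<lambda>i. sqrt (pmf p i) / ?S"
  have S: "?S > 0"
    using assms set_pmf_not_empty[of p] by (intro sum_pos) (auto simp: pmf_positive_iff)
  have nonneg: "0 \<le> ?f i" for i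
    using S by simp
  have "(\<integral>\<^sup>+i. ennreal (?f i) \<partial>count_space UNIV)
      = (\<integral>\<^sup>+i. ennreal (?f i) \<partial>count_space (set_pmf p))"
    by (rule nn_integral_count_space_eq) (auto simp: set_pmf_iff)
  also have "\<dots> = (\<Sum>i\<in>set_pmf p. ennreal (?f i))"
    using assms by (rule nn_integral_count_space_finite)
  also have "\<dots> = ennreal (\<Sum>i\<in>set_pmf p. ?f i)"
    using nonneg by (intro sum_ennreal)
  also have "(\<Sum>i\<in>set_pmf p. ?f i) = 1"
    using S by (simp flip: sum_divide_distrib)
  finally show ?thesis
    unfolding sqrt_pmf_def by (intro pmf_embed_pmf nonneg) simp
qed

end

theory Submission
  imports Defs
begin

text \<open>
  The output is obtained by rejection: a fresh sample of value \<open>i\<close> is accepted with probability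
  proportional to \<open>p\<^sub>i\<^sup>-\<^sup>1\<^sup>/\<^sup>2\<close>, so that accepted samples follow the square root distribution. Such a coin
  is made from the number \<open>n\<close> of occurrences of \<open>i\<close> in a block of other samples: if \<open>n\<close> is Poisson
  distributed with mean \<open>\<mu>\<close>, then \<open>n! / \<Gamma>(n + 3/2)\<close> has expectation \<open>erf (\<surd>\<mu>) / \<surd>\<mu>\<close>, which is
  \<open>1 / \<surd>\<mu>\<close> up to a relative error \<open>e\<^sup>-\<^sup>\<mu>\<close>. Blocks of Poisson length make the counts of different values
  independent, so all values can share the same blocks, and only tries of equal value need different
  ones. A first part of the input provides a bound for the multiplicities of the tries, hence for the
  number of blocks. With \<open>\<Theta>(M / (\<kappa> t))\<close> tries the means \<open>\<mu>\<close> lie between \<open>\<kappa>\<close> and \<open>O(\<kappa> t)\<close>, and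
  the \<open>\<Theta>(M / (\<kappa> t)\<^sup>3\<^sup>/\<^sup>2)\<close> accepted samples suffice. Dyadic approximations of the uniform variates with
  \<open>\<kappa>\<close> bits, the truncation of the Poisson variates and all large deviations contribute errors
  exponentially small in \<open>\<kappa>\<close>.
\<close>

section \<open>A relational program logic for the random access machine\<close>

text \<open>The \<open>p_i\<close> are unknown and the machine neither rounds reals nor takes roots,
  so a coin of bias proportional to \<open>p_i^(-1/2)\<close> must come from counts by field
  operations alone. The quotient \<open>n! / \<Gamma>(n + 3/2)\<close> is the falling factorial
  \<open>n! / \<Gamma>(n + 1 - k)\<close> at \<open>k = -1/2\<close>: for natural \<open>k\<close>
  its Poisson mean is \<open>\<mu>^k\<close>, and at order -1/2 this power survives up to the factor
  \<open>erf\<close>. Scaled to be 1 at \<open>n = 0\<close> it is a probability, and a one-step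
  recursion computes it.

  Running time is the worst case over all coins, so no stage may wait for success: every loop is
  bounded in advance, and a shortage of accepted samples is made up with raw samples from the pool.
  The output thus always has length \<open>m\<close>. For \<open>N = 1\<close> this is essential,
  because \<open>ln N = 0\<close> then forces the exact law.

  The estimates need \<open>\<kappa> \<ge> 121\<close>; for smaller \<kappa> and
  \<open>N \<ge> 2\<close> the factor \<open>exp 61\<close> makes the claimed bound exceed
  1.\<close>

lemma steps_Suc_left: "steps (Suc n) c s = bind_pmf (step c s) (\<lambda>(c', s'). steps n c' s')"
proof (induction n)
  case 0
  have "bind_pmf (step c s) (\<lambda>(c', s'). return_pmf (c', s')) = step c s"
    by (simp add: bind_return_pmf')
  then show ?case by (simp add: bind_return_pmf)
next
  case (Suc n)
  have "steps (Suc (Suc n)) c s = bind_pmf (steps (Suc n) c s) (\<lambda>(c', s'). step c' s')"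
    by simp
  also have "\<dots> = bind_pmf (step c s) (\<lambda>(c', s'). steps (Suc n) c' s')"
    unfolding Suc.IH by (simp add: bind_assoc_pmf case_prod_unfold)
  finally show ?case .
qed

lemma steps_add: "steps (m + n) c s = bind_pmf (steps m c s) (\<lambda>(c', s'). steps n c' s')"
  by (induction m arbitrary: c s)
     (simp_all add: bind_return_pmf steps_Suc_left bind_assoc_pmf case_prod_unfold del: steps.simps(2))

lemma steps_Skip [simp]: "steps n Skip s = return_pmf (Skip, s)"
  by (induction n) (simp_all add: bind_return_pmf)

lemma steps_halted:
  assumes "halts_within k c s" "k \<le> n"
  shows "steps n c s = steps k c s"
proof -
  obtain d where n: "n = k + d"
    using assms(2) le_Suc_ex by blast
  have "steps n c s = bind_pmf (steps k c s) (\<lambda>(c', s'). steps d c' s')"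
    unfolding n by (rule steps_add)
  also have "\<dots> = bind_pmf (steps k c s) return_pmf"
    using assms(1) by (intro bind_pmf_cong) (auto simp: halts_within_def)
  finally show ?thesis by (simp add: bind_return_pmf')
qed

text \<open>\<open>Skip\<close> is absorbing, so runs of \<open>c\<close> that end early are padded
  up to time \<open>n\<close>. In the composition they start \<open>d\<close> early, and the surplus
  time is idle because \<open>d\<close> halts within \<open>k\<close>. The extra step discards the
  leading \<open>Skip\<close>.\<close>

lemma steps_Seq:
  assumes "halts_within n c s" "\<And>s'. (Skip, s') \<in> set_pmf (steps n c s) \<Longrightarrow> halts_within k d s'"
  shows "steps (Suc (n + k)) (Seq c d) s = bind_pmf (steps n c s) (\<lambda>(c', s'). steps k d s')"
  using assms
proof (induction n arbitrary: c s)
  case 0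
  then show ?case
    by (simp add: halts_within_def steps_Suc_left bind_return_pmf del: steps.simps(2))
next
  case (Suc n)
  show ?case
  proof (cases "c = Skip")
    case True
    then have "halts_within k d s"
      using Suc.prems(2) by simp
    then show ?thesis
      using True steps_halted[of k d s "Suc (n + k)"]
      by (simp add: steps_Suc_left bind_return_pmf del: steps.simps(2))
  next
    case False
    have IH: "steps (Suc (n + k)) (Seq c' d) s' = bind_pmf (steps n c' s') (\<lambda>(c', s'). steps k d s')"
      if "(c', s') \<in> set_pmf (step c s)" for c' s'
    proof (rule Suc.IH)
      show "halts_within n c' s'"
        using Suc.prems(1) that
        by (auto simp: halts_within_def steps_Suc_left simp del: steps.simps(2))
      show "halts_within k d s''" if "(Skip, s'') \<in> set_pmf (steps n c' s')" for s''
        using Suc.prems(2)[of s''] that \<open>(c', s') \<in> set_pmf (step c s)\<close>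
        by (force simp: steps_Suc_left simp del: steps.simps(2))
    qed
    have "steps (Suc (Suc n + k)) (Seq c d) s
        = bind_pmf (step c s) (\<lambda>(c', s'). steps (Suc (n + k)) (Seq c' d) s')"
      using False by (subst steps_Suc_left) (simp add: bind_map_pmf case_prod_unfold del: steps.simps(2))
    also have "\<dots> = bind_pmf (step c s) (\<lambda>(c', s'). bind_pmf (steps n c' s') (\<lambda>(c', s'). steps k d s'))"
      using IH by (intro bind_pmf_cong) (auto simp del: steps.simps(2))
    also have "\<dots> = bind_pmf (steps (Suc n) c s) (\<lambda>(c', s'). steps k d s')"
      by (simp add: steps_Suc_left bind_assoc_pmf case_prod_unfold del: steps.simps(2))
    finally show ?thesis .
  qed
qed

text \<open>
  The final state is coupled to an abstract result with law \<^term>\<open>D\<close>, so that the contents of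
  scratch cells need not be described.
\<close>

definition refines ::
    "com \<Rightarrow> state \<Rightarrow> nat \<Rightarrow> 'a pmf \<Rightarrow> (state \<Rightarrow> 'a \<Rightarrow> bool) \<Rightarrow> bool" where
  "refines c s n D Q \<longleftrightarrow> rel_pmf (\<lambda>(c', s') a. c' = Skip \<and> Q s' a) (steps n c s) D"

lemma refines_halts: "refines c s n D Q \<Longrightarrow> halts_within n c s"
  by (fastforce simp: refines_def halts_within_def dest!: rel_pmf_imp_rel_set dest: rel_setD1)

lemma refines_result:
  "refines c s n D Q \<Longrightarrow> (c', s') \<in> set_pmf (steps n c s) \<Longrightarrow> \<exists>a. Q s' a"
  by (auto simp: refines_def dest!: rel_pmf_imp_rel_set dest: rel_setD1)

lemma refines_mono:
  assumes "refines c s n D Q" "n \<le> n'"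
  shows "refines c s n' D Q"
  using assms steps_halted[OF refines_halts[OF assms(1)] assms(2)] by (simp add: refines_def)

lemma refines_conseq:
  assumes "refines c s n D Q" "\<And>s a. Q s a \<Longrightarrow> Q' s a"
  shows "refines c s n D Q'"
  using assms unfolding refines_def by (auto elim!: pmf.rel_mono_strong)

lemma refines_map:
  assumes "refines c s n D Q" "\<And>s a. Q s a \<Longrightarrow> Q' s (f a)"
  shows "refines c s n (map_pmf f D) Q'"
  using assms unfolding refines_def by (auto simp: pmf.rel_map elim!: pmf.rel_mono_strong)

lemma refines_Seq:
  assumes c: "refines c s n D Q" and d: "\<And>s' a. Q s' a \<Longrightarrow> refines d s' k (E a) Q'"
  shows "refines (Seq c d) s (Suc (n + k)) (bind_pmf D E) Q'"
proof -
  have "steps (Suc (n + k)) (Seq c d) s = bind_pmf (steps n c s) (\<lambda>(c', s'). steps k d s')"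
    using refines_halts[OF c] refines_result[OF c] d refines_halts by (intro steps_Seq) blast+
  moreover have "rel_pmf (\<lambda>(c', s') a. c' = Skip \<and> Q' s' a)
      (bind_pmf (steps n c s) (\<lambda>(c', s'). steps k d s')) (bind_pmf D E)"
    using d by (intro rel_pmf_bindI[OF c[unfolded refines_def]]) (auto simp: refines_def)
  ultimately show ?thesis by (simp add: refines_def)
qed

lemma refines_Seq_det:
  assumes "refines c s n (return_pmf x) (\<lambda>s' _. Q s')" "\<And>s'. Q s' \<Longrightarrow> refines d s' k E Q'"
  shows "refines (Seq c d) s (Suc (n + k)) E Q'"
  using refines_Seq[OF assms(1), of d k "\<lambda>_. E" Q'] assms(2) by (simp add: bind_return_pmf)

lemma refines_Skip: "Q s a \<Longrightarrow> refines Skip s 0 (return_pmf a) Q"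
  by (simp add: refines_def)

lemma refines_NStore: "Q (nstore b (nval a s) (nval e s) s) x \<Longrightarrow> refines (NStore b a e) s 1 (return_pmf x) Q"
  by (simp add: refines_def bind_return_pmf)

lemma refines_RStore: "Q (rstore b (nval a s) (rval e s) s) x \<Longrightarrow> refines (RStore b a e) s 1 (return_pmf x) Q"
  by (simp add: refines_def bind_return_pmf)

lemma refines_Emit: "Q (s\<lparr>emitted := emitted s @ [nval e s]\<rparr>) x \<Longrightarrow> refines (Emit e) s 1 (return_pmf x) Q"
  by (simp add: refines_def bind_return_pmf)

lemma refines_Toss:
  assumes "\<And>c. Q (nstore b (nval a s) (if c then 1 else 0) s) c"
  shows "refines (Toss b a) s 1 (bernoulli_pmf (1 / 2)) Q"
  using assms by (simp add: refines_def bind_return_pmf pmf.rel_map rel_pmf_reflI)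

lemma refines_Cond:
  "refines (if bval b s then c else d) s n D Q \<Longrightarrow> refines (Cond b c d) s (Suc n) D Q"
  by (simp add: refines_def steps_Suc_left bind_return_pmf del: steps.simps(2))

text \<open>One step performs the store and one discards the remaining \<open>Skip\<close>.\<close>

lemma refines_NStore_Seq:
  "refines d (nstore b (nval a s) (nval e s) s) n D Q \<Longrightarrow> refines (Seq (NStore b a e) d) s (Suc (Suc n)) D Q"
  using refines_Seq_det[of "NStore b a e" s 1 "()" "\<lambda>s'. s' = nstore b (nval a s) (nval e s) s" d n D Q]
    refines_NStore[of "\<lambda>s' _. s' = nstore b (nval a s) (nval e s) s" b a s e "()"] by simp

lemma refines_RStore_Seq:
  "refines d (rstore b (nval a s) (rval e s) s) n D Q \<Longrightarrow> refines (Seq (RStore b a e) d) s (Suc (Suc n)) D Q"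
  using refines_Seq_det[of "RStore b a e" s 1 "()" "\<lambda>s'. s' = rstore b (nval a s) (rval e s) s" d n D Q]
    refines_RStore[of "\<lambda>s' _. s' = rstore b (nval a s) (rval e s) s" b a s e "()"] by simp

lemma refines_Emit_Seq:
  "refines d (s\<lparr>emitted := emitted s @ [nval e s]\<rparr>) n D Q \<Longrightarrow> refines (Seq (Emit e) d) s (Suc (Suc n)) D Q"
  using refines_Seq_det[of "Emit e" s 1 "()" "\<lambda>s'. s' = s\<lparr>emitted := emitted s @ [nval e s]\<rparr>" d n D Q]
    refines_Emit[of "\<lambda>s' _. s' = s\<lparr>emitted := emitted s @ [nval e s]\<rparr>" s e "()"] by simp

text \<open>The successor state gets a name, so that a long chain of updates does not grow into one
  nested term.\<close>

lemma refines_NStore_Seq_eq: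
  "(\<And>s'. s' = nstore b (nval a s) (nval e s) s \<Longrightarrow> refines d s' n D Q)
    \<Longrightarrow> refines (Seq (NStore b a e) d) s (Suc (Suc n)) D Q"
  by (rule refines_NStore_Seq) simp

lemma refines_RStore_Seq_eq:
  "(\<And>s'. s' = rstore b (nval a s) (rval e s) s \<Longrightarrow> refines d s' n D Q)
    \<Longrightarrow> refines (Seq (RStore b a e) d) s (Suc (Suc n)) D Q"
  by (rule refines_RStore_Seq) simp

text \<open>The body receives the number of the round, so that each try can have its own acceptance
  probability.\<close>

primrec iter :: "(nat \<Rightarrow> 'a \<Rightarrow> 'a pmf) \<Rightarrow> nat \<Rightarrow> 'a \<Rightarrow> 'a pmf" where
  "iter B 0 a = return_pmf a"
| "iter B (Suc n) a = bind_pmf (B 0 a) (iter (\<lambda>k. B (Suc k)) n)"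

lemma iter_Suc_right: "iter B (Suc n) a = bind_pmf (iter B n a) (B n)"
proof (induction n arbitrary: B a)
  case 0
  have "iter (\<lambda>k. B (Suc k)) 0 = return_pmf"
    by (rule ext) simp
  then show ?case by (simp add: bind_return_pmf bind_return_pmf' del: iter.simps(1))
     (simp add: bind_return_pmf)
next
  case (Suc n)
  have "iter (\<lambda>k. B (Suc k)) (Suc n) = (\<lambda>b. bind_pmf (iter (\<lambda>k. B (Suc k)) n b) (B (Suc n)))"
    by (rule ext) (rule Suc.IH)
  then have "iter B (Suc (Suc n)) a
      = bind_pmf (B 0 a) (\<lambda>b. bind_pmf (iter (\<lambda>k. B (Suc k)) n b) (B (Suc n)))"
    by (subst iter.simps(2)) simp
  also have "\<dots> = bind_pmf (iter B (Suc n) a) (B (Suc n))"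
    by (simp add: bind_assoc_pmf)
  finally show ?case .
qed

lemma iter_return [simp]: "iter (\<lambda>_. return_pmf) n a = return_pmf a"
  by (induction n) (simp_all add: bind_return_pmf)

text \<open>A round costs the successful test, the body and the removal of \<open>Skip\<close>; the
  last step is the failing test. The number of rounds is fixed beforehand, whereas the body may be
  random.\<close>

lemma refines_While:
  assumes "\<And>k s a. k < n \<Longrightarrow> I k s a \<Longrightarrow> bval b s \<and> refines c s T (B k a) (I (Suc k))"
    and "\<And>s a. I n s a \<Longrightarrow> \<not> bval b s"
    and "I 0 s a"
  shows "refines (While b c) s (n * (T + 2) + 1) (iter B n a) (I n)"
  using assms
proof (induction n arbitrary: I B s a)
  case 0
  then have "\<not> bval b s" by blast
  then show ?case
    using 0 by (simp add: refines_def bind_return_pmf)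
next
  case (Suc n)
  have "bval b s" and body: "refines c s T (B 0 a) (I 1)"
    using Suc.prems(1)[of 0 s a] Suc.prems(3) by auto
  have "refines (While b c) s' (n * (T + 2) + 1) (iter (\<lambda>k. B (Suc k)) n a') (I (Suc n))"
    if "I 1 s' a'" for s' a'
  proof (rule Suc.IH[where I = "\<lambda>k. I (Suc k)"])
    show "bval b s \<and> refines c s T (B (Suc k) a) (I (Suc (Suc k)))" if "k < n" "I (Suc k) s a" for k s a
      using that by (intro Suc.prems(1)) simp
    show "\<not> bval b s" if "I (Suc n) s a" for s a
      using that by (rule Suc.prems(2))
    show "I (Suc 0) s' a'"
      using that by simp
  qed
  then have "refines (Seq c (While b c)) s (Suc (T + (n * (T + 2) + 1))) (iter B (Suc n) a) (I (Suc n))"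
    by (simp only: iter.simps) (intro refines_Seq[OF body], simp_all)
  then have "refines (While b c) s (Suc (Suc (T + (n * (T + 2) + 1)))) (iter B (Suc n) a) (I (Suc n))"
    using \<open>bval b s\<close> by (simp add: refines_def steps_Suc_left[of _ "While b c"] bind_return_pmf del: steps.simps(2))
  then show ?case by (simp add: algebra_simps)
qed

lemma refines_While_det:
  assumes "\<And>k s. k < n \<Longrightarrow> I k s \<Longrightarrow> bval b s \<and> refines c s T (return_pmf ()) (\<lambda>s' _. I (Suc k) s')"
    and "\<And>s. I n s \<Longrightarrow> \<not> bval b s"
    and "I 0 s"
  shows "refines (While b c) s (n * (T + 2) + 1) (return_pmf ()) (\<lambda>s' _. I n s')"
  using refines_While[where I = "\<lambda>k s _. I k s" and B = "\<lambda>_. return_pmf" and n = n and a = "()"] assms by simp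

lemma running_time_le: "refines c s n D Q \<Longrightarrow> running_time c s \<le> n"
  unfolding running_time_def by (intro Least_le refines_halts)

text \<open>\<open>output_dist\<close> looks at the least halting time, \<open>refines\<close> at
  some upper bound for it. The laws agree since nothing changes after halting, and a coupling along
  equality forces equality.\<close>

lemma output_dist_eq:
  assumes "refines c s n D (\<lambda>s' ys. emitted s' = ys)"
  shows "output_dist c s = D"
proof -
  have "halts_within (running_time c s) c s"
    unfolding running_time_def using refines_halts[OF assms] by (rule LeastI)
  then have "steps n c s = steps (running_time c s) c s"
    using running_time_le[OF assms] by (intro steps_halted)
  then have "rel_pmf (=) (map_pmf (\<lambda>(c', s'). emitted s') (steps (running_time c s) c s)) D"
    using assms unfolding refines_def by (auto simp: pmf.rel_map elim!: pmf.rel_mono_strong)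
  then show ?thesis
    by (simp add: pmf.rel_eq output_dist_def)
qed

lemma nmem_nstore [simp]: "nmem (nstore b i v s) = (nmem s)(b := (nmem s b)(i := v))"
  and rmem_nstore [simp]: "rmem (nstore b i v s) = rmem s"
  and emitted_nstore [simp]: "emitted (nstore b i v s) = emitted s"
  and nmem_rstore [simp]: "nmem (rstore b i w s) = nmem s"
  and rmem_rstore [simp]: "rmem (rstore b i w s) = (rmem s)(b := (rmem s b)(i := w))"
  and emitted_rstore [simp]: "emitted (rstore b i w s) = emitted s"
  by (simp_all add: nstore_def rstore_def)

section \<open>The algorithm\<close>

abbreviation nvar :: "nat \<Rightarrow> nexp" where "nvar b \<equiv> NRead b (NLit 0)"
abbreviation rvar :: "nat \<Rightarrow> rexp" where "rvar b \<equiv> RRead b (NLit 0)"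
abbreviation nset :: "nat \<Rightarrow> nexp \<Rightarrow> com" where "nset b \<equiv> NStore b (NLit 0)"
abbreviation rset :: "nat \<Rightarrow> rexp \<Rightarrow> com" where "rset b \<equiv> RStore b (NLit 0)"
abbreviation rlit :: "nat \<Rightarrow> rexp" where "rlit n \<equiv> RNat (NLit n)"
abbreviation ninc :: "nat \<Rightarrow> com" where "ninc b \<equiv> nset b (NAdd (nvar b) (NLit 1))"
notation Seq (infixr ";;" 60)

text \<open>
  The first part of the input (as many samples as there will be tries) only serves to find the number
  of blocks; the second part consists of the tries; the rest is the pool for the block counts.

  Natural banks: 2 the number of tries, 3 the value counts in the first part, 4 their maximum and later
  the number of blocks, 5 the mean block length, 6 the address stride, 8 the cutoff of the Poisson
  variates, 9 the coin, 11 the block counts, 12 the address offset of the current block 13, 14 the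
  position in the pool, 16 the address offset of the next try of each value, 17 the position of the
  current try, 18 the length of the output; 7, 10 and 15 are loop counters. Real banks: 1 the
  normalization of the Poisson weights, 2 the current weight, 3 the partial sum of the weights,
  4 the uniform variate, 6 the acceptance data of the block counts.
\<close>

definition draw_com :: com where
  "draw_com =
     rset 4 (rlit 0);;
     nset 10 (NLit 0);;
     While (RLess (RNat (nvar 10)) (rvar 0))
       (Toss 9 (NLit 0);;
        rset 4 (RDiv (RAdd (rvar 4) (RNat (nvar 9))) (rlit 2));;
        ninc 10)"

text \<open>Without rounding, the floor of \<open>M / (72 * \<kappa> * t)\<close> is found by
  counting up while a real comparison holds; the samples of the first part are counted in the same
  loop.\<close>

definition scan_com :: com where
  "scan_com =
     While (BNot (RLess (RNat (nvar 1))
         (RMul (RMul (RMul (RNat (NAdd (nvar 2) (NLit 1))) (rlit 72)) (rvar 0)) (RRead 0 (NLit 1)))))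
       (NStore 3 (NRead 0 (nvar 2)) (NAdd (NRead 3 (NRead 0 (nvar 2))) (NLit 1));;
        Cond (NLess (nvar 4) (NRead 3 (NRead 0 (nvar 2)))) (nset 4 (NRead 3 (NRead 0 (nvar 2)))) Skip;;
        ninc 2)"

text \<open>The factor 4 is spelled out by additions, and the quotient \<open>M div (4 * R)\<close>
  is found by counting up with the product taken among the reals.\<close>

definition block_com :: com where
  "block_com =
     nset 4 (NAdd (NLit 1) (NAdd (NAdd (nvar 4) (nvar 4)) (NAdd (nvar 4) (nvar 4))));;
     While (BNot (RLess (RNat (nvar 1))
         (RMul (RMul (RNat (NAdd (nvar 5) (NLit 1))) (RNat (nvar 4))) (rlit 4))))
       (ninc 5)"

text \<open>One plus the sum of the input exceeds every entry, so pairs of a block number and a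
  value get distinct addresses. Multiples of the stride are later formed by repeated
  addition.\<close>

definition stride_com :: com where
  "stride_com =
     nset 6 (NLit 1);;
     While (NLess (nvar 7) (nvar 1))
       (nset 6 (NAdd (nvar 6) (NRead 0 (nvar 7)));;
        ninc 7)"

definition weights_com :: com where
  "weights_com =
     rset 1 (rlit 1);;
     rset 2 (rlit 1);;
     While (RLess (RNat (nvar 8)) (RAdd (RNat (NAdd (nvar 5) (nvar 5))) (RAdd (rvar 0) (rvar 0))))
       (ninc 8;;
        rset 2 (RDiv (RMul (rvar 2) (RNat (nvar 5))) (RNat (nvar 8)));;
        rset 1 (RAdd (rvar 1) (rvar 2)))"

abbreviation pool_addr :: nexp where "pool_addr \<equiv> NAdd (nvar 12) (NRead 0 (nvar 14))"

text \<open>Inversion of the cumulative Poisson weights is interleaved with reading the block: every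
  weight that fails to exceed the uniform variate consumes one pool sample and updates the
  acceptance data of its value.\<close>

definition consume_com :: com where
  "consume_com =
     While (BNot (RLess (RMul (rvar 4) (rvar 1)) (rvar 3)))
       (ninc 15;;
        rset 2 (RDiv (RMul (rvar 2) (RNat (nvar 5))) (RNat (nvar 15)));;
        rset 3 (RAdd (rvar 3) (rvar 2));;
        RStore 6 pool_addr
          (RSub (rlit 1)
             (RDiv (RMul (RSub (rlit 1) (RRead 6 pool_addr)) (RNat (NAdd (NRead 11 pool_addr) (NLit 1))))
                   (RAdd (RNat (NRead 11 pool_addr)) (RDiv (rlit 3) (rlit 2)))));;
        NStore 11 pool_addr (NAdd (NRead 11 pool_addr) (NLit 1));;
        ninc 14)"

definition pool_com :: com where
  "pool_com =
     nset 14 (NAdd (nvar 2) (nvar 2));;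
     While (NLess (nvar 13) (nvar 4))
       (draw_com;;
        nset 15 (NLit 0);;
        rset 2 (rlit 1);;
        rset 3 (rlit 1);;
        consume_com;;
        nset 12 (NAdd (nvar 12) (nvar 6));;
        ninc 13)"

text \<open>The output is shorter than \<open>M / (16 \<kappa>\<^sup>3 t\<^sup>3\<^sup>/\<^sup>2)\<close>; squaring avoids the root.\<close>

definition more_test :: bexp where
  "more_test = BNot (RLess (RMul (RNat (nvar 1)) (RNat (nvar 1)))
     (RMul (RMul (RMul (RNat (NAdd (nvar 18) (NLit 1))) (RNat (NAdd (nvar 18) (NLit 1)))) (rlit 256))
       (RMul (RMul (RMul (rvar 0) (rvar 0)) (RMul (RMul (rvar 0) (rvar 0)) (RMul (rvar 0) (rvar 0))))
             (RMul (RRead 0 (NLit 1)) (RMul (RRead 0 (NLit 1)) (RRead 0 (NLit 1)))))))"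

definition tries_com :: com where
  "tries_com =
     nset 17 (nvar 2);;
     While (NLess (nvar 17) (NAdd (nvar 2) (nvar 2)))
       (draw_com;;
        Cond (RLess (rvar 4)
            (RSub (rlit 1) (RRead 6 (NAdd (NRead 0 (nvar 17)) (NRead 16 (NRead 0 (nvar 17)))))))
          (Cond more_test (Emit (NRead 0 (nvar 17));; ninc 18) Skip)
          Skip;;
        NStore 16 (NRead 0 (nvar 17)) (NAdd (NRead 16 (NRead 0 (nvar 17))) (nvar 6));;
        ninc 17)"

text \<open>The filler has the wrong law, which matters only in the rare event of too few
  acceptances. It is taken from positions after all tries, so no input position is emitted
  twice.\<close>

definition fill_com :: com where
  "fill_com =
     nset 14 (NAdd (nvar 2) (nvar 2));;
     While more_test
       (Emit (NRead 0 (nvar 14));;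
        ninc 14;;
        ninc 18)"

definition sampler :: com where
  "sampler = scan_com;; block_com;; stride_com;; weights_com;; pool_com;; tries_com;; fill_com"

section \<open>The output distribution\<close>

definition draw_pmf :: "nat \<Rightarrow> real pmf" where
  "draw_pmf n = iter (\<lambda>_ u. map_pmf (\<lambda>c. (u + (if c then 1 else 0)) / 2) (bernoulli_pmf (1 / 2))) n 0"

primrec mapM_pmf :: "('a \<Rightarrow> 'b pmf) \<Rightarrow> 'a list \<Rightarrow> 'b list pmf" where
  "mapM_pmf f [] = return_pmf []"
| "mapM_pmf f (x # xs) = bind_pmf (f x) (\<lambda>y. map_pmf (Cons y) (mapM_pmf f xs))"

lemma mapM_pmf_append_single:
  "mapM_pmf f (xs @ [x]) = bind_pmf (mapM_pmf f xs) (\<lambda>ys. map_pmf (\<lambda>y. ys @ [y]) (f x))"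
  by (induction xs)
     (simp_all add: bind_return_pmf map_pmf_def bind_assoc_pmf)

lemma iter_append: "iter (\<lambda>k ys. map_pmf (\<lambda>y. ys @ [y]) (f k)) n [] = mapM_pmf f [0..<n]"
  by (induction n) (simp_all add: iter_Suc_right mapM_pmf_append_single del: iter.simps(2))

lemma replicate_pmf_eq_mapM: "replicate_pmf (length xs) p = mapM_pmf (\<lambda>_. p) xs"
  by (induction xs) (simp_all add: map_pmf_def)

lemma mapM_pmf_map: "mapM_pmf f (map g xs) = mapM_pmf (f \<circ> g) xs"
  by (induction xs) simp_all

text \<open>This is \<open>\<Gamma>(3/2) n! / \<Gamma>(n + 3/2)\<close>.\<close>

primrec accept_prob :: "nat \<Rightarrow> real" where
  "accept_prob 0 = 1"
| "accept_prob (Suc n) = accept_prob n * (real n + 1) / (real n + 3 / 2)"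

definition partial_exp :: "nat \<Rightarrow> nat \<Rightarrow> real" where
  "partial_exp G k = (\<Sum>j\<le>k. real G ^ j / fact j)"

text \<open>The quantile function of the Poisson law with mean \<open>G\<close> truncated at
  \<open>K\<close>. The weights stay unnormalized, which avoids the exponential.\<close>

definition inverse_cdf :: "nat \<Rightarrow> nat \<Rightarrow> real \<Rightarrow> nat" where
  "inverse_cdf G K u = (LEAST k. u * partial_exp G K < partial_exp G k)"

primrec blocks :: "(nat \<Rightarrow> 'a) \<Rightarrow> nat \<Rightarrow> nat list \<Rightarrow> 'a list list" where
  "blocks f p [] = []"
| "blocks f p (w # ws) = map f [p..<p + w] # blocks f (p + w) ws"

text \<open>The value 0 for a missing block matches memory cells that were never written.\<close>

definition cell :: "'a list list \<Rightarrow> nat \<Rightarrow> 'a \<Rightarrow> nat" where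
  "cell bs r x = (if r < length bs then count_list (bs ! r) x else 0)"

definition try_counts :: "'a list list \<Rightarrow> 'a list \<Rightarrow> nat list" where
  "try_counts bs ys = map (\<lambda>j. cell bs (count_list (take j ys) (ys ! j)) (ys ! j)) [0..<length ys]"

definition accepted :: "'a list \<Rightarrow> bool list \<Rightarrow> 'a list" where
  "accepted ys cs = map fst (filter snd (zip ys cs))"

definition max_count :: "'a list \<Rightarrow> nat" where
  "max_count xs = Max (range (count_list xs))"

text \<open>The default 0 is the content of memory beyond the input; it is read only when the block
  lengths overrun the pool.\<close>

definition nth0 :: "nat list \<Rightarrow> nat \<Rightarrow> nat" where
  "nth0 xs i = (if i < length xs then xs ! i else 0)"

text \<open>The constant is \<open>72 = 2 * 36\<close>: once \<open>R \<le> 9 * J * P\<close> for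
  the largest probability \<open>P\<close>, the block mean \<open>G\<close>, about
  \<open>M / (4 * R)\<close>, satisfies \<open>G * P \<ge> 2 * \<kappa> * t - P\<close>.\<close>

definition num_tries :: "real \<Rightarrow> real \<Rightarrow> nat \<Rightarrow> nat" where
  "num_tries \<kappa> t M = nat \<lfloor>real M / (72 * \<kappa> * t)\<rfloor>"

text \<open>With high probability the maximal count in the first part is at least half its mean
  \<open>J * P\<close>, so four times this count is at least \<open>2 * J * P\<close>, which bounds
  the multiplicities of the tries. The summand 1 keeps the number positive.\<close>

definition num_blocks :: "'a list \<Rightarrow> nat" where
  "num_blocks xs = 4 * max_count xs + 1"

definition num_out :: "real \<Rightarrow> real \<Rightarrow> nat \<Rightarrow> nat" where
  "num_out \<kappa> t M = nat \<lfloor>real M / (16 * \<kappa> ^ 3 * t powr (3 / 2))\<rfloor>"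

text \<open>Chosen for the base 2 tail bound \<open>exp G / 2 ^ Suc K\<close>: as
  \<open>ln 2 \<ge> 2 / 3\<close>, its exponent is at most
  \<open>G - 4 / 3 * (G + \<kappa>)\<close>.\<close>

definition cutoff :: "real \<Rightarrow> nat \<Rightarrow> nat" where
  "cutoff \<kappa> G = nat \<lceil>2 * real G + 2 * \<kappa>\<rceil>"

definition sampler_pmf :: "real \<Rightarrow> real \<Rightarrow> nat list \<Rightarrow> nat list pmf" where
  "sampler_pmf \<kappa> t xs =
     (let J = num_tries \<kappa> t (length xs);
          R = num_blocks (take J xs);
          G = length xs div (4 * R);
          ys = take J (drop J xs)
      in bind_pmf (replicate_pmf R (map_pmf (inverse_cdf G (cutoff \<kappa> G)) (draw_pmf (nat \<lceil>\<kappa>\<rceil>))))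
           (\<lambda>ws. bind_pmf (mapM_pmf (\<lambda>n. map_pmf (\<lambda>u. u < accept_prob n) (draw_pmf (nat \<lceil>\<kappa>\<rceil>)))
                             (try_counts (blocks (nth0 xs) (2 * J) ws) ys))
           (\<lambda>cs. return_pmf (take (num_out \<kappa> t (length xs)) (accepted ys cs @ drop (2 * J) xs)))))"

lemma blocks_append_single:
  "blocks f p (ws @ [w]) = blocks f p ws @ [map f [p + sum_list ws..<p + sum_list ws + w]]"
  by (induction ws arbitrary: p) (simp_all add: add.assoc)

lemma length_blocks [simp]: "length (blocks f p ws) = length ws"
  by (induction ws arbitrary: p) simp_all

lemma cell_append_Nil [simp]: "cell (bs @ [[]]) = cell bs"
  by (auto simp: cell_def nth_append fun_eq_iff less_Suc_eq)

lemma cell_append_snoc: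
  "cell (bs @ [ys @ [y]]) r x = cell (bs @ [ys]) r x + (if r = length bs \<and> x = y then 1 else 0)"
  by (auto simp: cell_def nth_append)

lemma max_count_Nil [simp]: "max_count [] = 0"
  by (simp add: max_count_def image_def)

lemma finite_range_count_list: "finite (range (count_list xs))"
  by (rule finite_subset[of _ "{..length xs}"]) (auto intro: count_le_length)

lemma count_list_le_max_count: "count_list xs x \<le> max_count xs"
  unfolding max_count_def using finite_range_count_list by (intro Max_ge) auto

lemma max_count_obtains: obtains x where "max_count xs = count_list xs x"
  using Max_in[OF finite_range_count_list[of xs]] unfolding max_count_def by auto

lemma max_count_snoc: "max_count (xs @ [x]) = max (max_count xs) (count_list (xs @ [x]) x)"
proof (rule antisym)
  obtain y where y: "max_count (xs @ [x]) = count_list (xs @ [x]) y"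
    using max_count_obtains .
  show "max_count (xs @ [x]) \<le> max (max_count xs) (count_list (xs @ [x]) x)"
    using count_list_le_max_count[of xs y] unfolding y by (cases "y = x") auto
  obtain z where z: "max_count xs = count_list xs z"
    using max_count_obtains .
  show "max (max_count xs) (count_list (xs @ [x]) x) \<le> max_count (xs @ [x])"
    using count_list_le_max_count[of "xs @ [x]" x] count_list_le_max_count[of "xs @ [x]" z]
    unfolding z by auto
qed

lemma max_count_le: "max_count xs \<le> length xs"
  using max_count_obtains[of xs] count_le_length[of xs] by metis

lemma accepted_snoc:
  "length cs = length ys \<Longrightarrow> accepted (ys @ [y]) (cs @ [c]) = accepted ys cs @ (if c then [y] else [])"
  by (simp add: accepted_def)

lemma partial_exp_pos: "0 < partial_exp G k"
proof -
  have "0 < (\<Sum>j\<in>{0}. real G ^ j / fact j)" by simp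
  also have "\<dots> \<le> partial_exp G k"
    unfolding partial_exp_def by (intro sum_mono2) auto
  finally show ?thesis .
qed

lemma inverse_cdf_props:
  assumes "u < 1"
  shows "u * partial_exp G K < partial_exp G (inverse_cdf G K u)" "inverse_cdf G K u \<le> K"
proof -
  have *: "u * partial_exp G K < partial_exp G K"
    using assms partial_exp_pos[of G K] by simp
  show "u * partial_exp G K < partial_exp G (inverse_cdf G K u)"
    unfolding inverse_cdf_def by (rule LeastI, rule *)
  show "inverse_cdf G K u \<le> K"
    unfolding inverse_cdf_def by (rule Least_le, rule *)
qed

lemma num_out_iff:
  fixes \<kappa> t :: real
  assumes "\<kappa> \<ge> 2" "t \<ge> 1"
  shows "e < num_out \<kappa> t M \<longleftrightarrow>
    \<not> real M * real M < (real e + 1) * (real e + 1) * 256 * (\<kappa> * \<kappa> * (\<kappa> * \<kappa> * (\<kappa> * \<kappa>)) * (t * (t * t)))"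
proof -
  let ?c = "16 * \<kappa> ^ 3 * t powr (3 / 2)"
  have c: "?c > 0" using assms by simp
  have sq: "(t powr (3 / 2))\<^sup>2 = t ^ 3"
    using assms powr_realpow[of t 3] by (simp add: power2_eq_square flip: powr_add)
  have "e < num_out \<kappa> t M \<longleftrightarrow> int (Suc e) \<le> \<lfloor>real M / ?c\<rfloor>"
    unfolding num_out_def by linarith
  also have "\<dots> \<longleftrightarrow> (real e + 1) * ?c \<le> real M"
    using c by (simp add: le_floor_iff pos_le_divide_eq add.commute)
  also have "\<dots> \<longleftrightarrow> ((real e + 1) * ?c)\<^sup>2 \<le> (real M)\<^sup>2"
    using assms by (intro power_mono_iff[symmetric]) auto
  also have "((real e + 1) * ?c)\<^sup>2 = (real e + 1) * (real e + 1) * 256 * (\<kappa> ^ 6 * t ^ 3)"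
    unfolding power_mult_distrib sq by (simp add: power2_eq_square flip: power_mult power_add)
  also have "\<kappa> ^ 6 * t ^ 3 = \<kappa> * \<kappa> * (\<kappa> * \<kappa> * (\<kappa> * \<kappa>)) * (t * (t * t))"
    by (simp add: numeral_eq_Suc mult.assoc)
  finally show ?thesis
    by (simp add: not_less power2_eq_square)
qed

section \<open>Correctness of the algorithm\<close>

text \<open>A frame condition listing the banks that may have changed. It leaves the output free,
  unlike \<open>same\<close>, and so remains usable once samples are emitted.\<close>

definition agree :: "nat set \<Rightarrow> nat set \<Rightarrow> state \<Rightarrow> state \<Rightarrow> bool" where
  "agree A B s s' \<longleftrightarrow> (\<forall>b. b \<notin> A \<longrightarrow> nmem s' b = nmem s b) \<and> (\<forall>b. b \<notin> B \<longrightarrow> rmem s' b = rmem s b)"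

definition same :: "nat set \<Rightarrow> nat set \<Rightarrow> state \<Rightarrow> state \<Rightarrow> bool" where
  "same A B s s' \<longleftrightarrow> agree A B s s' \<and> emitted s' = emitted s"

lemma agree_nmem: "agree A B s s' \<Longrightarrow> b \<notin> A \<Longrightarrow> nmem s' b = nmem s b"
  and agree_rmem: "agree A B s s' \<Longrightarrow> b \<notin> B \<Longrightarrow> rmem s' b = rmem s b"
  and same_nmem: "same A B s s' \<Longrightarrow> b \<notin> A \<Longrightarrow> nmem s' b = nmem s b"
  and same_rmem: "same A B s s' \<Longrightarrow> b \<notin> B \<Longrightarrow> rmem s' b = rmem s b"
  and same_emitted: "same A B s s' \<Longrightarrow> emitted s' = emitted s"
  by (simp_all add: agree_def same_def)

lemma same_refl: "same A B s s"
  by (simp add: same_def agree_def)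

lemma draw_com_refines:
  assumes S: "S = nat \<lceil>rmem s 0 0\<rceil>"
  shows "refines draw_com s (7 * S + 5) (draw_pmf S)
    (\<lambda>s' u. same {9, 10} {4} s s' \<and> rmem s' 4 0 = u \<and> 0 \<le> u \<and> u < 1)"
proof -
  define I where "I = (\<lambda>k s' u. same {9, 10} {4} s s' \<and> nmem s' 10 0 = k \<and> rmem s' 4 0 = u \<and> 0 \<le> u \<and> u < (1::real))"
  let ?b = "RLess (RNat (nvar 10)) (rvar 0)"
  let ?c = "Toss 9 (NLit 0);; rset 4 (RDiv (RAdd (rvar 4) (RNat (nvar 9))) (rlit 2));; ninc 10"
  let ?B = "\<lambda>(_::nat) u. map_pmf (\<lambda>c. (u + (if c then 1 else 0)) / (2::real)) (bernoulli_pmf (1 / 2))"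
  have body: "bval ?b s' \<and> refines ?c s' 5 (?B k u) (I (Suc k))" if "k < S" "I k s' u" for k s' u
  proof
    have r: "rmem s' 0 = rmem s 0"
      using that(2) by (auto simp: I_def intro: same_rmem)
    show "bval ?b s'"
      using that r unfolding S I_def by simp linarith
    have "refines ?c s' (Suc (1 + Suc (Suc 1)))
        (bind_pmf (bernoulli_pmf (1 / 2)) (\<lambda>c. return_pmf ((u + (if c then 1 else 0)) / 2))) (I (Suc k))"
    proof (rule refines_Seq[OF refines_Toss[where Q = "\<lambda>s'' c. s'' = nstore 9 0 (if c then 1 else 0) s'"]])
      show "refines (rset 4 (RDiv (RAdd (rvar 4) (RNat (nvar 9))) (rlit 2));; ninc 10) s'' (Suc (Suc 1))
          (return_pmf ((u + (if c then 1 else 0)) / 2)) (I (Suc k))"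
        if s'': "s'' = nstore 9 0 (if c then 1 else 0) s'" for s'' c
        using \<open>I k s' u\<close> unfolding I_def s''
        by (intro refines_RStore_Seq refines_NStore) (auto simp: same_def agree_def)
    qed simp
    then show "refines ?c s' 5 (?B k u) (I (Suc k))"
      by (simp add: map_pmf_def numeral_eq_Suc)
  qed
  have "refines draw_com s (Suc (Suc (Suc (Suc (S * (5 + 2) + 1))))) (draw_pmf S) (I S)"
    unfolding draw_com_def draw_pmf_def
  proof (intro refines_RStore_Seq refines_NStore_Seq refines_While)
    show "bval ?b s' \<and> refines ?c s' 5 (?B k u) (I (Suc k))" if "k < S" "I k s' u" for k s' u
      using body that .
    show "\<not> bval ?b s'" if "I S s' u" for s' u
    proof -
      have "rmem s' 0 = rmem s 0"
        using that by (auto simp: I_def intro: same_rmem)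
      then show ?thesis
        using that unfolding I_def S by simp linarith
    qed
  qed (simp add: I_def same_def agree_def)
  then show ?thesis
    by (rule refines_conseq[OF refines_mono]) (auto simp: I_def)
qed

text \<open>The derived quantities are parameters tied down by equations, so that they act as atoms
  in the program proofs.\<close>

locale sampler_input =
  fixes \<kappa> t :: real and xs :: "nat list" and M J R G K S stride m :: nat and ys :: "nat list"
  assumes \<kappa>: "\<kappa> \<ge> 2" and t: "t \<ge> 1"
    and M_eq: "M = length xs"
    and J_eq: "J = num_tries \<kappa> t M"
    and R_eq: "R = num_blocks (take J xs)"
    and G_eq: "G = M div (4 * R)"
    and K_eq: "K = cutoff \<kappa> G"
    and S_eq: "S = nat \<lceil>\<kappa>\<rceil>"
    and stride_eq: "stride = Suc (sum_list xs)"
    and ys_eq: "ys = take J (drop J xs)"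
    and m_eq: "m = num_out \<kappa> t M"
begin

abbreviation "s0 \<equiv> init_state \<kappa> t xs"

lemma init [simp]:
  "nmem s0 0 = nth0 xs" "nmem s0 (Suc 0) 0 = M" "b \<ge> 2 \<Longrightarrow> nmem s0 b i = 0"
  "rmem s0 0 0 = \<kappa>" "rmem s0 0 (Suc 0) = t" "b \<ge> 1 \<Longrightarrow> rmem s0 b i = 0" "emitted s0 = []"
  by (auto simp: init_state_def nth0_def fun_eq_iff M_eq)

lemma J_less_iff: "k < J \<longleftrightarrow> \<not> real M < (real k + 1) * 72 * \<kappa> * t"
proof -
  have c: "72 * \<kappa> * t > 0" using \<kappa> t by simp
  have "k < J \<longleftrightarrow> int (Suc k) \<le> \<lfloor>real M / (72 * \<kappa> * t)\<rfloor>"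
    unfolding J_eq num_tries_def by linarith
  also have "\<dots> \<longleftrightarrow> (real k + 1) * (72 * \<kappa> * t) \<le> real M"
    using c by (simp add: le_floor_iff pos_le_divide_eq add.commute)
  also have "(real k + 1) * (72 * \<kappa> * t) = (real k + 1) * 72 * \<kappa> * t"
    by (simp only: mult.assoc)
  finally show ?thesis by (simp only: not_less)
qed

lemma J_le: "144 * J \<le> M"
proof (cases "J = 0")
  case False
  then obtain k where k: "J = Suc k" by (cases J) auto
  then have "\<not> real M < (real k + 1) * 72 * \<kappa> * t"
    using J_less_iff[of k] by simp
  moreover have "(real k + 1) * 72 * 2 * 1 \<le> (real k + 1) * 72 * \<kappa> * t"
    using \<kappa> t by (intro mult_mono) auto
  ultimately have "real (144 * J) \<le> real M" unfolding k by simp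
  then show ?thesis by linarith
qed simp

lemma m_le: "128 * m \<le> M"
proof -
  have "128 \<le> 16 * \<kappa> ^ 3 * t powr (3 / 2)"
  proof -
    have "16 * 2 ^ 3 * 1 \<le> 16 * \<kappa> ^ 3 * t powr (3 / 2)"
      using \<kappa> t by (intro mult_mono power_mono) (auto simp: ge_one_powr_ge_zero)
    then show ?thesis by simp
  qed
  then have "real M / (16 * \<kappa> ^ 3 * t powr (3 / 2)) \<le> real M / 128"
    using \<kappa> t by (intro divide_left_mono) auto
  then have "real m \<le> real M / 128"
    unfolding m_eq num_out_def by linarith
  then show ?thesis by linarith
qed

lemma scan_refines:
  "refines scan_com s0 (J * 8 + 1) (return_pmf ())
     (\<lambda>s _. same {2, 3, 4} {} s0 s \<and> nmem s 2 0 = J \<and> nmem s 4 0 = max_count (take J xs))"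
proof -
  define I where "I = (\<lambda>k s. same {2, 3, 4} {} s0 s \<and> nmem s 2 0 = k \<and>
    nmem s 3 = count_list (take k xs) \<and> nmem s 4 0 = max_count (take k xs))"
  let ?b = "BNot (RLess (RNat (nvar 1))
         (RMul (RMul (RMul (RNat (NAdd (nvar 2) (NLit 1))) (rlit 72)) (rvar 0)) (RRead 0 (NLit 1))))"
  have "refines scan_com s0 (J * (6 + 2) + 1) (return_pmf ()) (\<lambda>s _. I J s)"
    unfolding scan_com_def
  proof (rule refines_While_det, rule conjI)
    fix k s assume k: "k < J" and I: "I k s"
    have sm: "same {2, 3, 4} {} s0 s" using I by (simp add: I_def)
    have [simp]: "nmem s 0 = nth0 xs" "nmem s (Suc 0) 0 = M" "rmem s 0 0 = \<kappa>" "rmem s 0 (Suc 0) = t"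
      using same_nmem[OF sm] same_rmem[OF sm] by simp_all
    have [simp]: "nmem s 2 0 = k" "nmem s 3 = count_list (take k xs)" "nmem s 4 0 = max_count (take k xs)"
      using I by (simp_all add: I_def)
    show "bval ?b s"
      using k J_less_iff[of k] by (simp add: add.commute)
    have kM: "k < M" using k J_le by linarith
    then have [simp]: "nth0 xs k = xs ! k" by (simp add: nth0_def M_eq)
    have tk: "take (Suc k) xs = take k xs @ [xs ! k]"
      using kM unfolding M_eq by (rule take_Suc_conv_app_nth)
    show "refines
       (NStore 3 (NRead 0 (nvar 2)) (NAdd (NRead 3 (NRead 0 (nvar 2))) (NLit 1));;
        Cond (NLess (nvar 4) (NRead 3 (NRead 0 (nvar 2)))) (nset 4 (NRead 3 (NRead 0 (nvar 2)))) Skip;;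
        ninc 2) s 6 (return_pmf ()) (\<lambda>s' _. I (Suc k) s')"
    proof (rule refines_mono[OF refines_NStore_Seq[OF refines_Seq_det[where n = 2 and x = "()" and k = 1
          and Q = "\<lambda>s'. same {2, 3, 4} {} s0 s' \<and> nmem s' 2 0 = k \<and>
            nmem s' 3 = count_list (take (Suc k) xs) \<and> nmem s' 4 0 = max_count (take (Suc k) xs)"]]])
      let ?s = "nstore 3 (nval (NRead 0 (nvar 2)) s) (nval (NAdd (NRead 3 (NRead 0 (nvar 2))) (NLit 1)) s) s"
      have s3: "(count_list (take k xs))(xs ! k := Suc (count_list (take k xs) (xs ! k))) = count_list (take (Suc k) xs)"
        by (auto simp: tk fun_eq_iff)
      have mc: "max_count (take (Suc k) xs) = max (max_count (take k xs)) (Suc (count_list (take k xs) (xs ! k)))"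
        by (simp add: tk max_count_snoc)
      have c1: "count_list (take (Suc k) xs) (xs ! k) = Suc (count_list (take k xs) (xs ! k))"
        by (simp add: tk)
      have "refines (if bval (NLess (nvar 4) (NRead 3 (NRead 0 (nvar 2)))) ?s
           then nset 4 (NRead 3 (NRead 0 (nvar 2))) else Skip) ?s 1 (return_pmf ())
         (\<lambda>s' _. same {2, 3, 4} {} s0 s' \<and> nmem s' 2 0 = k \<and>
            nmem s' 3 = count_list (take (Suc k) xs) \<and> nmem s' 4 0 = max_count (take (Suc k) xs))"
      proof (cases "max_count (take k xs) < Suc (count_list (take k xs) (xs ! k))")
        case True
        then have b: "bval (NLess (nvar 4) (NRead 3 (NRead 0 (nvar 2)))) ?s" by simp
        have mc': "max_count (take (Suc k) xs) = Suc (count_list (take k xs) (xs ! k))"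
          using True by (simp add: mc)
        show ?thesis
          by (simp only: b if_True, rule refines_NStore)
             (use sm in \<open>simp add: same_def agree_def mc' s3 c1\<close>)
      next
        case False
        then have b: "\<not> bval (NLess (nvar 4) (NRead 3 (NRead 0 (nvar 2)))) ?s" by simp
        have mc': "max_count (take (Suc k) xs) = max_count (take k xs)"
          using False by (simp add: mc)
        show ?thesis
          by (simp only: b if_False, rule refines_mono[OF refines_Skip])
             (use sm in \<open>simp_all add: same_def agree_def mc' s3\<close>)
      qed
      then show "refines (Cond (NLess (nvar 4) (NRead 3 (NRead 0 (nvar 2)))) (nset 4 (NRead 3 (NRead 0 (nvar 2)))) Skip)
         ?s 2 (return_pmf ()) (\<lambda>s' _. same {2, 3, 4} {} s0 s' \<and> nmem s' 2 0 = k \<and>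
            nmem s' 3 = count_list (take (Suc k) xs) \<and> nmem s' 4 0 = max_count (take (Suc k) xs))"
        by (rule refines_mono[OF refines_Cond]) simp
    next
      fix s' assume "same {2, 3, 4} {} s0 s' \<and> nmem s' 2 0 = k \<and>
            nmem s' 3 = count_list (take (Suc k) xs) \<and> nmem s' 4 0 = max_count (take (Suc k) xs)"
      then show "refines (ninc 2) s' 1 (return_pmf ()) (\<lambda>s' _. I (Suc k) s')"
        by (intro refines_NStore) (auto simp: I_def same_def agree_def)
    qed simp
  next
    fix s assume I: "I J s"
    have sm: "same {2, 3, 4} {} s0 s" using I by (simp add: I_def)
    have [simp]: "nmem s (Suc 0) 0 = M" "rmem s 0 0 = \<kappa>" "rmem s 0 (Suc 0) = t" "nmem s 2 0 = J"
      using same_nmem[OF sm] same_rmem[OF sm] I by (simp_all add: I_def)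
    show "\<not> bval ?b s"
      using J_less_iff[of J] by (simp add: add.commute)
  qed (simp add: I_def same_refl fun_eq_iff)
  then show ?thesis
    by (rule refines_conseq[OF refines_mono]) (auto simp: I_def)
qed

lemma block_refines:
  assumes "same {2, 3, 4} {} s0 s" "nmem s 2 0 = J" "nmem s 4 0 = max_count (take J xs)"
  shows "refines block_com s (G * 3 + 3) (return_pmf ())
     (\<lambda>s _. same {2, 3, 4, 5} {} s0 s \<and> nmem s 2 0 = J \<and> nmem s 4 0 = R \<and> nmem s 5 0 = G)"
proof -
  define I where "I = (\<lambda>k s. same {2, 3, 4, 5} {} s0 s \<and> nmem s 2 0 = J \<and> nmem s 4 0 = R \<and> nmem s 5 0 = k)"
  have R: "R > 0" by (simp add: R_eq num_blocks_def)
  let ?b = "BNot (RLess (RNat (nvar 1))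
         (RMul (RMul (RNat (NAdd (nvar 5) (NLit 1))) (RNat (nvar 4))) (rlit 4)))"
  have test: "bval ?b s' \<longleftrightarrow> k < G" if "I k s'" for k s'
  proof -
    have sm: "same {2, 3, 4, 5} {} s0 s'" using that by (simp add: I_def)
    have [simp]: "nmem s' (Suc 0) 0 = M" "nmem s' 4 0 = R" "nmem s' 5 0 = k"
      using same_nmem[OF sm] that by (simp_all add: I_def)
    have "bval ?b s' \<longleftrightarrow> real (Suc k * (4 * R)) \<le> real M"
      by (simp add: not_less algebra_simps)
    also have "\<dots> \<longleftrightarrow> Suc k * (4 * R) \<le> M"
      by (rule of_nat_le_iff)
    also have "\<dots> \<longleftrightarrow> k < G"
      using R by (simp add: G_eq less_eq_div_iff_mult_less_eq Suc_le_eq[symmetric] del: mult_Suc)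
    finally show ?thesis .
  qed
  have "refines block_com s (Suc (Suc (G * (1 + 2) + 1))) (return_pmf ()) (\<lambda>s _. I G s)"
    unfolding block_com_def
  proof (intro refines_NStore_Seq refines_While_det, rule conjI)
    fix k s assume k: "k < G" and I: "I k s"
    show "bval ?b s" using test[OF I] k by simp
    show "refines (ninc 5) s 1 (return_pmf ()) (\<lambda>s' _. I (Suc k) s')"
      using I by (intro refines_NStore) (auto simp: I_def same_def agree_def)
  next
    fix s assume "I G s"
    then show "\<not> bval ?b s" using test by blast
  qed (use assms in \<open>auto simp: I_def same_def agree_def R_eq num_blocks_def\<close>)
  then show ?thesis
    by (rule refines_conseq[OF refines_mono]) (auto simp: I_def)
qed

lemma stride_refines:
  assumes "same {2, 3, 4, 5} {} s0 s" "nmem s 2 0 = J" "nmem s 4 0 = R" "nmem s 5 0 = G"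
  shows "refines stride_com s (M * 5 + 3) (return_pmf ())
     (\<lambda>s _. same {2, 3, 4, 5, 6, 7} {} s0 s \<and> nmem s 2 0 = J \<and> nmem s 4 0 = R \<and> nmem s 5 0 = G \<and> nmem s 6 0 = stride)"
proof -
  define I where "I = (\<lambda>k s. same {2, 3, 4, 5, 6, 7} {} s0 s \<and> nmem s 2 0 = J \<and> nmem s 4 0 = R \<and> nmem s 5 0 = G \<and>
    nmem s 6 0 = Suc (sum_list (take k xs)) \<and> nmem s 7 0 = k)"
  have [simp]: "nmem s' 0 = nth0 xs" "nmem s' (Suc 0) 0 = M" if "I k s'" for k s'
  proof -
    have sm: "same {2, 3, 4, 5, 6, 7} {} s0 s'" using that by (simp add: I_def)
    show "nmem s' 0 = nth0 xs" "nmem s' (Suc 0) 0 = M"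
      using same_nmem[OF sm] by simp_all
  qed
  have "refines stride_com s (Suc (Suc (M * (Suc (Suc 1) + 2) + 1))) (return_pmf ()) (\<lambda>s _. I M s)"
    unfolding stride_com_def
  proof (intro refines_NStore_Seq refines_While_det, rule conjI)
    fix k s assume k: "k < M" and I: "I k s"
    show "bval (NLess (nvar 7) (nvar 1)) s" using k I by (simp, simp add: I_def)
    have nth: "nmem s 0 k = xs ! k" using k I by (simp add: nth0_def M_eq)
    have tk: "take (Suc k) xs = take k xs @ [xs ! k]"
      using k unfolding M_eq by (rule take_Suc_conv_app_nth)
    show "refines (nset 6 (NAdd (nvar 6) (NRead 0 (nvar 7)));; ninc 7) s (Suc (Suc 1)) (return_pmf ()) (\<lambda>s' _. I (Suc k) s')"
      using I nth unfolding I_def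
      by (intro refines_NStore refines_NStore_Seq) (auto simp: same_def agree_def tk)
  next
    fix s assume I: "I M s"
    then show "\<not> bval (NLess (nvar 7) (nvar 1)) s" by (simp, simp add: I_def)
  qed (use assms in \<open>auto simp: I_def same_def agree_def\<close>)
  then show ?thesis
    by (rule refines_conseq[OF refines_mono]) (auto simp: I_def M_eq stride_eq)
qed

definition prepared :: "state \<Rightarrow> bool" where
  "prepared s \<longleftrightarrow> same {2, 3, 4, 5, 6, 7, 8} {1, 2} s0 s \<and> nmem s 2 0 = J \<and> nmem s 4 0 = R \<and> nmem s 5 0 = G \<and>
     nmem s 6 0 = stride \<and> rmem s 1 0 = partial_exp G K"

lemma weights_refines:
  assumes "same {2, 3, 4, 5, 6, 7} {} s0 s" "nmem s 2 0 = J" "nmem s 4 0 = R" "nmem s 5 0 = G" "nmem s 6 0 = stride"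
  shows "refines weights_com s (K * 7 + 5) (return_pmf ()) (\<lambda>s _. prepared s)"
proof -
  define I where "I = (\<lambda>k s. same {2, 3, 4, 5, 6, 7, 8} {1, 2} s0 s \<and> nmem s 2 0 = J \<and> nmem s 4 0 = R \<and> nmem s 5 0 = G \<and>
    nmem s 6 0 = stride \<and> nmem s 8 0 = k \<and> rmem s 1 0 = partial_exp G k \<and> rmem s 2 0 = real G ^ k / fact k)"
  let ?b = "RLess (RNat (nvar 8)) (RAdd (RNat (NAdd (nvar 5) (nvar 5))) (RAdd (rvar 0) (rvar 0)))"
  have test: "bval ?b s' \<longleftrightarrow> k < K" if "I k s'" for k s'
  proof -
    have sm: "same {2, 3, 4, 5, 6, 7, 8} {1, 2} s0 s'" using that by (simp add: I_def)
    have [simp]: "rmem s' 0 0 = \<kappa>" "nmem s' 5 0 = G" "nmem s' 8 0 = k"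
      using same_rmem[OF sm] that by (simp_all add: I_def)
    have "bval ?b s' \<longleftrightarrow> real k < 2 * real G + 2 * \<kappa>"
      by simp
    also have "\<dots> \<longleftrightarrow> k < K"
      unfolding K_eq cutoff_def by linarith
    finally show ?thesis .
  qed
  have "refines weights_com s (Suc (Suc (Suc (Suc (K * (Suc (Suc (Suc (Suc 1))) + 2) + 1))))) (return_pmf ()) (\<lambda>s _. I K s)"
    unfolding weights_com_def
  proof (intro refines_RStore_Seq refines_While_det, rule conjI)
    fix k s assume k: "k < K" and I: "I k s"
    show "bval ?b s" using test[OF I] k by simp
    show "refines (ninc 8;; rset 2 (RDiv (RMul (rvar 2) (RNat (nvar 5))) (RNat (nvar 8)));;
        rset 1 (RAdd (rvar 1) (rvar 2))) s (Suc (Suc (Suc (Suc 1)))) (return_pmf ()) (\<lambda>s' _. I (Suc k) s')"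
      using I unfolding I_def
      by (intro refines_NStore_Seq refines_RStore_Seq refines_RStore)
         (auto simp: same_def agree_def partial_exp_def mult.commute)
  next
    fix s assume "I K s"
    then show "\<not> bval ?b s" using test by blast
  qed (use assms in \<open>auto simp: I_def same_def agree_def partial_exp_def\<close>)
  then show ?thesis
    by (rule refines_conseq[OF refines_mono]) (auto simp: I_def prepared_def)
qed

end

context sampler_input
begin

lemma nth0_less_stride: "nth0 xs i < stride"
  by (auto simp: nth0_def stride_eq less_Suc_eq_le intro: member_le_sum_list)

lemma address_iff:
  assumes "y < stride"
  shows "a = r * stride + y \<longleftrightarrow> a div stride = r \<and> a mod stride = y"
proof
  assume "a = r * stride + y"
  then show "a div stride = r \<and> a mod stride = y"
    using assms by simp
next
  assume "a div stride = r \<and> a mod stride = y"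
  then show "a = r * stride + y"
    using div_mult_mod_eq[of a stride] by auto
qed

text \<open>
  The counter of value \<^term>\<open>x\<close> in block \<^term>\<open>r\<close> is stored at address \<^term>\<open>r * stride + x\<close>. Real bank 6
  stores the complement of the acceptance probability, so that untouched cells have the right value.
\<close>

definition cells :: "state \<Rightarrow> nat list list \<Rightarrow> bool" where
  "cells s bs \<longleftrightarrow> (\<forall>a. nmem s 11 a = cell bs (a div stride) (a mod stride) \<and>
     rmem s 6 a = 1 - accept_prob (cell bs (a div stride) (a mod stride)))"

lemma cells_add:
  assumes "cells s (bs @ [zs])" "y < stride" "a = length bs * stride + y"
    "nmem s' 11 = (nmem s 11)(a := Suc (nmem s 11 a))"
    "rmem s' 6 = (rmem s 6)(a := 1 - (1 - rmem s 6 a) * (real (nmem s 11 a) + 1) / (real (nmem s 11 a) + 3 / 2))"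
  shows "cells s' (bs @ [zs @ [y]])"
  unfolding cells_def
proof (intro allI)
  fix b
  have "b = a \<longleftrightarrow> b div stride = length bs \<and> b mod stride = y"
    unfolding assms(3) using assms(2) by (rule address_iff)
  then show "nmem s' 11 b = cell (bs @ [zs @ [y]]) (b div stride) (b mod stride) \<and>
     rmem s' 6 b = 1 - accept_prob (cell (bs @ [zs @ [y]]) (b div stride) (b mod stride))"
    using assms(1) unfolding cells_def assms(4,5) cell_append_snoc by auto
qed

lemma cells_append_Nil [simp]: "cells s (bs @ [[]]) = cells s bs"
  by (simp add: cells_def)

abbreviation "pool_nbanks \<equiv> {2, 3, 4, 5, 6, 7, 8, 9, 10, 11, 12, 13, 14, 15::nat}"
abbreviation "pool_rbanks \<equiv> {1, 2, 3, 4, 6::nat}"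
abbreviation "bls ws \<equiv> blocks (nth0 xs) (2 * J) ws"
abbreviation "W \<equiv> map_pmf (inverse_cdf G K) (draw_pmf S)"

definition pooled :: "state \<Rightarrow> nat list \<Rightarrow> bool" where
  "pooled s ws \<longleftrightarrow> same pool_nbanks pool_rbanks s0 s \<and> nmem s 2 0 = J \<and> nmem s 4 0 = R \<and> nmem s 5 0 = G \<and>
     nmem s 6 0 = stride \<and> rmem s 1 0 = partial_exp G K \<and> nmem s 13 0 = length ws \<and>
     nmem s 12 0 = length ws * stride \<and> nmem s 14 0 = 2 * J + sum_list ws \<and> cells s (bls ws)"

lemma consume_refines:
  assumes "pooled s ws" "u < 1" "rmem s 4 0 = u" "nmem s 15 0 = 0" "rmem s 2 0 = 1" "rmem s 3 0 = 1"
  shows "refines consume_com s (K * 13 + 1) (return_pmf ())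
    (\<lambda>s _. same pool_nbanks pool_rbanks s0 s \<and> nmem s 2 0 = J \<and> nmem s 4 0 = R \<and> nmem s 5 0 = G \<and>
     nmem s 6 0 = stride \<and> rmem s 1 0 = partial_exp G K \<and> nmem s 13 0 = length ws \<and>
     nmem s 12 0 = length ws * stride \<and> nmem s 14 0 = 2 * J + sum_list (ws @ [inverse_cdf G K u]) \<and>
     cells s (bls (ws @ [inverse_cdf G K u])))"
proof -
  define p where "p = 2 * J + sum_list ws"
  define I where "I = (\<lambda>k s. same pool_nbanks pool_rbanks s0 s \<and> nmem s 2 0 = J \<and> nmem s 4 0 = R \<and> nmem s 5 0 = G \<and>
     nmem s 6 0 = stride \<and> rmem s 1 0 = partial_exp G K \<and> nmem s 13 0 = length ws \<and>
     nmem s 12 0 = length ws * stride \<and> nmem s 14 0 = p + k \<and> nmem s 15 0 = k \<and> rmem s 4 0 = u \<and>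
     rmem s 2 0 = real G ^ k / fact k \<and> rmem s 3 0 = partial_exp G k \<and>
     cells s (bls ws @ [map (nth0 xs) [p..<p + k]]))"
  let ?n = "inverse_cdf G K u"
  let ?b = "BNot (RLess (RMul (rvar 4) (rvar 1)) (rvar 3))"
  let ?c = "ninc 15;;
        rset 2 (RDiv (RMul (rvar 2) (RNat (nvar 5))) (RNat (nvar 15)));;
        rset 3 (RAdd (rvar 3) (rvar 2));;
        RStore 6 pool_addr
          (RSub (rlit 1)
             (RDiv (RMul (RSub (rlit 1) (RRead 6 pool_addr)) (RNat (NAdd (NRead 11 pool_addr) (NLit 1))))
                   (RAdd (RNat (NRead 11 pool_addr)) (RDiv (rlit 3) (rlit 2)))));;
        NStore 11 pool_addr (NAdd (NRead 11 pool_addr) (NLit 1));;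
        ninc 14"
  have "refines consume_com s (?n * (11 + 2) + 1) (return_pmf ()) (\<lambda>s _. I ?n s)"
    unfolding consume_com_def
  proof (rule refines_While_det, rule conjI)
    fix k s assume k: "k < ?n" and I: "I k s"
    \<comment> \<open>Minimality in \<open>inverse_cdf\<close> says exactly that the loop goes on
      for every \<open>k\<close> below it.\<close>
    show "bval ?b s"
      using I not_less_Least[OF k[unfolded inverse_cdf_def]] by (simp add: I_def)
    have sm: "same pool_nbanks pool_rbanks s0 s" using I by (simp add: I_def)
    have [simp]: "nmem s 0 = nth0 xs"
      using same_nmem[OF sm] by simp
    have [simp]: "nmem s 2 0 = J" "nmem s 4 0 = R" "nmem s 5 0 = G" "nmem s 6 0 = stride"
      "rmem s (Suc 0) 0 = partial_exp G K" "nmem s 13 0 = length ws" "nmem s 12 0 = length ws * stride"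
      "nmem s 14 0 = p + k" "nmem s 15 0 = k" "rmem s 4 0 = u" "rmem s 2 0 = real G ^ k / fact k"
      "rmem s 3 0 = partial_exp G k"
      and c: "cells s (bls ws @ [map (nth0 xs) [p..<p + k]])"
      using I by (simp_all add: I_def)
    have pe: "partial_exp G (Suc k) = partial_exp G k + real G * real G ^ k / ((1 + real k) * fact k)"
      by (simp add: partial_exp_def)
    have "refines ?c s (Suc (Suc (Suc (Suc (Suc (Suc (Suc (Suc (Suc (Suc (1))))))))))) (return_pmf ()) (\<lambda>s' _. I (Suc k) s')"
    proof (intro refines_NStore_Seq_eq refines_RStore_Seq_eq refines_NStore)
      show "I (Suc k) (nstore 14 (nval (NLit 0) s'') (nval (NAdd (nvar 14) (NLit 1)) s'') s'')" (is "I _ ?s")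
        if s': "s'' = nstore 11 (nval pool_addr s3) (nval (NAdd (NRead 11 pool_addr) (NLit 1)) s3) s3"
        "s3 = rstore 6 (nval pool_addr s4) (rval (RSub (rlit 1)
             (RDiv (RMul (RSub (rlit 1) (RRead 6 pool_addr)) (RNat (NAdd (NRead 11 pool_addr) (NLit 1))))
                   (RAdd (RNat (NRead 11 pool_addr)) (RDiv (rlit 3) (rlit 2))))) s4) s4"
        "s4 = rstore 3 (nval (NLit 0) s5) (rval (RAdd (rvar 3) (rvar 2)) s5) s5"
        "s5 = rstore 2 (nval (NLit 0) s6) (rval (RDiv (RMul (rvar 2) (RNat (nvar 5))) (RNat (nvar 15))) s6) s6"
        "s6 = nstore 15 (nval (NLit 0) s) (nval (NAdd (nvar 15) (NLit 1)) s) s" for s'' s3 s4 s5 s6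
      proof -
        let ?a = "length ws * stride + nth0 xs (p + k)"
        have 6: "nmem s6 = (nmem s)(15 := (nmem s 15)(0 := Suc k))" "rmem s6 = rmem s" "emitted s6 = emitted s"
          by (simp_all add: s'(5))
        have 5: "nmem s5 = nmem s6" "emitted s5 = emitted s"
          "rmem s5 = (rmem s)(2 := (rmem s 2)(0 := real G ^ Suc k / fact (Suc k)))"
          by (simp_all add: s'(4) 6 mult.commute)
        have 4: "nmem s4 = nmem s6" "emitted s4 = emitted s"
          "rmem s4 = (rmem s5)(3 := (rmem s 3)(0 := partial_exp G (Suc k)))"
          by (simp_all add: s'(3) 5 pe)
        have 3: "nmem s3 = nmem s6" "emitted s3 = emitted s"
          "rmem s3 = (rmem s4)(6 := (rmem s 6)(?a :=
             1 - (1 - rmem s 6 ?a) * (real (nmem s 11 ?a) + 1) / (real (nmem s 11 ?a) + 3 / 2)))"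
          by (simp_all add: s'(2) 4 5 6 add.commute)
        have 2: "nmem s'' = (nmem s6)(11 := (nmem s 11)(?a := Suc (nmem s 11 ?a)))"
          "emitted s'' = emitted s" "rmem s'' = rmem s3"
          by (simp_all add: s'(1) 3 6)
        have 1: "nmem ?s = (nmem s'')(14 := (nmem s 14)(0 := p + Suc k))"
          "emitted ?s = emitted s" "rmem ?s = rmem s3"
          by (simp_all add: 2 6)
        have "cells ?s (bls ws @ [map (nth0 xs) [p..<p + k] @ [nth0 xs (p + k)]])"
          by (rule cells_add[where a = ?a, OF c nth0_less_stride[of "p + k"]]) (simp_all only: 1, simp_all add: 2 3 4 5 6)
        then have "cells ?s (bls ws @ [map (nth0 xs) [p..<p + Suc k]])"
          by simp
        moreover have "same pool_nbanks pool_rbanks s0 ?s"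
          using sm unfolding same_def agree_def by (simp only: 1, simp add: 2 3 4 5 6)
        ultimately show ?thesis
          unfolding I_def by (simp only: 1, simp add: 2 3 4 5 6)
      qed
    qed
    then show "refines ?c s 11 (return_pmf ()) (\<lambda>s' _. I (Suc k) s')"
      by (rule refines_mono) simp
  next
    fix s assume "I ?n s"
    then show "\<not> bval ?b s"
      using inverse_cdf_props(1)[OF assms(2)] by (simp add: I_def)
  next
    show "I 0 s"
      using assms by (simp add: I_def pooled_def p_def partial_exp_def)
  qed
  \<comment> \<open>The number of rounds depends on \<open>u\<close>, but the cutoff
    \<open>K\<close> bounds it uniformly over all coins.\<close>
  then have "refines consume_com s (K * 13 + 1) (return_pmf ()) (\<lambda>s _. I ?n s)"
    by (rule refines_mono) (use inverse_cdf_props(2)[OF assms(2), of G K] in simp)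
  then show ?thesis
    by (rule refines_conseq) (simp add: I_def p_def blocks_append_single)
qed

lemma same_s0_trans:
  "same A B s s' \<Longrightarrow> same C D s0 s \<Longrightarrow> A \<subseteq> C \<Longrightarrow> B \<subseteq> D \<Longrightarrow> same C D s0 s'"
  unfolding same_def agree_def by (metis subsetD)

lemma pool_refines:
  assumes "prepared s"
  shows "refines pool_com s (R * (7 * S + 13 * K + 22) + 3) (replicate_pmf R W) pooled"
proof -
  let ?T = "7 * S + 13 * K + 20"
  define I where "I = (\<lambda>k s ws. length ws = k \<and> pooled s ws)"
  let ?B = "\<lambda>(_::nat) ws. map_pmf (\<lambda>w. ws @ [w]) W"
  let ?c = "draw_com;; nset 15 (NLit 0);; rset 2 (rlit 1);; rset 3 (rlit 1);; consume_com;;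
        nset 12 (NAdd (nvar 12) (nvar 6));; ninc 13"
  have "refines pool_com s (Suc (Suc (R * (?T + 2) + 1))) (iter ?B R []) (I R)"
    unfolding pool_com_def
  proof (intro refines_NStore_Seq refines_While, rule conjI)
    fix k s ws assume k: "k < R" and I: "I k s ws"
    have len: "length ws = k" and ps: "pooled s ws"
      using I by (simp_all add: I_def)
    have sm: "same pool_nbanks pool_rbanks s0 s" using ps by (simp add: pooled_def)
    show "bval (NLess (nvar 13) (nvar 4)) s"
      using k ps len by (simp add: pooled_def)
    have S: "S = nat \<lceil>rmem s 0 0\<rceil>"
      using same_rmem[OF sm] by (simp add: S_eq)
    have "refines ?c s
        (Suc (7 * S + 5 + Suc (Suc (Suc (Suc (Suc (Suc (Suc (K * 13 + 1 + Suc (Suc 1))))))))))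
        (bind_pmf (draw_pmf S) (\<lambda>u. return_pmf (ws @ [inverse_cdf G K u]))) (I (Suc k))"
    proof (rule refines_Seq[OF draw_com_refines[OF S]], elim conjE,
        intro refines_NStore_Seq_eq refines_RStore_Seq_eq)
      fix s' u s1 s2 s3
      assume s': "same {9, 10} {4} s s'" "rmem s' 4 0 = u" "0 \<le> u" "u < 1"
        and s3: "s1 = nstore 15 (nval (NLit 0) s') (nval (NLit 0) s') s'"
          "s2 = rstore 2 (nval (NLit 0) s1) (rval (rlit 1) s1) s1"
          "s3 = rstore 3 (nval (NLit 0) s2) (rval (rlit 1) s2) s2"
      have sm': "same pool_nbanks pool_rbanks s0 s'"
        using s'(1) sm by (rule same_s0_trans) auto
      have "cells s3 (bls ws)"
        using ps same_nmem[OF s'(1)] same_rmem[OF s'(1)] by (simp add: pooled_def cells_def s3)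
      moreover have "same pool_nbanks pool_rbanks s0 s3"
        using sm' by (simp add: same_def agree_def s3)
      ultimately have p: "pooled s3 ws"
        using ps same_nmem[OF s'(1)] same_rmem[OF s'(1)] by (simp add: pooled_def s3)
      show "refines (consume_com;; nset 12 (NAdd (nvar 12) (nvar 6));; ninc 13) s3 (Suc (K * 13 + 1 + Suc (Suc 1)))
         (return_pmf (ws @ [inverse_cdf G K u])) (I (Suc k))"
      proof (rule refines_Seq_det[OF consume_refines[OF p s'(4)]], goal_cases)
        case (5 s4)
        then show ?case
          using len by (intro refines_NStore_Seq refines_NStore) (auto simp: I_def pooled_def same_def agree_def cells_def)
      qed (use s' in \<open>simp_all add: s3\<close>)
    qed
    moreover have "bind_pmf (draw_pmf S) (\<lambda>u. return_pmf (ws @ [inverse_cdf G K u])) = ?B k ws"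
      by (simp add: map_pmf_def bind_assoc_pmf bind_return_pmf)
    ultimately have "refines ?c s
        (Suc (7 * S + 5 + Suc (Suc (Suc (Suc (Suc (Suc (Suc (K * 13 + 1 + Suc (Suc 1)))))))))) (?B k ws) (I (Suc k))"
      by (simp only:)
    then show "refines ?c s ?T (?B k ws) (I (Suc k))"
      by (rule refines_mono) simp
  next
    fix s ws assume "I R s ws"
    then show "\<not> bval (NLess (nvar 13) (nvar 4)) s"
      by (simp add: I_def pooled_def)
  next
    have sm: "same {2, 3, 4, 5, 6, 7, 8} {1, 2} s0 s" using assms by (simp add: prepared_def)
    have [simp]: "nmem s 11 a = 0" "rmem s 6 a = 0" "nmem s 13 a = 0" "nmem s 12 a = 0" for a
      using same_nmem[OF sm] same_rmem[OF sm] by simp_all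
    show "I 0 (nstore 14 (nval (NLit 0) s) (nval (NAdd (nvar 2) (nvar 2)) s) s) []"
      using assms by (auto simp: I_def pooled_def prepared_def same_def agree_def cells_def cell_def)
  qed
  then have "refines pool_com s (Suc (Suc (R * (?T + 2) + 1))) (iter ?B R []) (\<lambda>s ws. pooled s ws)"
    by (rule refines_conseq) (simp add: I_def)
  moreover have "iter ?B R [] = replicate_pmf R W"
    using iter_append[of "\<lambda>_. W" R] replicate_pmf_eq_mapM[of "[0..<R]" W] by simp
  ultimately show ?thesis
    by (simp add: refines_mono)
qed

lemma more_test_iff:
  assumes "nmem s (Suc 0) 0 = M" "rmem s 0 0 = \<kappa>" "rmem s 0 (Suc 0) = t"
  shows "bval more_test s \<longleftrightarrow> nmem s 18 0 < m"
  unfolding m_eq num_out_iff[OF \<kappa> t] using assms by (simp add: more_test_def add.commute)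

abbreviation "try_nbanks \<equiv> {2, 3, 4, 5, 6, 7, 8, 9, 10, 11, 12, 13, 14, 15, 16, 17, 18::nat}"

definition tried :: "state \<Rightarrow> nat list \<Rightarrow> bool" where
  "tried s zs \<longleftrightarrow> agree try_nbanks pool_rbanks s0 s \<and> nmem s 2 0 = J \<and>
     emitted s = take m zs \<and> nmem s 18 0 = length (emitted s)"

lemma length_ys: "length ys = J"
  using J_le by (simp add: ys_eq M_eq)

text \<open>Bank 16 holds, for each value, the stride times the number of its earlier tries. Adding
  the value gives the address of the cell that \<open>try_counts\<close> prescribes.\<close>

lemma tries_refines:
  assumes "pooled s ws"
  shows "refines tries_com s (J * (7 * S + 17) + 3)
    (mapM_pmf (\<lambda>n. map_pmf (\<lambda>u. u < accept_prob n) (draw_pmf S)) (try_counts (bls ws) ys))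
    (\<lambda>s cs. tried s (accepted ys cs))"
proof -
  let ?T = "7 * S + 15"
  let ?c = "\<lambda>k. try_counts (bls ws) ys ! k"
  define I where "I = (\<lambda>k s cs. length cs = k \<and> tried s (accepted (take k ys) cs) \<and> nmem s 6 0 = stride \<and>
     cells s (bls ws) \<and> nmem s 17 0 = J + k \<and> nmem s 16 = (\<lambda>y. stride * count_list (take k ys) y))"
  let ?B = "\<lambda>k cs. map_pmf (\<lambda>c. cs @ [c]) (map_pmf (\<lambda>u. u < accept_prob (?c k)) (draw_pmf S))"
  let ?b = "RLess (rvar 4) (RSub (rlit 1) (RRead 6 (NAdd (NRead 0 (nvar 17)) (NRead 16 (NRead 0 (nvar 17))))))"
  let ?e = "Cond ?b (Cond more_test (Emit (NRead 0 (nvar 17));; ninc 18) Skip) Skip"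
  let ?f = "NStore 16 (NRead 0 (nvar 17)) (NAdd (NRead 16 (NRead 0 (nvar 17))) (nvar 6));; ninc 17"
  have "refines tries_com s (Suc (Suc (J * (?T + 2) + 1))) (iter ?B J []) (I J)"
    unfolding tries_com_def
  proof (intro refines_NStore_Seq refines_While, rule conjI)
    fix k s cs assume k: "k < J" and I: "I k s cs"
    have sm: "agree try_nbanks pool_rbanks s0 s" using I by (simp add: I_def tried_def)
    show "bval (NLess (nvar 17) (NAdd (nvar 2) (nvar 2))) s"
      using k I by (simp add: I_def tried_def)
    have S: "S = nat \<lceil>rmem s 0 0\<rceil>"
      using agree_rmem[OF sm] by (simp add: S_eq)
    have J: "2 * J \<le> M" using J_le by linarith
    have y: "nth0 xs (J + k) = ys ! k"
      using k J by (simp add: nth0_def ys_eq M_eq)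
    have tk: "take (Suc k) ys = take k ys @ [ys ! k]"
      using k length_ys by (intro take_Suc_conv_app_nth) simp
    let ?cs = "\<lambda>u. cs @ [u < accept_prob (?c k)]"
    have "refines (draw_com;; ?e;; ?f) s (Suc (7 * S + 5 + Suc (5 + Suc (Suc 1))))
        (bind_pmf (draw_pmf S) (\<lambda>u. return_pmf (?cs u))) (I (Suc k))"
    proof (rule refines_Seq[OF draw_com_refines[OF S]], elim conjE, rule refines_Seq_det)
      fix s' u
      assume s': "same {9, 10} {4} s s'" "rmem s' 4 0 = u"
      let ?Q = "\<lambda>s'. tried s' (accepted (take (Suc k) ys) (?cs u)) \<and> nmem s' 6 0 = stride \<and>
        cells s' (bls ws) \<and> nmem s' 17 0 = J + k \<and> nmem s' 16 = (\<lambda>y. stride * count_list (take k ys) y)"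
      have sm': "agree try_nbanks pool_rbanks s0 s'"
        using s'(1) sm by (auto simp: same_def agree_def)
      have I': "I k s' cs"
        using I sm' same_nmem[OF s'(1)] same_rmem[OF s'(1)] same_emitted[OF s'(1)]
        by (simp add: I_def tried_def cells_def)
      then have [simp]: "nmem s' 2 0 = J" "nmem s' 6 0 = stride" "nmem s' 17 0 = J + k"
        "nmem s' 16 = (\<lambda>y. stride * count_list (take k ys) y)"
        and em: "emitted s' = take m (accepted (take k ys) cs)" "nmem s' 18 0 = length (emitted s')"
        and cl: "cells s' (bls ws)"
        and len: "length cs = length (take k ys)"
        using k length_ys by (simp_all add: I_def tried_def)
      have [simp]: "nmem s' 0 = nth0 xs" "nmem s' (Suc 0) 0 = M" "rmem s' 0 0 = \<kappa>" "rmem s' 0 (Suc 0) = t"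
        using agree_nmem[OF sm'] agree_rmem[OF sm'] by simp_all
      define c where "c = count_list (take k ys) (ys ! k)"
      have lt: "ys ! k < stride" using nth0_less_stride[of "J + k"] unfolding y .
      have "rmem s' 6 (ys ! k + stride * c) = 1 - accept_prob (cell (bls ws) c (ys ! k))"
        using cl lt unfolding cells_def by simp
      moreover have "?c k = cell (bls ws) c (ys ! k)"
        using k length_ys by (simp add: try_counts_def c_def)
      ultimately have b: "bval ?b s' \<longleftrightarrow> u < accept_prob (?c k)"
        using s'(2) unfolding bval.simps rval.simps nval.simps by (simp add: y c_def)
      have acc: "accepted (take (Suc k) ys) (cs @ [True]) = accepted (take k ys) cs @ [ys ! k]"
        "accepted (take (Suc k) ys) (cs @ [False]) = accepted (take k ys) cs"
        unfolding tk by (simp_all add: accepted_snoc[OF len])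
      have mt: "bval more_test s' \<longleftrightarrow> length (take m (accepted (take k ys) cs)) < m"
        by (subst more_test_iff) (simp_all add: em)
      show "refines ?e s' 5 (return_pmf ()) (\<lambda>s' _. ?Q s')"
      proof (cases "u < accept_prob (?c k)")
        case True
        show ?thesis
        proof (cases "bval more_test s'")
          case more: True
          have "refines (Emit (NRead 0 (nvar 17));; ninc 18) s' (Suc (Suc 1)) (return_pmf ()) (\<lambda>s' _. ?Q s')"
            using True more cl sm' em unfolding mt
            by (intro refines_Emit_Seq refines_NStore)
               (auto simp: tried_def acc y cells_def same_def agree_def min_def split: if_splits)
          then have "refines ?e s' (Suc (Suc (Suc (Suc 1)))) (return_pmf ()) (\<lambda>s' _. ?Q s')"
            using True more b by (intro refines_Cond) (simp only: if_True, intro refines_Cond, simp only: if_True)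
          then show ?thesis
            by (rule refines_mono) simp
        next
          case more: False
          have "refines Skip s' 0 (return_pmf ()) (\<lambda>s' _. ?Q s')"
            using True more cl sm' em unfolding mt
            by (intro refines_Skip) (auto simp: tried_def acc)
          then have "refines ?e s' (Suc (Suc 0)) (return_pmf ()) (\<lambda>s' _. ?Q s')"
            using True more b by (intro refines_Cond) (simp only: if_True, intro refines_Cond, simp only: if_False)
          then show ?thesis
            by (rule refines_mono) simp
        qed
      next
        case False
        have "refines Skip s' 0 (return_pmf ()) (\<lambda>s' _. ?Q s')"
          using False cl sm' em by (intro refines_Skip) (auto simp: tried_def acc)
        then have "refines ?e s' (Suc 0) (return_pmf ()) (\<lambda>s' _. ?Q s')"
          using False b by (intro refines_Cond) (simp only: if_False)
        then show ?thesis
          by (rule refines_mono) simp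
      qed
      show "refines ?f s' (Suc (Suc 1)) (return_pmf (?cs u)) (I (Suc k))" if Q: "?Q s'" for s'
      proof -
        have "agree try_nbanks pool_rbanks s0 s'" using Q by (simp add: tried_def)
        then have [simp]: "nmem s' 0 = nth0 xs"
          using agree_nmem by fastforce
        have "nmem s' 16 = (\<lambda>y. stride * count_list (take k ys) y)" "nmem s' 17 0 = J + k" "nmem s' 6 0 = stride"
          using Q by blast+
        note [simp] = this
        have "(\<lambda>y. stride * count_list (take k ys) y)(ys ! k := stride * count_list (take k ys) (ys ! k) + stride)
            = (\<lambda>y. stride * count_list (take (Suc k) ys) y)"
          unfolding tk by (auto simp: fun_eq_iff)
        then show ?thesis
          using Q I y unfolding I_def
          by (intro refines_NStore_Seq refines_NStore) (auto simp: tried_def cells_def same_def agree_def)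
      qed
    qed
    moreover have "bind_pmf (draw_pmf S) (\<lambda>u. return_pmf (?cs u)) = ?B k cs"
      by (simp add: map_pmf_def bind_assoc_pmf bind_return_pmf)
    ultimately have "refines (draw_com;; ?e;; ?f) s (Suc (7 * S + 5 + Suc (5 + Suc (Suc 1)))) (?B k cs) (I (Suc k))"
      by (simp only:)
    then show "refines (draw_com;; ?e;; ?f) s ?T (?B k cs) (I (Suc k))"
      by (rule refines_mono) simp
  next
    fix s cs assume "I J s cs"
    then show "\<not> bval (NLess (nvar 17) (NAdd (nvar 2) (nvar 2))) s"
      by (simp add: I_def tried_def)
  next
    have sm: "same pool_nbanks pool_rbanks s0 s" using assms by (simp add: pooled_def)
    have [simp]: "nmem s 16 a = 0" "nmem s 18 a = 0" "emitted s = []" for a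
      using same_nmem[OF sm] same_emitted[OF sm] by simp_all
    show "I 0 (nstore 17 (nval (NLit 0) s) (nval (nvar 2) s) s) []"
      using assms by (auto simp: I_def tried_def pooled_def same_def agree_def cells_def accepted_def fun_eq_iff)
  qed
  moreover have "iter ?B J [] = mapM_pmf (\<lambda>n. map_pmf (\<lambda>u. u < accept_prob n) (draw_pmf S)) (try_counts (bls ws) ys)"
  proof -
    have "length (try_counts (bls ws) ys) = J"
      unfolding try_counts_def using length_ys by simp
    then have "try_counts (bls ws) ys = map ?c [0..<J]"
      by (metis map_nth)
    then have "mapM_pmf (\<lambda>n. map_pmf (\<lambda>u. u < accept_prob n) (draw_pmf S)) (try_counts (bls ws) ys)
       = mapM_pmf (\<lambda>k. map_pmf (\<lambda>u. u < accept_prob (?c k)) (draw_pmf S)) [0..<J]"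
      by (metis (no_types, lifting) mapM_pmf_map comp_apply ext)
    then show ?thesis
      by (simp only: iter_append)
  qed
  ultimately have "refines tries_com s (Suc (Suc (J * (?T + 2) + 1)))
      (mapM_pmf (\<lambda>n. map_pmf (\<lambda>u. u < accept_prob n) (draw_pmf S)) (try_counts (bls ws) ys)) (I J)"
    by simp
  then show ?thesis
    by (rule refines_conseq[OF refines_mono]) (simp_all add: I_def length_ys)
qed

lemma fill_refines:
  assumes "tried s zs"
  shows "refines fill_com s (m * 7 + 3) (return_pmf (take m (zs @ drop (2 * J) xs))) (\<lambda>s ys. emitted s = ys)"
proof -
  define I where "I = (\<lambda>k s. agree try_nbanks pool_rbanks s0 s \<and> nmem s 14 0 = 2 * J + k \<and>
     emitted s = take m zs @ take k (drop (2 * J) xs) \<and> nmem s 18 0 = length (take m zs) + k)"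
  \<comment> \<open>Truncated subtraction: no round is run if enough tries were accepted.\<close>
  let ?n = "m - length zs"
  have test: "bval more_test s' \<longleftrightarrow> k < ?n" if "I k s'" for k s'
  proof -
    have sm: "agree try_nbanks pool_rbanks s0 s'" using that by (simp add: I_def)
    have "bval more_test s' \<longleftrightarrow> nmem s' 18 0 < m"
      using agree_nmem[OF sm] agree_rmem[OF sm] by (intro more_test_iff) simp_all
    then show ?thesis
      using that by (auto simp: I_def)
  qed
  have "refines fill_com s (Suc (Suc (?n * (Suc (Suc (Suc (Suc 1))) + 2) + 1))) (return_pmf ()) (\<lambda>s _. I ?n s)"
    unfolding fill_com_def
  proof (intro refines_NStore_Seq refines_While_det, rule conjI)
    fix k s assume k: "k < ?n" and I: "I k s"
    show "bval more_test s" using test[OF I] k by simp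
    have sm: "agree try_nbanks pool_rbanks s0 s" using I by (simp add: I_def)
    then have [simp]: "nmem s 0 = nth0 xs"
      using agree_nmem by fastforce
    \<comment> \<open>The pool never runs out, since \<open>2 * J + m \<le> M\<close>.\<close>
    have lt: "2 * J + k < M"
      using k J_le m_le by linarith
    then have "take (Suc k) (drop (2 * J) xs) = take k (drop (2 * J) xs) @ [nth0 xs (2 * J + k)]"
      by (simp add: nth0_def M_eq take_Suc_conv_app_nth)
    then show "refines (Emit (NRead 0 (nvar 14));; ninc 14;; ninc 18) s (Suc (Suc (Suc (Suc 1)))) (return_pmf ()) (\<lambda>s' _. I (Suc k) s')"
      using I unfolding I_def
      by (intro refines_Emit_Seq refines_NStore_Seq refines_NStore) (auto simp: same_def agree_def)
  next
    fix s assume "I ?n s"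
    then show "\<not> bval more_test s" using test by blast
  next
    show "I 0 (nstore 14 (nval (NLit 0) s) (nval (NAdd (nvar 2) (nvar 2)) s) s)"
      using assms by (auto simp: I_def tried_def same_def agree_def)
  qed
  then have "refines fill_com s (m * 7 + 3) (return_pmf ()) (\<lambda>s _. I ?n s)"
    by (rule refines_mono) simp
  then have "refines fill_com s (m * 7 + 3) (map_pmf (\<lambda>_. take m (zs @ drop (2 * J) xs)) (return_pmf ())) (\<lambda>s ys. emitted s = ys)"
    by (rule refines_map) (simp add: I_def)
  then show ?thesis by simp
qed

lemma sampler_refines:
  "refines sampler s0
     (J * 8 + G * 3 + M * 5 + K * 7 + R * (7 * S + 13 * K + 22) + J * (7 * S + 17) + m * 7 + 27)
     (sampler_pmf \<kappa> t xs) (\<lambda>s ys. emitted s = ys)"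
proof -
  have "refines sampler s0
     (Suc (J * 8 + 1 + Suc (G * 3 + 3 + Suc (M * 5 + 3 + Suc (K * 7 + 5 +
        Suc (R * (7 * S + 13 * K + 22) + 3 + Suc (J * (7 * S + 17) + 3 + (m * 7 + 3))))))))
     (sampler_pmf \<kappa> t xs) (\<lambda>s ys. emitted s = ys)"
    unfolding sampler_def sampler_pmf_def Let_def M_eq[symmetric] J_eq[symmetric] R_eq[symmetric]
      G_eq[symmetric] K_eq[symmetric] S_eq[symmetric] ys_eq[symmetric] m_eq[symmetric]
    apply (rule refines_Seq_det[OF scan_refines])
    apply (elim conjE, rule refines_Seq_det[OF block_refines], assumption+)
    apply (elim conjE, rule refines_Seq_det[OF stride_refines], assumption+)
    apply (elim conjE, rule refines_Seq_det[OF weights_refines], assumption+)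
    apply (rule refines_Seq[OF pool_refines], assumption)
    apply (rule refines_Seq[OF tries_refines], assumption)
    apply (rule fill_refines, assumption)
    done
  then show ?thesis
    by (rule refines_mono) simp
qed

end

section \<open>Multiplicities in the output and running time\<close>

lemma count_list_take_le: "count_list (take n xs) x \<le> count_list xs x"
proof -
  have "count_list xs x = count_list (take n xs) x + count_list (drop n xs) x"
    by (simp flip: count_list_append)
  then show ?thesis by simp
qed

lemma count_list_accepted_le: "count_list (accepted ys cs) x \<le> count_list ys x"
proof (induction ys arbitrary: cs)
  case (Cons y ys)
  show ?case
  proof (cases cs)
    case Nil
    then show ?thesis by (simp add: accepted_def)
  next
    case (Cons c cs')
    then show ?thesis
      using Cons.IH[of cs'] by (cases c) (auto simp: accepted_def intro: le_SucI)
  qed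
qed (simp add: accepted_def)

context sampler_input
begin

text \<open>Accepted tries and filler are subsequences of two disjoint stretches of the input, and
  the filler is long enough because \<open>2 * J + m \<le> M\<close>.\<close>

lemma sampler_pmf_support:
  assumes "zs \<in> set_pmf (sampler_pmf \<kappa> t xs)"
  shows "count_list zs x \<le> count_list xs x" "length zs = m"
proof -
  obtain cs where zs: "zs = take m (accepted ys cs @ drop (2 * J) xs)"
    using assms unfolding sampler_pmf_def Let_def M_eq[symmetric] J_eq[symmetric] ys_eq[symmetric] m_eq[symmetric]
    by auto
  have "xs = take J xs @ ys @ drop (2 * J) xs"
    unfolding ys_eq mult_2 drop_drop[symmetric] append_take_drop_id ..
  then have "count_list xs x = count_list (take J xs) x + count_list ys x + count_list (drop (2 * J) xs) x"
    by (metis count_list_append add.assoc)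
  then show "count_list zs x \<le> count_list xs x"
    unfolding zs using count_list_take_le[of m "accepted ys cs @ drop (2 * J) xs" x] count_list_accepted_le[of ys cs x]
    by simp
  show "length zs = m"
    unfolding zs using J_le m_le by (simp add: M_eq)
qed

text \<open>The nested loop over the blocks costs about \<open>R * K\<close>. Since \<open>K\<close>
  is about \<open>2 * G + 2 * \<kappa>\<close> and \<open>4 * R * G \<le> M\<close>, it stays linear
  in \<open>M\<close>. A nonempty input absorbs the constant start-up cost.\<close>

lemma running_time_sampler:
  assumes "xs \<noteq> []"
  shows "real (running_time sampler s0) \<le> real (length xs) * (200 + 100 * \<kappa>)"
proof -
  have M: "1 \<le> real M" using assms by (cases xs) (simp_all add: M_eq)
  have J: "real J \<le> real M" using J_le by simp
  have m: "real m \<le> real M" using m_le by simp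
  have "R \<le> M"
  proof -
    have "R \<le> 4 * J + 1"
      using max_count_le[of "take J xs"] by (simp add: R_eq num_blocks_def)
    then show ?thesis using J_le M by (cases "J = 0") auto
  qed
  then have R: "real R \<le> real M" by simp
  have "4 * R * G \<le> M" unfolding G_eq by (rule times_div_less_eq_dividend)
  then have "real (4 * R * G) \<le> real M" by (simp only: of_nat_le_iff)
  then have RG: "4 * (real R * real G) \<le> real M" by simp
  have G: "real G \<le> real M" unfolding G_eq by simp
  have K: "real K \<le> 2 * real G + 2 * \<kappa> + 1" using \<kappa> unfolding K_eq cutoff_def by linarith
  have S: "real S \<le> \<kappa> + 1" using \<kappa> unfolding S_eq by linarith
  have RK: "real R * real K \<le> real M + (2 * \<kappa> + 1) * real M"
  proof -
    have "real R * real K \<le> real R * (2 * real G + 2 * \<kappa> + 1)" using K by (intro mult_left_mono) auto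
    also have "\<dots> = 2 * (real R * real G) + (2 * \<kappa> + 1) * real R" by (simp add: algebra_simps)
    also have "(2 * \<kappa> + 1) * real R \<le> (2 * \<kappa> + 1) * real M" using R \<kappa> by (intro mult_left_mono) auto
    finally show ?thesis using RG by linarith
  qed
  have RS: "real R * real S \<le> real M * (\<kappa> + 1)" using R S by (intro mult_mono) auto
  have JS: "real J * real S \<le> real M * (\<kappa> + 1)" using J S by (intro mult_mono) auto
  have \<kappa>M: "\<kappa> \<le> real M * \<kappa>" using M \<kappa> mult_right_mono[of 1 "real M" \<kappa>] by simp
  let ?T = "J * 8 + G * 3 + M * 5 + K * 7 + R * (7 * S + 13 * K + 22) + J * (7 * S + 17) + m * 7 + 27"
  have "running_time sampler s0 \<le> ?T"
    by (rule running_time_le[OF sampler_refines])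
  then have "real (running_time sampler s0) \<le> real ?T" by (simp only: of_nat_le_iff)
  also have "real ?T = 8 * real J + 3 * real G + 5 * real M + 7 * real K + 7 * (real R * real S) + 13 * (real R * real K)
      + 22 * real R + 7 * (real J * real S) + 17 * real J + 7 * real m + 27"
    by (simp add: algebra_simps)
  also have "\<dots> \<le> 8 * real M + 3 * real M + 5 * real M + 7 * (2 * real M + 2 * (real M * \<kappa>) + real M)
      + 7 * (real M * (\<kappa> + 1)) + 13 * (real M + (2 * \<kappa> + 1) * real M)
      + 22 * real M + 7 * (real M * (\<kappa> + 1)) + 17 * real M + 7 * real M + 27 * real M"
    using J G m R K RK RS JS \<kappa>M M by (intro add_mono mult_left_mono) auto
  also have "\<dots> \<le> real M * (200 + 100 * \<kappa>)"
    using \<kappa>M M \<kappa> by (simp add: algebra_simps)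
  finally show ?thesis by (simp only: M_eq)
qed

lemma output_dist_sampler: "output_dist sampler s0 = sampler_pmf \<kappa> t xs"
  by (rule output_dist_eq[OF sampler_refines])

lemma halts_sampler: "halts sampler s0"
  unfolding halts_def using refines_halts[OF sampler_refines] by blast

end

text \<open>Every admissible input determines the locale parameters, so the locale facts hold for
  arbitrary inputs.\<close>

lemma sampler_input_self:
  assumes "\<kappa> \<ge> 2" "t \<ge> 1"
  shows "\<exists>J R G K S stride ys. sampler_input \<kappa> t xs (length xs) J R G K S stride (num_out \<kappa> t (length xs)) ys"
  using assms unfolding sampler_input_def by blast

section \<open>Statistical distance\<close>

text \<open>A one-sided bound is enough, because passing to complements reverses the sign of the
  difference.\<close>

lemma stat_dist_le:
  assumes "\<And>A. measure_pmf.prob p A \<le> measure_pmf.prob q A + e"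
  shows "stat_dist p q \<le> e"
  unfolding stat_dist_def
proof (rule cSUP_least)
  fix A
  have "measure_pmf.prob q A - measure_pmf.prob p A = measure_pmf.prob p (- A) - measure_pmf.prob q (- A)"
    using measure_pmf.prob_compl[of A p] measure_pmf.prob_compl[of A q] by (simp add: Compl_eq_Diff_UNIV)
  then show "\<bar>measure_pmf.prob p A - measure_pmf.prob q A\<bar> \<le> e"
    using assms[of A] assms[of "- A"] by linarith
qed simp

lemma prob_le_stat_dist: "measure_pmf.prob p A \<le> measure_pmf.prob q A + stat_dist p q"
proof -
  have "bdd_above (range (\<lambda>A. \<bar>measure_pmf.prob p A - measure_pmf.prob q A\<bar>))"
  proof (rule bdd_aboveI2)
    show "\<bar>measure_pmf.prob p A - measure_pmf.prob q A\<bar> \<le> 1" for A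
      using measure_pmf.prob_le_1[of p A] measure_pmf.prob_le_1[of q A]
        measure_nonneg[of "measure_pmf p" A] measure_nonneg[of "measure_pmf q" A] by linarith
  qed
  then have "\<bar>measure_pmf.prob p A - measure_pmf.prob q A\<bar> \<le> stat_dist p q"
    unfolding stat_dist_def by (rule cSUP_upper[OF UNIV_I])
  then show ?thesis by linarith
qed

lemma stat_dist_nonneg: "0 \<le> stat_dist p q"
  using prob_le_stat_dist[of p UNIV q] by simp

lemma stat_dist_refl [simp]: "stat_dist p p = 0"
  using stat_dist_le[of p p 0] stat_dist_nonneg[of p p] by simp

lemma stat_dist_commute: "stat_dist p q = stat_dist q p"
  by (simp add: stat_dist_def abs_minus_commute)

lemma stat_dist_triangle: "stat_dist p r \<le> stat_dist p q + stat_dist q r"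
proof (rule stat_dist_le)
  fix A
  show "measure_pmf.prob p A \<le> measure_pmf.prob r A + (stat_dist p q + stat_dist q r)"
    using prob_le_stat_dist[of p A q] prob_le_stat_dist[of q A r] by linarith
qed

lemma stat_dist_le_1: "stat_dist p q \<le> 1"
  by (rule stat_dist_le) (simp add: add_increasing)

lemma stat_dist_map: "stat_dist (map_pmf f p) (map_pmf f q) \<le> stat_dist p q"
  using prob_le_stat_dist by (intro stat_dist_le) (simp add: measure_map_pmf)

lemma integrable_pmf_bounded:
  fixes f :: "'a \<Rightarrow> real"
  shows "(\<And>x. 0 \<le> f x) \<Longrightarrow> (\<And>x. f x \<le> B) \<Longrightarrow> integrable (measure_pmf p) f"
  by (rule measure_pmf.integrable_const_bound[of _ B]) auto

lemma prob_bind_pmf: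
  "measure_pmf.prob (bind_pmf p f) A = measure_pmf.expectation p (\<lambda>x. measure_pmf.prob (f x) A)"
proof -
  have "ennreal (measure_pmf.prob (bind_pmf p f) A) = (\<integral>\<^sup>+x. ennreal (measure_pmf.prob (f x) A) \<partial>p)"
    by (simp flip: measure_pmf.emeasure_eq_measure)
  also have "\<dots> = ennreal (measure_pmf.expectation p (\<lambda>x. measure_pmf.prob (f x) A))"
    by (intro nn_integral_eq_integral integrable_pmf_bounded[of _ 1]) auto
  finally show ?thesis
    by (simp add: integral_nonneg_AE)
qed

lemma expectation_pmf_eq: "measure_pmf.expectation p f = (\<integral>x. pmf p x * f x \<partial>count_space UNIV)"
  for f :: "'a \<Rightarrow> real"
  by (subst measure_pmf_eq_density, subst integral_density) auto

text \<open>Among test functions with values in [0, 1], the difference is largest for the indicator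
  of the set where \<open>p\<close> exceeds \<open>q\<close>.\<close>

lemma expectation_le_stat_dist:
  fixes f :: "'a \<Rightarrow> real"
  assumes "\<And>x. 0 \<le> f x" "\<And>x. f x \<le> 1"
  shows "measure_pmf.expectation p f \<le> measure_pmf.expectation q f + stat_dist p q"
proof -
  define B where "B = {x. pmf q x < pmf p x}"
  have int: "integrable (count_space UNIV) (\<lambda>x. pmf r x * g x)"
    if "\<And>x. 0 \<le> g x" "\<And>x. g x \<le> 1" for r and g :: "'a \<Rightarrow> real"
  proof -
    have "integrable (density (count_space UNIV) (pmf r)) g"
      using integrable_pmf_bounded[of g 1 r, OF that] by (simp flip: measure_pmf_eq_density)
    then show ?thesis by (subst (asm) integrable_density) auto
  qed
  have "measure_pmf.expectation p f - measure_pmf.expectation q f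
      = (\<integral>x. pmf p x * f x - pmf q x * f x \<partial>count_space UNIV)"
    unfolding expectation_pmf_eq using assms int by (intro Bochner_Integration.integral_diff[symmetric]) auto
  also have "\<dots> \<le> (\<integral>x. pmf p x * indicator B x - pmf q x * indicator B x \<partial>count_space UNIV)"
  proof (rule integral_mono)
    fix x
    have "(pmf p x - pmf q x) * f x \<le> (pmf p x - pmf q x) * indicator B x"
      using assms[of x] by (cases "x \<in> B") (auto simp: B_def mult_left_le intro!: mult_nonpos_nonneg)
    then show "pmf p x * f x - pmf q x * f x \<le> pmf p x * indicator B x - pmf q x * indicator B x"
      by (simp add: left_diff_distrib)
  qed (use assms int in \<open>auto intro!: Bochner_Integration.integrable_diff\<close>)
  also have "\<dots> = measure_pmf.expectation p (indicator B) - measure_pmf.expectation q (indicator B)"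
    unfolding expectation_pmf_eq by (rule Bochner_Integration.integral_diff) (auto intro!: int)
  also have "\<dots> \<le> stat_dist p q"
    using prob_le_stat_dist[of p B q] by simp
  finally show ?thesis by linarith
qed

lemma stat_dist_bind_left: "stat_dist (bind_pmf p f) (bind_pmf q f) \<le> stat_dist p q"
  unfolding prob_bind_pmf by (intro stat_dist_le) (auto simp: prob_bind_pmf intro!: expectation_le_stat_dist)

text \<open>On the exceptional set \<open>B\<close> only the trivial bound 1 is used, so its
  probability is paid in full.\<close>

lemma stat_dist_bind_right:
  assumes "\<And>x. x \<in> set_pmf p \<Longrightarrow> x \<notin> B \<Longrightarrow> stat_dist (f x) (g x) \<le> e" "0 \<le> e"
  shows "stat_dist (bind_pmf p f) (bind_pmf p g) \<le> e + measure_pmf.prob p B"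
proof (rule stat_dist_le)
  fix A
  have int: "integrable (measure_pmf p) (\<lambda>x. measure_pmf.prob (h x) A)" for h :: "'a \<Rightarrow> 'b pmf"
    by (rule integrable_pmf_bounded[of _ 1]) auto
  have int_B: "integrable (measure_pmf p) (indicator B :: _ \<Rightarrow> real)"
    by (rule integrable_pmf_bounded[of _ 1]) (auto simp: indicator_def)
  have "measure_pmf.expectation p (\<lambda>x. measure_pmf.prob (f x) A)
      \<le> measure_pmf.expectation p (\<lambda>x. measure_pmf.prob (g x) A + (e + indicator B x))"
  proof (rule integral_mono_AE)
    show "AE x in measure_pmf p. measure_pmf.prob (f x) A \<le> measure_pmf.prob (g x) A + (e + indicator B x)"
    proof (rule AE_pmfI)
      fix x assume "x \<in> set_pmf p"
      show "measure_pmf.prob (f x) A \<le> measure_pmf.prob (g x) A + (e + indicator B x)"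
      proof (cases "x \<in> B")
        case True
        show ?thesis
          unfolding indicator_simps(1)[OF True]
          using measure_pmf.prob_le_1[of "f x" A] measure_nonneg[of "measure_pmf (g x)" A] assms(2) by linarith
      next
        case False
        show ?thesis
          unfolding indicator_simps(2)[OF False]
          using prob_le_stat_dist[of "f x" A "g x"] assms(1)[OF \<open>x \<in> set_pmf p\<close> False] by linarith
      qed
    qed
  qed (use int int_B in auto)
  also have "\<dots> = measure_pmf.expectation p (\<lambda>x. measure_pmf.prob (g x) A) + (e + measure_pmf.prob p B)"
    using int int_B by simp
  finally show "measure_pmf.prob (bind_pmf p f) A \<le> measure_pmf.prob (bind_pmf p g) A + (e + measure_pmf.prob p B)"
    by (simp add: prob_bind_pmf)
qed

lemma stat_dist_bind_right':
  assumes "\<And>x. x \<in> set_pmf p \<Longrightarrow> stat_dist (f x) (g x) \<le> e" "0 \<le> e"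
  shows "stat_dist (bind_pmf p f) (bind_pmf p g) \<le> e"
  using stat_dist_bind_right[of p "{}" f g e] assms by simp

text \<open>A hybrid argument: the laws are exchanged one coordinate at a time.\<close>

lemma stat_dist_mapM:
  assumes "\<And>x. x \<in> set xs \<Longrightarrow> stat_dist (f x) (g x) \<le> e"
  shows "stat_dist (mapM_pmf f xs) (mapM_pmf g xs) \<le> real (length xs) * e"
  using assms
proof (induction xs)
  case (Cons x xs)
  have "stat_dist (bind_pmf (f x) (\<lambda>y. map_pmf (Cons y) (mapM_pmf f xs)))
      (bind_pmf (f x) (\<lambda>y. map_pmf (Cons y) (mapM_pmf g xs))) \<le> real (length xs) * e"
  proof (rule stat_dist_bind_right')
    have IH: "stat_dist (mapM_pmf f xs) (mapM_pmf g xs) \<le> real (length xs) * e"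
      using Cons by simp
    show "stat_dist (map_pmf (Cons y) (mapM_pmf f xs)) (map_pmf (Cons y) (mapM_pmf g xs))
        \<le> real (length xs) * e" for y
      by (rule order.trans[OF stat_dist_map IH])
    show "0 \<le> real (length xs) * e"
      by (rule order.trans[OF stat_dist_nonneg IH])
  qed
  moreover have "stat_dist (bind_pmf (f x) (\<lambda>y. map_pmf (Cons y) (mapM_pmf g xs)))
      (bind_pmf (g x) (\<lambda>y. map_pmf (Cons y) (mapM_pmf g xs))) \<le> e"
    by (rule order.trans[OF stat_dist_bind_left Cons.prems]) simp
  ultimately show ?case
    using stat_dist_triangle[of "mapM_pmf f (x # xs)" "mapM_pmf g (x # xs)"
        "bind_pmf (f x) (\<lambda>y. map_pmf (Cons y) (mapM_pmf g xs))"]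
    by (simp add: algebra_simps)
qed simp

lemma stat_dist_replicate: "stat_dist (replicate_pmf n p) (replicate_pmf n q) \<le> real n * stat_dist p q"
  using stat_dist_mapM[of "[0..<n]" "\<lambda>_. p" "\<lambda>_. q" "stat_dist p q"]
    replicate_pmf_eq_mapM[of "[0..<n]" p] replicate_pmf_eq_mapM[of "[0..<n]" q] by simp

section \<open>Tail bounds\<close>

lemma nn_integral_prod_list_replicate_pmf:
  fixes p :: "'a pmf" and f :: "'a \<Rightarrow> ennreal"
  shows "(\<integral>\<^sup>+xs. prod_list (map f xs) \<partial>measure_pmf (replicate_pmf n p)) = (\<integral>\<^sup>+x. f x \<partial>measure_pmf p) ^ n"
  by (induction n) (simp_all add: nn_integral_cmult nn_integral_multc mult.commute)

text \<open>Markov's inequality for a product of independent factors, the common core of the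
  Chernoff bounds that follow. Nonnegative integrals avoid integrability conditions.\<close>

lemma prob_prod_list_replicate_pmf_ge:
  fixes p :: "'a pmf" and f :: "'a \<Rightarrow> real"
  assumes f: "\<And>x. 0 \<le> f x" and c: "(\<integral>\<^sup>+x. ennreal (f x) \<partial>measure_pmf p) \<le> ennreal c" "0 \<le> c" and a: "0 < a"
  shows "measure_pmf.prob (replicate_pmf n p) {xs. a \<le> prod_list (map f xs)} \<le> c ^ n / a"
proof -
  have pl: "ennreal (prod_list (map f xs)) = prod_list (map (\<lambda>x. ennreal (f x)) xs)" for xs
    by (induction xs) (auto simp: f ennreal_mult')
  have "emeasure (replicate_pmf n p) ({xs. 1 \<le> ennreal (1 / a) * ennreal (prod_list (map f xs))} \<inter> UNIV)
      \<le> ennreal (1 / a) * (\<integral>\<^sup>+xs. ennreal (prod_list (map f xs)) * indicator UNIV xs \<partial>replicate_pmf n p)"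
    using nn_integral_Markov_inequality[where u = "\<lambda>xs. ennreal (prod_list (map f xs))" and
        M = "measure_pmf (replicate_pmf n p)" and A = UNIV and c = "ennreal (1 / a)"]
    by simp
  also have "\<dots> = ennreal (1 / a) * (\<integral>\<^sup>+x. ennreal (f x) \<partial>p) ^ n"
    by (simp add: pl nn_integral_prod_list_replicate_pmf)
  also have "\<dots> \<le> ennreal (1 / a) * ennreal c ^ n"
    using c by (intro mult_left_mono power_mono) auto
  also have "\<dots> = ennreal (c ^ n / a)"
    using c a by (simp add: ennreal_power flip: ennreal_mult)
  also have "{xs. 1 \<le> ennreal (1 / a) * ennreal (prod_list (map f xs))} \<inter> UNIV = {xs. a \<le> prod_list (map f xs)}"
  proof -
    have "1 \<le> ennreal (1 / a) * ennreal (prod_list (map f xs)) \<longleftrightarrow> a \<le> prod_list (map f xs)" for xs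
    proof -
      have "ennreal (1 / a) * ennreal (prod_list (map f xs)) = ennreal (prod_list (map f xs) / a)"
        using a by (simp flip: ennreal_mult')
      then show ?thesis
        using a by (simp add: ennreal_ge_1 le_divide_eq)
    qed
    then show ?thesis by auto
  qed
  finally show ?thesis
    using c a by (simp add: measure_pmf.emeasure_eq_measure)
qed

lemma prod_list_map_if: "prod_list (map (\<lambda>x. if P x then c else 1) xs) = c ^ length (filter P xs)"
  for c :: real
  by (induction xs) auto

lemma nn_integral_if_pmf:
  assumes "0 \<le> c"
  shows "(\<integral>\<^sup>+x. ennreal (if P x then c else 1) \<partial>measure_pmf p) = ennreal (1 + (c - 1) * measure_pmf.prob p {x. P x})"
proof -
  let ?q = "measure_pmf.prob p {x. P x}"
  have "(\<integral>\<^sup>+x. ennreal (if P x then c else 1) \<partial>measure_pmf p)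
      = (\<integral>\<^sup>+x. ennreal c * indicator {x. P x} x + indicator (- {x. P x}) x \<partial>measure_pmf p)"
    by (intro nn_integral_cong) (auto simp: indicator_def)
  also have "\<dots> = ennreal c * ennreal ?q + ennreal (1 - ?q)"
    using measure_pmf.prob_compl[of "{x. P x}" p]
    by (simp add: nn_integral_add nn_integral_cmult measure_pmf.emeasure_eq_measure Compl_eq_Diff_UNIV)
  also have "\<dots> = ennreal (c * ?q + (1 - ?q))"
    using assms by (simp add: ennreal_plus ennreal_mult)
  finally show ?thesis by (simp add: algebra_simps)
qed

text \<open>A Chernoff bound with the fixed base 2, followed by \<open>1 + q \<le> exp q\<close>. A
  fixed base suffices when the threshold differs from the mean by a large enough constant
  factor.\<close>

lemma prob_filter_ge:
  "measure_pmf.prob (replicate_pmf n p) {xs. k \<le> length (filter P xs)}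
     \<le> exp (real n * measure_pmf.prob p {x. P x}) / 2 ^ k"
proof -
  let ?q = "measure_pmf.prob p {x. P x}"
  have "measure_pmf.prob (replicate_pmf n p) {xs. 2 ^ k \<le> prod_list (map (\<lambda>x. if P x then 2 else 1::real) xs)}
      \<le> (1 + ?q) ^ n / 2 ^ k"
    using nn_integral_if_pmf[of 2 p P] by (intro prob_prod_list_replicate_pmf_ge) auto
  also have "\<dots> \<le> exp ?q ^ n / 2 ^ k"
    by (intro divide_right_mono power_mono) (auto simp: exp_ge_add_one_self)
  finally show ?thesis
    by (simp add: prod_list_map_if exp_of_nat_mult)
qed

text \<open>Base 1/2 turns the lower tail into an event that a product is large; then
  \<open>1 - q / 2 \<le> exp (- q / 2)\<close>.\<close>

lemma prob_filter_le:
  "measure_pmf.prob (replicate_pmf n p) {xs. length (filter P xs) \<le> k}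
     \<le> exp (- (real n * measure_pmf.prob p {x. P x}) / 2) * 2 ^ k"
proof -
  let ?q = "measure_pmf.prob p {x. P x}"
  have "measure_pmf.prob (replicate_pmf n p) {xs. (1 / 2) ^ k \<le> prod_list (map (\<lambda>x. if P x then 1 / 2 else 1::real) xs)}
      \<le> (1 - ?q / 2) ^ n / (1 / 2) ^ k"
    using nn_integral_if_pmf[of "1 / 2" p P] order.trans[OF measure_pmf.prob_le_1[of p "{x. P x}"], of 2]
    by (intro prob_prod_list_replicate_pmf_ge) (auto simp: field_simps)
  also have "\<dots> \<le> exp (- ?q / 2) ^ n / (1 / 2) ^ k"
    using order.trans[OF measure_pmf.prob_le_1[of p "{x. P x}"], of 2] exp_ge_add_one_self[of "- ?q / 2"]
    by (intro divide_right_mono power_mono) auto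
  finally show ?thesis
    by (simp add: prod_list_map_if power_one_over flip: exp_of_nat_mult)
       (simp add: field_simps power_one_over)
qed

section \<open>The random sources\<close>

lemma pair_pmf_of_set:
  assumes "finite A" "A \<noteq> {}" "finite B" "B \<noteq> {}"
  shows "pair_pmf (pmf_of_set A) (pmf_of_set B) = pmf_of_set (A \<times> B)"
proof (rule pmf_eqI)
  fix x
  show "pmf (pair_pmf (pmf_of_set A) (pmf_of_set B)) x = pmf (pmf_of_set (A \<times> B)) x"
    using assms by (cases x) (simp add: pmf_pair indicator_def card_cartesian_product)
qed

text \<open>Every round halves the earlier sum, so the last coin becomes the leading bit: it adds
  \<open>0\<close> or \<open>2 ^ n\<close> to a uniform index below \<open>2 ^ n\<close>.\<close>

lemma draw_pmf_eq: "draw_pmf n = map_pmf (\<lambda>j. real j / 2 ^ n) (pmf_of_set {..<2 ^ n})"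
proof (induction n)
  case 0
  have "{..<1} = {0::nat}" by auto
  then show ?case by (simp add: draw_pmf_def pmf_of_set_singleton)
next
  case (Suc n)
  let ?A = "{..<2 ^ n} :: nat set"
  let ?f = "\<lambda>(j, c). j + (if c then 2 ^ n else 0) :: nat"
  have ne: "?A \<noteq> {}" by (simp add: lessThan_empty_iff)
  have "draw_pmf (Suc n) = bind_pmf (draw_pmf n)
      (\<lambda>u. map_pmf (\<lambda>c. (u + (if c then 1 else 0)) / 2) (pmf_of_set UNIV))"
    unfolding draw_pmf_def iter_Suc_right bernoulli_pmf_half_conv_pmf_of_set ..
  also have "\<dots> = map_pmf (\<lambda>(j, c). (real j / 2 ^ n + (if c then 1 else 0)) / 2)
      (pair_pmf (pmf_of_set ?A) (pmf_of_set UNIV))"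
    unfolding Suc.IH pair_pmf_def
    by (simp add: map_pmf_def bind_assoc_pmf bind_return_pmf)
  also have "\<dots> = map_pmf (\<lambda>j. real j / 2 ^ Suc n) (map_pmf ?f (pmf_of_set (?A \<times> UNIV)))"
    unfolding map_pmf_comp
    using ne by (auto simp: pair_pmf_of_set field_simps intro!: map_pmf_cong split: if_splits)
  also have "map_pmf ?f (pmf_of_set (?A \<times> UNIV)) = pmf_of_set (?f ` (?A \<times> UNIV))"
    using ne by (intro map_pmf_of_set_inj) (auto simp: inj_on_def split: if_splits)
  also have "?f ` (?A \<times> UNIV) = {..<2 ^ Suc n}"
  proof (intro equalityI subsetI)
    fix x :: nat assume x: "x \<in> {..<2 ^ Suc n}"
    show "x \<in> ?f ` (?A \<times> UNIV)"
    proof (cases "x < 2 ^ n")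
      case True
      then show ?thesis by (intro image_eqI[of _ _ "(x, False)"]) auto
    next
      case False
      then show ?thesis using x by (intro image_eqI[of _ _ "(x - 2 ^ n, True)"]) auto
    qed
  qed auto
  finally show ?case .
qed

lemma card_nat_between:
  fixes a b :: real
  assumes "0 \<le> a" "a \<le> b"
  shows "b - a - 1 \<le> real (card {j::nat. a \<le> real j \<and> real j < b})"
    "real (card {j::nat. a \<le> real j \<and> real j < b}) \<le> b - a + 1"
    "finite {j::nat. a \<le> real j \<and> real j < b}"
proof -
  have eq: "{j::nat. a \<le> real j \<and> real j < b} = {nat \<lceil>a\<rceil>..<nat \<lceil>b\<rceil>}"
    by (auto simp: nat_le_iff zless_nat_eq_int_zless ceiling_le_iff less_ceiling_iff)
  have "real (nat \<lceil>b\<rceil> - nat \<lceil>a\<rceil>) = of_int (\<lceil>b\<rceil> - \<lceil>a\<rceil>)"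
    using assms ceiling_mono[OF assms(2)] by (simp add: of_nat_diff[OF nat_mono[OF ceiling_mono[OF assms(2)]]])
  then show "b - a - 1 \<le> real (card {j::nat. a \<le> real j \<and> real j < b})"
    "real (card {j::nat. a \<le> real j \<and> real j < b}) \<le> b - a + 1"
    unfolding eq card_atLeastLessThan by linarith+
  show "finite {j::nat. a \<le> real j \<and> real j < b}"
    unfolding eq by simp
qed

text \<open>The number of grid points of spacing \<open>1 / 2 ^ n\<close> in a half-open interval
  differs from its scaled length by at most one.\<close>

lemma prob_draw_pmf:
  assumes "0 \<le> a" "a \<le> b" "b \<le> 1"
  shows "\<bar>measure_pmf.prob (draw_pmf n) {u. a \<le> u \<and> u < b} - (b - a)\<bar> \<le> 1 / 2 ^ n"
proof -
  let ?N = "2 ^ n :: real"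
  let ?C = "{j::nat. a * ?N \<le> real j \<and> real j < b * ?N}"
  have "{..<2 ^ n} \<inter> (\<lambda>j. real j / ?N) -` {u. a \<le> u \<and> u < b} = ?C"
  proof (intro equalityI subsetI)
    fix j assume j: "j \<in> ?C"
    have "b * ?N \<le> ?N" using assms by simp
    then have "real j < ?N" using j unfolding mem_Collect_eq by linarith
    then have "real j < real (2 ^ n)" by simp
    then have "j < 2 ^ n" by (simp only: of_nat_less_iff)
    then show "j \<in> {..<2 ^ n} \<inter> (\<lambda>j. real j / ?N) -` {u. a \<le> u \<and> u < b}"
      using j by (simp add: field_simps)
  qed (simp add: field_simps)
  then have "measure_pmf.prob (draw_pmf n) {u. a \<le> u \<and> u < b} = real (card ?C) / ?N"
    unfolding draw_pmf_eq by (simp add: measure_pmf_of_set lessThan_empty_iff)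
  moreover have "\<bar>real (card ?C) - (b - a) * ?N\<bar> \<le> 1"
    using card_nat_between[of "a * ?N" "b * ?N"] assms by (simp add: mult_right_mono algebra_simps abs_le_iff)
  then have "\<bar>real (card ?C) - (b - a) * ?N\<bar> / ?N \<le> 1 / ?N"
    by (intro divide_right_mono) auto
  then have "\<bar>(real (card ?C) - (b - a) * ?N) / ?N\<bar> \<le> 1 / ?N"
    by (simp add: abs_divide)
  then have "\<bar>real (card ?C) / ?N - (b - a)\<bar> \<le> 1 / ?N"
    by (simp add: diff_divide_distrib)
  ultimately show ?thesis by simp
qed

lemma set_draw_pmf: "u \<in> set_pmf (draw_pmf n) \<Longrightarrow> 0 \<le> u \<and> u < 1"
proof -
  assume "u \<in> set_pmf (draw_pmf n)"
  then obtain j where j: "j < 2 ^ n" "u = real j / 2 ^ n"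
    unfolding draw_pmf_eq by (auto simp: lessThan_empty_iff)
  have "real j < real (2 ^ n)" using j(1) by (simp only: of_nat_less_iff)
  then show "0 \<le> u \<and> u < 1" using j(2) by simp
qed

lemma stat_dist_bernoulli_draw:
  assumes "0 \<le> x" "x \<le> 1"
  shows "stat_dist (map_pmf (\<lambda>u. u < x) (draw_pmf n)) (bernoulli_pmf x) \<le> 1 / 2 ^ n"
proof -
  let ?p = "map_pmf (\<lambda>u. u < x) (draw_pmf n)"
  have "measure_pmf.prob (draw_pmf n) {u. u < x} = measure_pmf.prob (draw_pmf n) {u. 0 \<le> u \<and> u < x}"
    by (rule measure_pmf.finite_measure_eq_AE) (auto intro!: AE_pmfI dest: set_draw_pmf)
  then have *: "\<bar>pmf ?p True - x\<bar> \<le> 1 / 2 ^ n"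
    using prob_draw_pmf[of 0 x n] assms by (simp add: pmf_map vimage_def)
  have eq: "pmf ?p False = 1 - pmf ?p True"
    using pmf_False_conv_True[of ?p] by simp
  have pr: "measure_pmf.prob q A = (if True \<in> A then pmf q True else 0) + (if False \<in> A then pmf q False else 0)"
    for q :: "bool pmf" and A
  proof -
    have "measure_pmf.prob q A = (\<Sum>b\<in>UNIV. if b \<in> A then pmf q b else 0)"
      by (simp add: measure_measure_pmf_finite sum.If_cases)
    then show ?thesis by (simp add: UNIV_bool)
  qed
  show ?thesis
  proof (rule stat_dist_le)
    fix A
    have "0 \<le> 1 / (2::real) ^ n" by simp
    then show "measure_pmf.prob ?p A \<le> measure_pmf.prob (bernoulli_pmf x) A + 1 / 2 ^ n"
      unfolding pr[of ?p] pr[of "bernoulli_pmf x"] eq using * assms by (auto simp: abs_le_iff)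
  qed
qed

text \<open>The uniform variates that are sent to \<open>k\<close> include an interval whose length
  is the normalized weight of \<open>k\<close>; the grid costs \<open>1 / 2 ^ n\<close>. The lower
  bound is what the comparison with the Poisson law uses.\<close>

lemma pmf_inverse_cdf_ge:
  assumes k: "k \<le> K"
  shows "real G ^ k / fact k / partial_exp G K - 1 / 2 ^ n \<le> pmf (map_pmf (inverse_cdf G K) (draw_pmf n)) k"
proof -
  let ?Z = "partial_exp G K"
  define b where "b = partial_exp G k / ?Z"
  \<comment> \<open>Subtracting the last weight stands for the partial sum up to
    \<open>k - 1\<close> and also gives the left end 0 when \<open>k = 0\<close>.\<close>
  define a where "a = (partial_exp G k - real G ^ k / fact k) / ?Z"
  have Z: "?Z > 0" by (rule partial_exp_pos)
  have mono: "partial_exp G i \<le> partial_exp G j" if "i \<le> j" for i j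
    unfolding partial_exp_def using that by (intro sum_mono2) auto
  have prev: "partial_exp G i \<le> partial_exp G k - real G ^ k / fact k" if i: "i < k" for i
  proof -
    obtain k' where "k = Suc k'" using i by (cases k) auto
    then show ?thesis using mono[of i k'] i by (simp add: partial_exp_def)
  qed
  have "0 \<le> partial_exp G k - real G ^ k / fact k"
    by (cases k) (simp_all add: partial_exp_def sum_nonneg)
  then have ab: "0 \<le> a" "a \<le> b" "b \<le> 1"
    using Z mono[OF k] by (auto simp: a_def b_def intro!: divide_right_mono)
  have "b - a - 1 / 2 ^ n \<le> measure_pmf.prob (draw_pmf n) {u. a \<le> u \<and> u < b}"
    using prob_draw_pmf[OF ab, of n] by (simp add: abs_le_iff)
  also have "\<dots> \<le> measure_pmf.prob (draw_pmf n) (inverse_cdf G K -` {k})"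
  proof (rule measure_pmf.finite_measure_mono)
    have "inverse_cdf G K u = k" if u: "a \<le> u" "u < b" for u
      unfolding inverse_cdf_def
    proof (rule Least_equality)
      show "u * ?Z < partial_exp G k"
        using u(2) Z by (simp add: b_def pos_less_divide_eq)
      fix i assume i: "u * ?Z < partial_exp G i"
      show "k \<le> i"
      proof (rule ccontr)
        assume "\<not> k \<le> i"
        then have "partial_exp G i \<le> a * ?Z"
          using prev[of i] Z by (simp add: a_def)
        also have "\<dots> \<le> u * ?Z" using u(1) Z by simp
        finally show False using i by simp
      qed
    qed
    then show "{u. a \<le> u \<and> u < b} \<subseteq> inverse_cdf G K -` {k}" by auto
  qed simp
  also have "b - a = real G ^ k / fact k / ?Z"
    by (simp add: a_def b_def diff_divide_distrib)
  finally show ?thesis by (simp add: pmf_map)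
qed

lemma summable_exp_real: "summable (\<lambda>k. x ^ k / fact k :: real)"
  using summable_exp[of x] by (simp add: field_simps)

lemma suminf_exp_real: "(\<Sum>k. x ^ k / fact k) = exp (x :: real)"
  by (simp add: exp_def field_simps)

lemma nn_integral_poisson_power:
  assumes "0 < \<mu>" "0 \<le> c"
  shows "(\<integral>\<^sup>+k. ennreal (c ^ k) \<partial>measure_pmf (poisson_pmf \<mu>)) = ennreal (exp (\<mu> * (c - 1)))"
proof -
  have "(\<integral>\<^sup>+k. ennreal (c ^ k) \<partial>measure_pmf (poisson_pmf \<mu>))
      = (\<Sum>k. ennreal (exp (- \<mu>) * ((c * \<mu>) ^ k / fact k)))"
    using assms unfolding nn_integral_measure_pmf nn_integral_count_space_nat
    by (intro suminf_cong) (simp add: power_mult_distrib mult_ac flip: ennreal_mult)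
  also have "\<dots> = ennreal (\<Sum>k. exp (- \<mu>) * ((c * \<mu>) ^ k / fact k))"
    using assms summable_exp_real[of "c * \<mu>"] by (intro suminf_ennreal2 summable_mult) auto
  also have "(\<Sum>k. exp (- \<mu>) * ((c * \<mu>) ^ k / fact k)) = exp (- \<mu>) * exp (c * \<mu>)"
    using summable_exp_real[of "c * \<mu>"] by (subst suminf_mult) (simp_all add: suminf_exp_real)
  also have "\<dots> = exp (\<mu> * (c - 1))"
    by (simp add: algebra_simps flip: exp_add)
  finally show ?thesis .
qed

text \<open>A Poisson variate \<open>w\<close> has \<open>E (2 ^ w) = exp \<mu>\<close>, so Markov's
  inequality with base 2 takes this simple form.\<close>

lemma prob_sum_poisson_ge:
  assumes "0 < \<mu>"
  shows "measure_pmf.prob (replicate_pmf n (poisson_pmf \<mu>)) {ws. k \<le> sum_list ws} \<le> exp (real n * \<mu>) / 2 ^ k"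
proof -
  have eq: "prod_list (map (\<lambda>w. 2 ^ w) ws) = (2::real) ^ sum_list ws" for ws
    by (induction ws) (simp_all add: power_add)
  show ?thesis
    using prob_prod_list_replicate_pmf_ge[of "\<lambda>w. 2 ^ w" "poisson_pmf \<mu>" "exp \<mu>" "2 ^ k" n]
      nn_integral_poisson_power[OF assms, of 2]
    by (simp add: eq exp_of_nat_mult)
qed

text \<open>The distance is turned around: truncation only raises the weights up to
  \<open>K\<close>, so the Poisson law can exceed the sampled one by the grid error at each of
  \<open>K + 1\<close> values and by its own tail beyond \<open>K\<close>.\<close>

lemma stat_dist_inverse_cdf:
  assumes "0 < G"
  shows "stat_dist (map_pmf (inverse_cdf G K) (draw_pmf n)) (poisson_pmf (real G))
    \<le> (real K + 1) / 2 ^ n + exp (real G) / 2 ^ Suc K"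
  unfolding stat_dist_commute[of _ "poisson_pmf (real G)"]
proof (rule stat_dist_le)
  let ?W = "map_pmf (inverse_cdf G K) (draw_pmf n)" and ?P = "poisson_pmf (real G)"
  fix A
  have "partial_exp G K \<le> exp (real G)"
    unfolding partial_exp_def suminf_exp_real[symmetric] using summable_exp_real
    by (intro sum_le_suminf) auto
  then have le: "pmf ?P k \<le> pmf ?W k + 1 / 2 ^ n" if "k \<le> K" for k
  proof -
    have "pmf ?P k = real G ^ k / fact k / exp (real G)"
      using assms by (simp add: exp_minus field_simps)
    also have "\<dots> \<le> real G ^ k / fact k / partial_exp G K"
      using \<open>partial_exp G K \<le> exp (real G)\<close> partial_exp_pos[of G K] by (intro divide_left_mono) auto
    finally show ?thesis
      using pmf_inverse_cdf_ge[OF that, of G n] by linarith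
  qed
  have tail: "measure_pmf.prob ?P {Suc K..} \<le> exp (real G) / 2 ^ Suc K"
    using prob_sum_poisson_ge[of "real G" 1 "Suc K"] assms
    by (simp add: replicate_pmf_1[unfolded One_nat_def] vimage_def atLeast_def del: replicate_pmf.simps)
  have "measure_pmf.prob ?P A \<le> measure_pmf.prob ?P ((A \<inter> {..K}) \<union> {Suc K..})"
    by (rule measure_pmf.finite_measure_mono) auto
  also have "\<dots> \<le> measure_pmf.prob ?P (A \<inter> {..K}) + measure_pmf.prob ?P {Suc K..}"
    by (rule measure_Un_le) auto
  also have "measure_pmf.prob ?P (A \<inter> {..K}) = (\<Sum>k\<in>A \<inter> {..K}. pmf ?P k)"
    by (rule measure_measure_pmf_finite) simp
  also have "\<dots> \<le> (\<Sum>k\<in>A \<inter> {..K}. pmf ?W k + 1 / 2 ^ n)"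
    using le by (intro sum_mono) auto
  also have "\<dots> = measure_pmf.prob ?W (A \<inter> {..K}) + real (card (A \<inter> {..K})) * (1 / 2 ^ n)"
    by (simp add: sum.distrib measure_measure_pmf_finite del: measure_map_pmf)
  also have "measure_pmf.prob ?W (A \<inter> {..K}) \<le> measure_pmf.prob ?W A"
    by (rule measure_pmf.finite_measure_mono) auto
  also have "real (card (A \<inter> {..K})) * (1 / 2 ^ n) \<le> (real K + 1) * (1 / 2 ^ n)"
    using card_mono[of "{..K}" "A \<inter> {..K}"] by (intro mult_right_mono) auto
  also note tail
  finally show "measure_pmf.prob ?P A \<le> measure_pmf.prob ?W A + ((real K + 1) / 2 ^ n + exp (real G) / 2 ^ Suc K)"
    by simp
qed

section \<open>The acceptance probability\<close>

lemma accept_prob_bounds: "0 < accept_prob n \<and> accept_prob n \<le> 1"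
proof (induction n)
  case (Suc n)
  have "accept_prob n * (real n + 1) \<le> 1 * (real n + 3 / 2)"
    using Suc by (intro mult_mono) auto
  then show ?case
    using Suc by (simp add: divide_le_eq)
qed simp

definition accept_rate :: "real \<Rightarrow> real" where
  "accept_rate \<mu> = measure_pmf.expectation (poisson_pmf \<mu>) accept_prob"

text \<open>
  As \<^term>\<open>accept_prob n\<close> is the fractional falling factorial of order -1/2, up to a constant factor,
  \<^term>\<open>x * accept_rate (x\<^sup>2)\<close> is the integral of the Gaussian over the interval from 0 to \<^term>\<open>x\<close>;
  only its derivative is needed.
\<close>

definition gauss_series :: "real \<Rightarrow> real" where
  "gauss_series x = (\<Sum>n. accept_prob n / fact n * x ^ n)"

lemma summable_gauss_series: "summable (\<lambda>n. accept_prob n / fact n * x ^ n)"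
proof (rule summable_comparison_test)
  show "\<exists>N. \<forall>n\<ge>N. norm (accept_prob n / fact n * x ^ n) \<le> \<bar>x\<bar> ^ n / fact n"
    using accept_prob_bounds by (auto simp: abs_mult power_abs less_imp_le intro!: exI[of _ 0] divide_right_mono mult_left_le_one_le)
  show "summable (\<lambda>n. \<bar>x\<bar> ^ n / fact n)"
    by (rule summable_exp_real)
qed

lemma accept_rate_eq:
  assumes "0 < \<mu>"
  shows "accept_rate \<mu> = exp (- \<mu>) * gauss_series \<mu>"
proof -
  have "accept_rate \<mu> = (\<integral>n. \<mu> ^ n / fact n * exp (- \<mu>) * accept_prob n \<partial>count_space UNIV)"
    using assms by (simp add: accept_rate_def expectation_pmf_eq)
  also have "\<dots> = (\<Sum>n. \<mu> ^ n / fact n * exp (- \<mu>) * accept_prob n)"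
  proof (rule integral_count_space_nat)
    have "summable (\<lambda>n. exp (- \<mu>) * (accept_prob n / fact n * \<mu> ^ n))"
      by (intro summable_mult summable_gauss_series)
    then show "integrable (count_space UNIV) (\<lambda>n. \<mu> ^ n / fact n * exp (- \<mu>) * accept_prob n)"
      using assms accept_prob_bounds
      by (simp add: integrable_count_space_nat_iff abs_mult less_imp_le mult_ac)
  qed
  also have "\<dots> = exp (- \<mu>) * gauss_series \<mu>"
    unfolding gauss_series_def using summable_gauss_series[of \<mu>] by (subst suminf_mult[symmetric]) (simp_all add: mult_ac)
  finally show ?thesis .
qed

text \<open>For the coefficients \<open>c\<close>, the recursion of \<open>accept_prob\<close> reads
  \<open>(n + 3/2) * c (n + 1) = c n\<close>, so
  \<open>(n + 1) * c (n + 1) = c n - c (n + 1) / 2\<close>. Summation gives the equation; the 1 is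
  the missing constant term of the shifted series.\<close>

lemma gauss_series_ode:
  "(gauss_series has_field_derivative (gauss_series x + (1 - gauss_series x) / (2 * x))) (at x)"
  if "x > 0" for x
proof -
  let ?c = "\<lambda>n. accept_prob n / fact n"
  have d: "(gauss_series has_field_derivative (\<Sum>n. diffs ?c n * x ^ n)) (at x)"
    unfolding gauss_series_def [abs_def]
    by (rule termdiffs_strong_converges_everywhere) (rule summable_gauss_series)
  have sd: "summable (\<lambda>n. diffs ?c n * x ^ n)"
    by (rule termdiff_converges_all) (rule summable_gauss_series)
  have rec: "(real n + 3 / 2) * ?c (Suc n) = ?c n" for n
  proof -
    have "real n + 3 / 2 \<noteq> 0" by linarith
    then have "(real n + 3 / 2) * accept_prob (Suc n) = accept_prob n * (real n + 1)" by simp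
    then have "(real n + 3 / 2) * ?c (Suc n) = accept_prob n * (real n + 1) / ((real n + 1) * fact n)"
      by (simp only: times_divide_eq_right fact_Suc of_nat_Suc add.commute)
    also have "\<dots> = ?c n"
      using of_nat_neq_0[of n, where ?'a = real] by (simp del: of_nat_neq_0)
    finally show ?thesis .
  qed
  have "diffs ?c n * x ^ n = ?c n * x ^ n - (?c (Suc n) * x ^ Suc n) / (2 * x)" for n
  proof -
    define C where "C = ?c (Suc n)"
    have 1: "diffs ?c n = (real n + 1) * C"
      unfolding C_def by (simp only: diffs_def of_nat_Suc add.commute)
    have 2: "?c n = (real n + 3 / 2) * C"
      unfolding C_def by (rule rec[symmetric])
    show ?thesis
      unfolding C_def[symmetric] 1 2 using that by (simp add: field_simps)
  qed
  moreover have s1: "summable (\<lambda>n. ?c (Suc n) * x ^ Suc n)"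
    using summable_Suc_iff[THEN iffD2, OF summable_gauss_series[of x]] .
  ultimately have "(\<Sum>n. diffs ?c n * x ^ n) = (\<Sum>n. ?c n * x ^ n - (?c (Suc n) * x ^ Suc n) / (2 * x))"
    by simp
  also have "\<dots> = gauss_series x - (\<Sum>n. ?c (Suc n) * x ^ Suc n) / (2 * x)"
    unfolding suminf_diff[OF summable_gauss_series summable_divide[OF s1], symmetric]
      suminf_divide[OF s1] gauss_series_def ..
  also have "(\<Sum>n. ?c (Suc n) * x ^ Suc n) = gauss_series x - 1"
    using suminf_split_head[OF summable_gauss_series[of x]] by (simp add: gauss_series_def)
  also have "gauss_series x - (gauss_series x - 1) / (2 * x) = gauss_series x + (1 - gauss_series x) / (2 * x)"
    by (simp add: diff_divide_distrib)
  finally show ?thesis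
    using d by (simp only:)
qed

definition gauss_integral :: "real \<Rightarrow> real" where
  "gauss_integral y = sqrt y * accept_rate y"

text \<open>In the product \<open>sqrt y * exp (- y) * gauss_series y\<close> all terms containing
  the series cancel by its differential equation; the inhomogeneous part \<open>1 / (2 * y)\<close>
  remains.\<close>

lemma gauss_integral_deriv:
  assumes "0 < y"
  shows "(gauss_integral has_field_derivative exp (- y) / (2 * sqrt y)) (at y)"
proof -
  have root: "sqrt y * (sqrt y * a) = y * a" for a
    using assms by (simp flip: mult.assoc)
  have "((\<lambda>y. sqrt y * (exp (- y) * gauss_series y)) has_field_derivative exp (- y) / (2 * sqrt y)) (at y)"
    using assms
    by (auto intro!: derivative_eq_intros gauss_series_ode simp: field_simps)
       (simp add: root algebra_simps)
  moreover have "eventually (\<lambda>z. sqrt z * (exp (- z) * gauss_series z) = gauss_integral z) (nhds y)"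
    using eventually_nhds_in_open[of "{0<..}" y] assms
    by (auto elim!: eventually_mono simp: gauss_integral_def accept_rate_eq)
  ultimately show ?thesis
    by (subst (asm) DERIV_cong_ev[OF refl _ refl]) auto
qed

lemma gauss_integral_mono:
  assumes "0 < x" "x \<le> y"
  shows "gauss_integral x \<le> gauss_integral y"
proof (rule DERIV_nonneg_imp_nondecreasing[OF assms(2)])
  fix z assume "x \<le> z" "z \<le> y"
  then show "\<exists>d. (gauss_integral has_real_derivative d) (at z) \<and> 0 \<le> d"
    using gauss_integral_deriv[of z] assms(1) by (intro exI[of _ "exp (- z) / (2 * sqrt z)"]) auto
qed

text \<open>For \<open>z \<ge> 1\<close> the derivative is at most \<open>exp (- z)\<close>, so the
  function becomes nonincreasing after adding \<open>exp (- z)\<close>.\<close>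

lemma gauss_integral_le:
  assumes "1 \<le> x" "x \<le> y"
  shows "gauss_integral y \<le> gauss_integral x + exp (- x)"
proof -
  have "gauss_integral y + exp (- y) \<le> gauss_integral x + exp (- x)"
  proof (rule DERIV_nonpos_imp_nonincreasing[OF assms(2)])
    fix z assume z: "x \<le> z" "z \<le> y"
    then have "0 < z" using assms(1) by linarith
    then have "((\<lambda>z. gauss_integral z + exp (- z)) has_real_derivative (exp (- z) / (2 * sqrt z) - exp (- z))) (at z)"
      using gauss_integral_deriv[of z] assms(1) by (auto intro!: derivative_eq_intros)
    moreover have "1 \<le> 2 * sqrt z" using z assms(1) real_sqrt_ge_one[of z] by linarith
    then have "exp (- z) / (2 * sqrt z) \<le> exp (- z)"
      using mult_left_mono[of 1 "2 * sqrt z" "exp (- z)"] \<open>0 < z\<close> by (subst pos_divide_le_eq) auto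
    ultimately show "\<exists>d. ((\<lambda>z. gauss_integral z + exp (- z)) has_real_derivative d) (at z) \<and> d \<le> 0"
      by (intro exI[of _ "exp (- z) / (2 * sqrt z) - exp (- z)"]) auto
  qed
  then show ?thesis using exp_ge_zero[of "- y"] by linarith
qed

text \<open>By monotonicity the argument 1 suffices, where the constant term of the series already
  gives \<open>exp (- 1)\<close>.\<close>

lemma gauss_integral_ge:
  assumes "1 \<le> x"
  shows "exp (- 1) \<le> gauss_integral x"
proof -
  have "accept_prob 0 / fact 0 * 1 ^ 0 \<le> gauss_series 1"
    unfolding gauss_series_def
    using sum_le_suminf[OF summable_gauss_series[of 1], of "{0}"] accept_prob_bounds by (simp add: less_imp_le)
  then have "exp (- 1) * 1 \<le> gauss_integral 1"
    unfolding gauss_integral_def by (simp add: accept_rate_eq)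
  also have "\<dots> \<le> gauss_integral x"
    using assms by (intro gauss_integral_mono) auto
  finally show ?thesis by simp
qed

section \<open>Poissonization\<close>

lemma pmf_replicate_pmf: "pmf (replicate_pmf n p) xs = (if length xs = n then prod_list (map (pmf p) xs) else 0)"
proof (induction n arbitrary: xs)
  case 0
  then show ?case by (auto simp: indicator_def)
next
  case (Suc n)
  have eq: "replicate_pmf (Suc n) p = map_pmf (\<lambda>(x, xs). x # xs) (pair_pmf p (replicate_pmf n p))"
    by (simp add: pair_pmf_def map_bind_pmf)
  show ?case
  proof (cases xs)
    case Nil
    then have "[] \<notin> (\<lambda>(x, xs). x # xs) ` set_pmf (pair_pmf p (replicate_pmf n p))" by auto
    then show ?thesis unfolding eq Nil by (subst pmf_map_outside) auto
  next
    case (Cons y ys)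
    have "inj (\<lambda>(x :: 'a, xs). x # xs)" by (auto simp: inj_def)
    then have "pmf (replicate_pmf (Suc n) p) (y # ys) = pmf (pair_pmf p (replicate_pmf n p)) (y, ys)"
      unfolding eq using pmf_map_inj'[of "\<lambda>(x, xs). x # xs" _ "(y, ys)"] by simp
    then show ?thesis using Suc.IH[of ys] Cons by (simp add: pmf_pair del: replicate_pmf.simps)
  qed
qed

definition poisson_list_pmf :: "real \<Rightarrow> 'a pmf \<Rightarrow> 'a list pmf" where
  "poisson_list_pmf \<mu> p = bind_pmf (poisson_pmf \<mu>) (\<lambda>w. replicate_pmf w p)"

lemma pmf_poisson_list_pmf:
  assumes "0 < \<mu>"
  shows "pmf (poisson_list_pmf \<mu> p) xs
    = \<mu> ^ length xs / fact (length xs) * exp (- \<mu>) * prod_list (map (pmf p) xs)"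
proof -
  have "pmf (poisson_list_pmf \<mu> p) xs
      = (\<integral>w. (if w = length xs then prod_list (map (pmf p) xs) else 0) \<partial>measure_pmf (poisson_pmf \<mu>))"
    by (simp add: poisson_list_pmf_def pmf_bind pmf_replicate_pmf eq_commute)
  also have "\<dots> = (\<Sum>w\<in>{length xs}. (if w = length xs then prod_list (map (pmf p) xs) else 0) * pmf (poisson_pmf \<mu>) w)"
    by (rule integral_measure_pmf_real) (auto split: if_splits)
  finally show ?thesis
    using assms by (simp add: mult_ac)
qed

lemma prod_list_eq_prod_count:
  fixes f :: "'a \<Rightarrow> real"
  assumes "finite A" "set xs \<subseteq> A"
  shows "prod_list (map f xs) = (\<Prod>i\<in>A. f i ^ count_list xs i)"
  using assms(2)
proof (induction xs)
  case (Cons x xs)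
  have "(\<Prod>i\<in>A. f i ^ count_list (x # xs) i) = (\<Prod>i\<in>A. (if i = x then f x else 1) * f i ^ count_list xs i)"
    by (intro prod.cong) auto
  also have "\<dots> = f x * (\<Prod>i\<in>A. f i ^ count_list xs i)"
    using assms(1) Cons.prems by (simp add: prod.distrib prod.delta)
  finally show ?case using Cons by simp
qed simp

lemma real_card_permutations_of_multiset:
  "real (card (permutations_of_multiset D)) = fact (size D) / (\<Prod>x\<in>set_mset D. fact (count D x))"
proof -
  have "real (card (permutations_of_multiset D)) = real (fact (size D) div (\<Prod>x\<in>set_mset D. fact (count D x)))"
    by (simp add: card_permutations_of_multiset(1))
  also have "\<dots> = real (fact (size D)) / real (\<Prod>x\<in>set_mset D. fact (count D x))"
    by (intro real_of_nat_div card_permutations_of_multiset(2))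
  finally show ?thesis by simp
qed

text \<open>Poisson splitting. The lists with counts \<open>c\<close> are the permutations of one
  multiset; the factorial of the length in their number cancels the one in the Poisson weight, and
  the remaining terms factor over the values.\<close>

lemma map_count_poisson_list_pmf:
  assumes fin: "finite (set_pmf p)" and \<mu>: "0 < \<mu>"
  shows "map_pmf count_list (poisson_list_pmf \<mu> p) = Pi_pmf (set_pmf p) 0 (\<lambda>i. poisson_pmf (\<mu> * pmf p i))"
    (is "?L = ?R")
proof (rule pmf_eqI)
  fix c
  let ?A = "set_pmf p"
  let ?P = "poisson_list_pmf \<mu> p"
  have set_P: "set xs \<subseteq> ?A" if "xs \<in> set_pmf ?P" for xs
    using that by (auto simp: poisson_list_pmf_def set_replicate_pmf)
  have L: "pmf ?L c = measure_pmf.prob ?P {xs. count_list xs = c}"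
    by (simp add: pmf_map vimage_def)
  show "pmf ?L c = pmf ?R c"
  proof (cases "\<forall>i. i \<notin> ?A \<longrightarrow> c i = 0")
    case False
    then obtain i where i: "i \<notin> ?A" "c i \<noteq> 0" by blast
    have "xs \<notin> set_pmf ?P" if "count_list xs = c" for xs
    proof
      assume "xs \<in> set_pmf ?P"
      then have "i \<notin> set xs" using set_P i(1) by blast
      then show False using i(2) that by (auto simp: count_list_0_iff)
    qed
    then have "pmf ?L c = 0"
      unfolding pmf_eq_0_set_pmf by auto
    moreover have "pmf ?R c = 0"
      using i by (intro pmf_Pi_outside[OF fin]) auto
    ultimately show ?thesis by simp
  next
    case True
    define D where "D = (\<Sum>i\<in>?A. replicate_mset (c i) i)"
    have cD: "count D i = c i" for i
      using fin True by (auto simp: D_def count_sum)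
    have setD: "set_mset D \<subseteq> ?A"
      using True by (auto simp: cD simp flip: count_greater_zero_iff)
    have eq: "{xs. count_list xs = c} = permutations_of_multiset D"
    proof (intro equalityI subsetI)
      fix xs assume "xs \<in> {xs. count_list xs = c}"
      then have "mset xs = D"
        by (intro multiset_eqI) (auto simp: cD count_mset)
      then show "xs \<in> permutations_of_multiset D" by (rule permutations_of_multisetI)
    next
      fix xs assume "xs \<in> permutations_of_multiset D"
      then have "mset xs = D" by (rule permutations_of_multisetD)
      then show "xs \<in> {xs. count_list xs = c}"
        by (simp add: cD fun_eq_iff flip: count_mset)
    qed
    define n where "n = (\<Sum>i\<in>?A. c i)"
    have size: "size D = n"
      unfolding size_multiset_overloaded_eq n_def cD using setD fin
      by (intro sum.mono_neutral_left) (auto simp flip: cD simp: not_in_iff)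
    have pmf: "pmf ?P xs = \<mu> ^ n / fact n * exp (- \<mu>) * (\<Prod>i\<in>?A. pmf p i ^ c i)"
      if "xs \<in> permutations_of_multiset D" for xs
    proof -
      have "mset xs = D" using that by (rule permutations_of_multisetD)
      then have "set xs \<subseteq> ?A" "length xs = n" "count_list xs = c"
        using setD size that eq by (auto simp flip: set_mset_mset size_mset)
      then show ?thesis
        using \<mu> fin by (simp add: pmf_poisson_list_pmf prod_list_eq_prod_count)
    qed
    have pf: "(\<Prod>x\<in>set_mset D. fact (count D x)) = (\<Prod>i\<in>?A. fact (c i) :: real)"
      using setD fin unfolding cD by (intro prod.mono_neutral_left) (auto simp flip: cD simp: not_in_iff)
    have sum1: "(\<Sum>i\<in>?A. pmf p i) = 1"
      using fin by (rule sum_pmf_eq_1) simp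
    have "pmf ?L c = (\<Sum>xs\<in>permutations_of_multiset D. pmf ?P xs)"
      unfolding L eq by (rule measure_measure_pmf_finite) simp
    also have "\<dots> = fact n / (\<Prod>i\<in>?A. fact (c i)) * (\<mu> ^ n / fact n * exp (- \<mu>) * (\<Prod>i\<in>?A. pmf p i ^ c i))"
      by (simp add: pmf real_card_permutations_of_multiset size pf)
    also have "\<dots> = \<mu> ^ n * exp (- \<mu>) * (\<Prod>i\<in>?A. pmf p i ^ c i) / (\<Prod>i\<in>?A. fact (c i))"
      by (simp add: field_simps)
    also have "\<mu> ^ n = (\<Prod>i\<in>?A. \<mu> ^ c i)"
      by (simp add: n_def power_sum)
    also have "exp (- \<mu>) = (\<Prod>i\<in>?A. exp (- (\<mu> * pmf p i)))"
    proof -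
      have "(\<Sum>i\<in>?A. - (\<mu> * pmf p i)) = - \<mu>"
        by (simp add: sum_negf sum1 flip: sum_distrib_left)
      then show ?thesis using fin by (simp flip: exp_sum)
    qed
    also have "(\<Prod>i\<in>?A. \<mu> ^ c i) * (\<Prod>i\<in>?A. exp (- (\<mu> * pmf p i))) * (\<Prod>i\<in>?A. pmf p i ^ c i) / (\<Prod>i\<in>?A. fact (c i))
        = (\<Prod>i\<in>?A. (\<mu> * pmf p i) ^ c i / fact (c i) * exp (- (\<mu> * pmf p i)))"
      by (simp add: prod.distrib[symmetric] prod_dividef[symmetric] power_mult_distrib mult_ac)
    also have "\<dots> = pmf ?R c"
      using True fin \<mu> by (subst pmf_Pi) (auto simp: pmf_positive intro!: prod.cong)
    finally show ?thesis .
  qed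
qed

lemma nn_integral_prod_replicate_pmf:
  fixes F :: "nat \<Rightarrow> 'a \<Rightarrow> ennreal"
  shows "(\<integral>\<^sup>+xs. (\<Prod>r<n. F r (xs ! r)) \<partial>measure_pmf (replicate_pmf n p)) = (\<Prod>r<n. \<integral>\<^sup>+x. F r x \<partial>measure_pmf p)"
proof (induction n arbitrary: F)
  case (Suc n)
  show ?case
    using Suc.IH[of "\<lambda>r. F (Suc r)"]
    by (simp add: prod.lessThan_Suc_shift nn_integral_cmult nn_integral_multc del: prod.lessThan_Suc)
qed simp

lemma ennreal_expectation:
  fixes f :: "'a \<Rightarrow> real"
  assumes "\<And>x. 0 \<le> f x" "\<And>x. f x \<le> 1"
  shows "(\<integral>\<^sup>+x. ennreal (f x) \<partial>measure_pmf p) = ennreal (measure_pmf.expectation p f)"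
  using assms by (intro nn_integral_eq_integral integrable_pmf_bounded[of _ 1]) auto

lemma expectation_prod_replicate_pmf:
  fixes F :: "nat \<Rightarrow> 'a \<Rightarrow> real"
  assumes F: "\<And>r x. 0 \<le> F r x" "\<And>r x. F r x \<le> 1"
  shows "measure_pmf.expectation (replicate_pmf n p) (\<lambda>xs. \<Prod>r<n. F r (xs ! r))
    = (\<Prod>r<n. measure_pmf.expectation p (F r))"
proof -
  have "ennreal (measure_pmf.expectation (replicate_pmf n p) (\<lambda>xs. \<Prod>r<n. F r (xs ! r)))
      = (\<integral>\<^sup>+xs. (\<Prod>r<n. ennreal (F r (xs ! r))) \<partial>measure_pmf (replicate_pmf n p))"
    using F by (subst ennreal_expectation[symmetric]) (auto simp: prod_ennreal intro!: prod_nonneg prod_le_1)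
  also have "\<dots> = (\<Prod>r<n. ennreal (measure_pmf.expectation p (F r)))"
    unfolding nn_integral_prod_replicate_pmf[where F = "\<lambda>r x. ennreal (F r x)"]
    using F by (intro prod.cong refl ennreal_expectation)
  also have "\<dots> = ennreal (\<Prod>r<n. measure_pmf.expectation p (F r))"
    using F by (intro prod_ennreal integral_nonneg_AE) auto
  finally show ?thesis
    using F by (subst (asm) ennreal_inj) (auto intro!: integral_nonneg_AE prod_nonneg)
qed

lemma pmf_mapM_pmf:
  fixes f :: "'a \<Rightarrow> 'b pmf"
  shows "length ys = length xs \<Longrightarrow> pmf (mapM_pmf f xs) ys = (\<Prod>j<length xs. pmf (f (xs ! j)) (ys ! j))"
proof (induction xs arbitrary: ys)
  case (Cons x xs)
  then obtain y zs where ys: "ys = y # zs" "length zs = length xs" by (cases ys) auto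
  have eq: "mapM_pmf f (x # xs) = map_pmf (\<lambda>(y, ys). y # ys) (pair_pmf (f x) (mapM_pmf f xs))"
    by (simp add: pair_pmf_def map_bind_pmf map_pmf_def bind_assoc_pmf bind_return_pmf)
  have "inj (\<lambda>(y :: 'b, ys). y # ys)" by (auto simp: inj_def)
  then have "pmf (mapM_pmf f (x # xs)) (y # zs) = pmf (pair_pmf (f x) (mapM_pmf f xs)) (y, zs)"
    unfolding eq using pmf_map_inj'[of "\<lambda>(y, ys). y # ys" _ "(y, zs)"] by simp
  then show ?case
    using Cons.IH[OF ys(2)] unfolding ys(1)
    by (simp add: pmf_pair prod.lessThan_Suc_shift del: mapM_pmf.simps prod.lessThan_Suc)
qed simp

lemma length_mapM_pmf: "ys \<in> set_pmf (mapM_pmf f xs) \<Longrightarrow> length ys = length xs"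
  by (induction xs arbitrary: ys) auto

text \<open>Turns a product over tries into one over all cells, with factor 1 at cells that no try
  visits, so that the factorization of the law of the cells applies.\<close>

lemma prod_reindex_extend:
  fixes g :: "nat \<Rightarrow> 'b \<Rightarrow> real" and h :: "'a \<Rightarrow> 'b"
  assumes "finite Z" "inj_on \<sigma> {..<n}" "\<sigma> ` {..<n} \<subseteq> Z"
  shows "(\<Prod>j<n. g j (h (\<sigma> j)))
    = (\<Prod>z\<in>Z. if z \<in> \<sigma> ` {..<n} then g (the_inv_into {..<n} \<sigma> z) (h z) else 1)"
proof -
  have "(\<Prod>z\<in>Z. if z \<in> \<sigma> ` {..<n} then g (the_inv_into {..<n} \<sigma> z) (h z) else 1)
      = (\<Prod>z\<in>\<sigma> ` {..<n}. g (the_inv_into {..<n} \<sigma> z) (h z))"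
    using assms by (intro prod.mono_neutral_cong_right) auto
  also have "\<dots> = (\<Prod>j<n. g j (h (\<sigma> j)))"
    using assms(2) by (simp add: prod.reindex the_inv_into_f_f)
  finally show ?thesis by simp
qed

lemma count_list_take_less:
  assumes "j < k" "k \<le> length ys" "ys ! j = x"
  shows "count_list (take j ys) x < count_list (take k ys) x"
proof -
  have "take k ys = take j ys @ [x] @ take (k - Suc j) (drop (Suc j) ys)"
    using assms by (metis Cons_nth_drop_Suc append_Cons append_Nil append_take_drop_id le_add_diff_inverse
        less_imp_le_nat less_le_trans nat_less_le take_Suc_Cons take_add Suc_diff_Suc)
  then show ?thesis by simp
qed

text \<open>
  Tries of the same value use different blocks, and Poissonization makes the counts of different
  values in a block independent. Hence the acceptance events are independent.
\<close>

lemma acceptance_independent: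
  fixes p :: "'a pmf"
  assumes fin: "finite (set_pmf p)" and \<mu>: "0 < \<mu>" and ys: "set ys \<subseteq> set_pmf p" and R: "max_count ys \<le> R"
  shows "bind_pmf (replicate_pmf R (poisson_list_pmf \<mu> p))
      (\<lambda>bs. mapM_pmf (\<lambda>n. bernoulli_pmf (accept_prob n)) (try_counts bs ys))
    = mapM_pmf (\<lambda>x. bernoulli_pmf (accept_rate (\<mu> * pmf p x))) ys" (is "?L = ?R")
proof (rule pmf_eqI)
  fix cs :: "bool list"
  let ?A = "set_pmf p" and ?P = "poisson_list_pmf \<mu> p"
  have len_tc: "length (try_counts bs ys) = length ys" for bs :: "'a list list"
    by (simp add: try_counts_def)
  show "pmf ?L cs = pmf ?R cs"
  proof (cases "length cs = length ys")
    case False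
    then have "cs \<notin> set_pmf ?L" "cs \<notin> set_pmf ?R"
      using length_mapM_pmf len_tc by fastforce+
    then have "pmf ?L cs = 0" "pmf ?R cs = 0"
      unfolding pmf_eq_0_set_pmf by blast+
    then show ?thesis by (simp only:)
  next
    case True
    define n where "n = length ys"
    \<comment> \<open>\<open>\<sigma> j\<close> is the cell, a block number and a value, that try
      \<open>j\<close> consults, and \<open>\<psi> j k\<close> is the probability of its prescribed
      outcome at count \<open>k\<close>. \<open>\<Psi>\<close> extends these factors by 1 to all
      cells.\<close>
    define \<sigma> where "\<sigma> = (\<lambda>j. (count_list (take j ys) (ys ! j), ys ! j))"
    define \<psi> where "\<psi> = (\<lambda>j k. pmf (bernoulli_pmf (accept_prob k)) (cs ! j))"
    define \<Psi> where "\<Psi> = (\<lambda>z k. if z \<in> \<sigma> ` {..<n} then \<psi> (the_inv_into {..<n} \<sigma> z) k else 1)"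
    let ?Z = "{..<R} \<times> ?A"
    have inj: "inj_on \<sigma> {..<n}"
    proof (rule linorder_inj_onI)
      fix j k assume "j < k" "j \<in> {..<n}" "k \<in> {..<n}"
      then show "\<sigma> j \<noteq> \<sigma> k"
        using count_list_take_less[of j k ys "ys ! j"] by (auto simp: \<sigma>_def n_def)
    qed auto
    have sub: "\<sigma> ` {..<n} \<subseteq> ?Z"
    proof (rule image_subsetI)
      fix j assume j: "j \<in> {..<n}"
      then have "count_list (take j ys) (ys ! j) < count_list (take n ys) (ys ! j)"
        unfolding n_def by (intro count_list_take_less) auto
      also have "\<dots> \<le> R" using count_list_le_max_count[of ys "ys ! j"] R by (simp add: n_def)
      finally show "\<sigma> j \<in> ?Z" using j ys by (auto simp: \<sigma>_def n_def)
    qed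
    have \<psi>: "0 \<le> \<psi> j k" "\<psi> j k \<le> 1" for j k by (auto simp: \<psi>_def pmf_le_1)
    then have \<Psi>: "0 \<le> \<Psi> z k" "\<Psi> z k \<le> 1" for z k by (auto simp: \<Psi>_def)
    have split: "(\<Prod>j<n. g j (h (\<sigma> j))) = (\<Prod>r<R. \<Prod>x\<in>?A. if (r, x) \<in> \<sigma> ` {..<n} then g (the_inv_into {..<n} \<sigma> (r, x)) (h (r, x)) else 1)"
      for g :: "nat \<Rightarrow> nat \<Rightarrow> real" and h
      unfolding prod.cartesian_product using fin inj sub
      by (subst prod_reindex_extend[of ?Z]) (auto simp: case_prod_unfold intro!: prod.cong)
    have split': "(\<Prod>j<n. g j (\<sigma> j)) = (\<Prod>r<R. \<Prod>x\<in>?A. if (r, x) \<in> \<sigma> ` {..<n} then g (the_inv_into {..<n} \<sigma> (r, x)) (r, x) else 1)"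
      for g :: "nat \<Rightarrow> nat \<times> 'a \<Rightarrow> real"
      unfolding prod.cartesian_product using fin inj sub
      by (subst prod_reindex_extend[of ?Z _ _ _ "\<lambda>z. z"]) (auto simp: case_prod_unfold intro!: prod.cong)
    have "pmf ?L cs = measure_pmf.expectation (replicate_pmf R ?P) (\<lambda>bs. \<Prod>j<n. \<psi> j (cell bs (fst (\<sigma> j)) (snd (\<sigma> j))))"
      unfolding pmf_bind
      by (intro Bochner_Integration.integral_cong refl, subst pmf_mapM_pmf)
         (auto simp: len_tc True n_def try_counts_def \<psi>_def \<sigma>_def intro!: prod.cong)
    also have "\<dots> = measure_pmf.expectation (replicate_pmf R ?P) (\<lambda>bs. \<Prod>r<R. \<Prod>x\<in>?A. \<Psi> (r, x) (count_list (bs ! r) x))"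
    proof (intro integral_cong_AE AE_pmfI)
      fix bs assume "bs \<in> set_pmf (replicate_pmf R ?P)"
      then have len: "length bs = R" by (simp add: set_replicate_pmf)
      show "(\<Prod>j<n. \<psi> j (cell bs (fst (\<sigma> j)) (snd (\<sigma> j)))) = (\<Prod>r<R. \<Prod>x\<in>?A. \<Psi> (r, x) (count_list (bs ! r) x))"
        unfolding split[of \<psi> "\<lambda>z. cell bs (fst z) (snd z)"] \<Psi>_def
        by (intro prod.cong refl) (auto simp: cell_def len)
    qed simp_all
    \<comment> \<open>First the blocks separate, as they are independent; then Poisson splitting
      separates the values within a block.\<close>
    also have "\<dots> = (\<Prod>r<R. measure_pmf.expectation ?P (\<lambda>b. \<Prod>x\<in>?A. \<Psi> (r, x) (count_list b x)))"
      using \<Psi> by (intro expectation_prod_replicate_pmf prod_nonneg prod_le_1) auto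
    also have "\<dots> = (\<Prod>r<R. \<Prod>x\<in>?A. measure_pmf.expectation (poisson_pmf (\<mu> * pmf p x)) (\<Psi> (r, x)))"
    proof (intro prod.cong refl)
      fix r
      have "measure_pmf.expectation ?P (\<lambda>b. \<Prod>x\<in>?A. \<Psi> (r, x) (count_list b x))
          = measure_pmf.expectation (map_pmf count_list ?P) (\<lambda>c. \<Prod>x\<in>?A. \<Psi> (r, x) (c x))"
        by simp
      also have "\<dots> = (\<Prod>x\<in>?A. measure_pmf.expectation (poisson_pmf (\<mu> * pmf p x)) (\<Psi> (r, x)))"
        unfolding map_count_poisson_list_pmf[OF fin \<mu>]
        using fin \<Psi> by (intro expectation_prod_Pi_pmf integrable_pmf_bounded[of _ 1]) auto
      finally show "measure_pmf.expectation ?P (\<lambda>b. \<Prod>x\<in>?A. \<Psi> (r, x) (count_list b x)) = \<dots>" .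
    qed
    also have "\<dots> = (\<Prod>j<n. measure_pmf.expectation (poisson_pmf (\<mu> * pmf p (snd (\<sigma> j)))) (\<psi> j))"
      unfolding split'[of "\<lambda>j z. measure_pmf.expectation (poisson_pmf (\<mu> * pmf p (snd z))) (\<psi> j)"] \<Psi>_def
      by (intro prod.cong refl) (auto simp: if_distrib)
    \<comment> \<open>Averaging a Bernoulli law over its random parameter leaves the Bernoulli law
      with the mean parameter, which is \<open>accept_rate\<close>.\<close>
    also have "\<dots> = (\<Prod>j<n. pmf (bernoulli_pmf (accept_rate (\<mu> * pmf p (ys ! j)))) (cs ! j))"
    proof (intro prod.cong refl)
      fix j
      let ?Q = "poisson_pmf (\<mu> * pmf p (snd (\<sigma> j)))"
      have int: "integrable (measure_pmf ?Q) accept_prob"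
        using accept_prob_bounds by (intro integrable_pmf_bounded[of _ 1]) (auto simp: less_imp_le)
      have bd: "0 \<le> accept_rate (\<mu> * pmf p (ys ! j))" "accept_rate (\<mu> * pmf p (ys ! j)) \<le> 1"
        unfolding accept_rate_def using accept_prob_bounds
        by (auto intro!: integral_nonneg_AE measure_pmf.integral_le_const integrable_pmf_bounded[of _ 1] simp: less_imp_le)
      show "measure_pmf.expectation ?Q (\<psi> j) = pmf (bernoulli_pmf (accept_rate (\<mu> * pmf p (ys ! j)))) (cs ! j)"
        using int bd accept_prob_bounds
        by (cases "cs ! j") (simp_all add: \<psi>_def \<sigma>_def accept_rate_def less_imp_le)
    qed
    also have "\<dots> = pmf ?R cs"
      using True by (subst pmf_mapM_pmf) (auto simp: n_def)
    finally show ?thesis .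
  qed
qed

lemma stat_dist_map_map_le:
  "stat_dist (map_pmf f p) (map_pmf g p) \<le> measure_pmf.prob p {x. f x \<noteq> g x}"
proof (rule stat_dist_le)
  fix A
  have "measure_pmf.prob p (f -` A) \<le> measure_pmf.prob p (g -` A \<union> {x. f x \<noteq> g x})"
    by (rule measure_pmf.finite_measure_mono) auto
  also have "\<dots> \<le> measure_pmf.prob p (g -` A) + measure_pmf.prob p {x. f x \<noteq> g x}"
    by (rule measure_Un_le) auto
  finally show "measure_pmf.prob (map_pmf f p) A \<le> measure_pmf.prob (map_pmf g p) A + measure_pmf.prob p {x. f x \<noteq> g x}"
    by simp
qed

section \<open>Rejection sampling\<close>

text \<open>Consecutive stretches of an independent sample are independent blocks as long as they
  fit into the pool. The prefix \<open>pre\<close> is general for the induction, which moves each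
  finished block into it.\<close>

lemma map_blocks_replicate_pmf:
  "sum_list ws \<le> L \<Longrightarrow> map_pmf (\<lambda>pool. blocks (nth0 (pre @ pool)) (length pre) ws) (replicate_pmf L p)
     = mapM_pmf (\<lambda>w. replicate_pmf w p) ws"
proof (induction ws arbitrary: pre L)
  case (Cons w ws)
  then obtain L' where L: "L = w + L'" "sum_list ws \<le> L'"
    by (metis add_le_imp_le_left le_add1 le_trans nat_le_iff_add sum_list.Cons)
  have "map_pmf (\<lambda>pool. blocks (nth0 (pre @ pool)) (length pre) (w # ws)) (replicate_pmf L p)
      = bind_pmf (replicate_pmf w p) (\<lambda>a. map_pmf (\<lambda>b. blocks (nth0 (pre @ a @ b)) (length pre) (w # ws)) (replicate_pmf L' p))"
    unfolding L(1) replicate_pmf_distrib by (simp add: map_pmf_def bind_assoc_pmf bind_return_pmf)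
  also have "\<dots> = bind_pmf (replicate_pmf w p) (\<lambda>a. map_pmf (Cons a)
      (map_pmf (\<lambda>b. blocks (nth0 ((pre @ a) @ b)) (length (pre @ a)) ws) (replicate_pmf L' p)))"
  proof (intro bind_pmf_cong refl)
    fix a assume "a \<in> set_pmf (replicate_pmf w p)"
    then have len: "length a = w" by (simp add: set_replicate_pmf)
    have "map (nth0 (pre @ a @ b)) [length pre..<length pre + w] = a" for b
      using len by (intro nth_equalityI) (auto simp: nth0_def nth_append)
    then show "map_pmf (\<lambda>b. blocks (nth0 (pre @ a @ b)) (length pre) (w # ws)) (replicate_pmf L' p)
        = map_pmf (Cons a) (map_pmf (\<lambda>b. blocks (nth0 ((pre @ a) @ b)) (length (pre @ a)) ws) (replicate_pmf L' p))"
      using len by (simp add: pmf.map_comp o_def)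
  qed
  also have "\<dots> = mapM_pmf (\<lambda>w. replicate_pmf w p) (w # ws)"
    by (simp only: Cons.IH[OF L(2)] mapM_pmf.simps)
  finally show ?case .
qed simp

lemma bind_replicate_mapM_pmf:
  "bind_pmf (replicate_pmf n q) (mapM_pmf g) = replicate_pmf n (bind_pmf q g)"
proof (induction n)
  case 0
  then show ?case by (simp add: bind_return_pmf)
next
  case (Suc n)
  have "bind_pmf (replicate_pmf (Suc n) q) (mapM_pmf g)
      = bind_pmf q (\<lambda>w. bind_pmf (replicate_pmf n q) (\<lambda>ws. bind_pmf (g w) (\<lambda>y. bind_pmf (mapM_pmf g ws) (\<lambda>ys. return_pmf (y # ys)))))"
    by (simp add: bind_assoc_pmf bind_return_pmf map_pmf_def)
  also have "\<dots> = bind_pmf q (\<lambda>w. bind_pmf (g w) (\<lambda>y. bind_pmf (bind_pmf (replicate_pmf n q) (mapM_pmf g)) (\<lambda>ys. return_pmf (y # ys))))"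
    by (subst bind_commute_pmf) (simp add: bind_assoc_pmf)
  also have "\<dots> = replicate_pmf (Suc n) (bind_pmf q g)"
    unfolding Suc.IH by (simp add: bind_assoc_pmf)
  finally show ?case .
qed

lemma bind_replicate_zip_mapM_pmf:
  "bind_pmf (replicate_pmf n p) (\<lambda>ys. map_pmf (zip ys) (mapM_pmf f ys))
    = replicate_pmf n (bind_pmf p (\<lambda>x. map_pmf (Pair x) (f x)))"
proof -
  have "map_pmf (zip ys) (mapM_pmf f ys) = mapM_pmf (\<lambda>x. map_pmf (Pair x) (f x)) ys" for ys
  proof (induction ys)
    case (Cons y ys)
    show ?case
      by (simp add: map_bind_pmf bind_map_pmf pmf.map_comp o_def flip: Cons.IH)
  qed simp
  then show ?thesis
    using bind_replicate_mapM_pmf[of n p "\<lambda>x. map_pmf (Pair x) (f x)"] by simp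
qed

definition try_pmf :: "('a \<Rightarrow> real) \<Rightarrow> 'a pmf \<Rightarrow> ('a \<times> bool) pmf" where
  "try_pmf q p = bind_pmf p (\<lambda>x. map_pmf (Pair x) (bernoulli_pmf (q x)))"

text \<open>One round of rejection sampling, with \<open>H x\<close> the continuation after
  accepting \<open>x\<close> and \<open>D\<close> the one after a rejection. An accepted value has
  law \<open>\<nu>\<close>, so acceptance with total weight \<open>a\<close> also leads to
  \<open>D\<close>.\<close>

lemma bind_try_pmf:
  assumes fin: "finite (set_pmf p)" and q: "\<And>x. 0 \<le> q x" "\<And>x. q x \<le> 1"
    and \<nu>: "\<And>x. pmf p x * q x = a * pmf \<nu> x"
    and H: "bind_pmf \<nu> H = D"
  shows "bind_pmf (try_pmf q p) (\<lambda>(x, c). if c then H x else D) = D"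
proof (rule pmf_eqI)
  fix y
  have E: "measure_pmf.expectation r f = (\<Sum>x\<in>set_pmf p. f x * pmf r x)"
    if "set_pmf r \<subseteq> set_pmf p" for r and f :: "'a \<Rightarrow> real"
    using that fin by (intro integral_measure_pmf_real) auto
  \<comment> \<open>If \<open>a = 0\<close>, then \<open>\<nu>\<close> is unconstrained and may
    leave the support of \<open>p\<close>, but it enters with weight 0.\<close>
  have "set_pmf \<nu> \<subseteq> set_pmf p" if "a \<noteq> 0"
  proof
    fix x assume "x \<in> set_pmf \<nu>"
    then have "a * pmf \<nu> x \<noteq> 0" using that by (simp add: set_pmf_iff)
    then show "x \<in> set_pmf p" using \<nu>[of x] by (auto simp: set_pmf_iff)
  qed
  then have \<nu>_sum: "(\<Sum>x\<in>set_pmf p. a * pmf \<nu> x * f x) = a * measure_pmf.expectation \<nu> f" for f :: "'a \<Rightarrow> real"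
    by (cases "a = 0") (simp_all add: E sum_distrib_left mult_ac)
  have "pmf (bind_pmf (try_pmf q p) (\<lambda>(x, c). if c then H x else D)) y
      = measure_pmf.expectation p (\<lambda>x. q x * pmf (H x) y + (1 - q x) * pmf D y)"
    using q by (simp add: try_pmf_def bind_assoc_pmf bind_map_pmf pmf_bind mult.commute)
  also have "\<dots> = (\<Sum>x\<in>set_pmf p. a * pmf \<nu> x * pmf (H x) y + (pmf p x - a * pmf \<nu> x * 1) * pmf D y)"
    unfolding \<nu>[symmetric] by (subst E) (simp_all add: algebra_simps)
  also have "\<dots> = (\<Sum>x\<in>set_pmf p. a * pmf \<nu> x * pmf (H x) y)
      + ((\<Sum>x\<in>set_pmf p. pmf p x) - (\<Sum>x\<in>set_pmf p. a * pmf \<nu> x * 1)) * pmf D y"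
    by (simp add: sum.distrib sum_subtractf flip: sum_distrib_right)
  also have "\<dots> = a * pmf D y + (1 - a) * pmf D y"
    unfolding \<nu>_sum using fin by (simp add: sum_pmf_eq_1 pmf_bind flip: H)
  finally show "pmf (bind_pmf (try_pmf q p) (\<lambda>(x, c). if c then H x else D)) y = pmf D y"
    by (simp add: algebra_simps)
qed

text \<open>If too few tries are accepted, the list is completed by fresh samples, so that its law is exact.\<close>

lemma rejection_sampling:
  assumes fin: "finite (set_pmf p)" and q: "\<And>x. 0 \<le> q x" "\<And>x. q x \<le> 1"
    and \<nu>: "\<And>x. pmf p x * q x = a * pmf \<nu> x"
  shows "bind_pmf (replicate_pmf n (try_pmf q p))
      (\<lambda>zs. map_pmf (\<lambda>rest. take m (map fst (filter snd zs) @ rest)) (replicate_pmf m \<nu>)) = replicate_pmf m \<nu>"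
proof (induction n arbitrary: m)
  case 0
  have "map_pmf (take m) (replicate_pmf m \<nu>) = map_pmf id (replicate_pmf m \<nu>)"
    by (intro map_pmf_cong) (auto simp: set_replicate_pmf)
  then show ?case by (simp add: bind_return_pmf)
next
  case (Suc n)
  let ?Q = "replicate_pmf n (try_pmf q p)"
  show ?case
  proof (cases m)
    case 0
    then show ?thesis by simp
  next
    case (Suc m')
    let ?D = "replicate_pmf m \<nu>"
    let ?F = "\<lambda>m zs. map_pmf (\<lambda>rest. take m (map fst (filter snd zs) @ rest)) (replicate_pmf m \<nu>)"
    have "bind_pmf ?Q (\<lambda>zs. map_pmf (\<lambda>rest. take m (x # map fst (filter snd zs) @ rest)) ?D)
        = map_pmf (Cons x) (bind_pmf ?Q (?F m'))" for x
    proof -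
      have "map_pmf (\<lambda>rest. take m (x # map fst (filter snd zs) @ rest)) ?D = map_pmf (Cons x) (?F m' zs)"
        for zs :: "('a \<times> bool) list"
      proof -
        \<comment> \<open>After an acceptance at most \<open>m'\<close> of the \<open>m\<close>
          fresh samples can be used, so the last one is split off and dropped.\<close>
        have "?D = map_pmf (\<lambda>(xs, y). xs @ [y]) (pair_pmf (replicate_pmf m' \<nu>) \<nu>)"
          using replicate_pmf_distrib[of m' 1 \<nu>] Suc
          by (simp add: pair_pmf_def map_bind_pmf replicate_pmf_1[unfolded One_nat_def] bind_map_pmf del: replicate_pmf.simps)
        then have "map_pmf (\<lambda>rest. take m (x # map fst (filter snd zs) @ rest)) ?D
            = map_pmf (\<lambda>z. x # take m' (map fst (filter snd zs) @ fst z)) (pair_pmf (replicate_pmf m' \<nu>) \<nu>)"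
          by (auto simp: pmf.map_comp set_replicate_pmf Suc intro!: map_pmf_cong)
        also have "\<dots> = map_pmf (\<lambda>rest. x # take m' (map fst (filter snd zs) @ rest)) (map_pmf fst (pair_pmf (replicate_pmf m' \<nu>) \<nu>))"
          by (simp add: pmf.map_comp o_def)
        finally show ?thesis by (simp add: map_fst_pair_pmf pmf.map_comp o_def)
      qed
      then show ?thesis by (simp add: map_bind_pmf)
    qed
    then have H: "bind_pmf ?Q (\<lambda>zs. map_pmf (\<lambda>rest. take m (x # map fst (filter snd zs) @ rest)) ?D)
        = map_pmf (Cons x) (replicate_pmf m' \<nu>)" for x
      using Suc.IH[of m'] by simp
    have "bind_pmf (replicate_pmf (Suc n) (try_pmf q p)) (?F m)
        = bind_pmf (try_pmf q p) (\<lambda>z. bind_pmf ?Q (\<lambda>zs. ?F m (z # zs)))"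
      by (simp add: bind_assoc_pmf bind_return_pmf)
    also have "\<dots> = bind_pmf (try_pmf q p) (\<lambda>(x, c). if c then map_pmf (Cons x) (replicate_pmf m' \<nu>) else ?D)"
    proof (intro bind_pmf_cong refl)
      fix z :: "'a \<times> bool"
      obtain x c where z: "z = (x, c)" by fastforce
      show "bind_pmf ?Q (\<lambda>zs. ?F m (z # zs)) = (case z of (x, c) \<Rightarrow> if c then map_pmf (Cons x) (replicate_pmf m' \<nu>) else ?D)"
        using H[of x] Suc.IH[of m] by (cases c) (simp_all only: z filter.simps list.map append_Cons if_True if_False fst_conv snd_conv prod.case)
    qed
    also have "\<dots> = ?D"
      using Suc by (intro bind_try_pmf[OF fin q \<nu>]) (simp add: map_pmf_def)
    finally show ?thesis .
  qed
qed

text \<open>Without the completion by fresh samples the result changes only when fewer than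
  \<open>m\<close> tries are accepted.\<close>

lemma stat_dist_rejection_sampling:
  assumes "finite (set_pmf p)" "\<And>x. 0 \<le> q x" "\<And>x. q x \<le> 1" "\<And>x. pmf p x * q x = a * pmf \<nu> x"
  shows "stat_dist (map_pmf (\<lambda>zs. take m (map fst (filter snd zs))) (replicate_pmf n (try_pmf q p))) (replicate_pmf m \<nu>)
    \<le> measure_pmf.prob (replicate_pmf n (try_pmf q p)) {zs. length (filter snd zs) < m}"
proof -
  let ?B = "{zs. length (filter snd zs) < m}"
  have "stat_dist (bind_pmf (replicate_pmf n (try_pmf q p)) (\<lambda>zs. return_pmf (take m (map fst (filter snd zs)))))
     (bind_pmf (replicate_pmf n (try_pmf q p))
      (\<lambda>zs. map_pmf (\<lambda>rest. take m (map fst (filter snd zs) @ rest)) (replicate_pmf m \<nu>)))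
     \<le> 0 + measure_pmf.prob (replicate_pmf n (try_pmf q p)) ?B"
    by (rule stat_dist_bind_right) (auto simp: not_less)
  then show ?thesis
    unfolding rejection_sampling[OF assms] by (simp add: map_pmf_def)
qed

lemma accept_rate_bounds: "0 \<le> accept_rate \<mu>" "accept_rate \<mu> \<le> 1"
  unfolding accept_rate_def using accept_prob_bounds
  by (auto intro!: integral_nonneg_AE measure_pmf.integral_le_const integrable_pmf_bounded[of _ 1] simp: less_imp_le)

text \<open>\<open>\<delta>\<close> is the cost of replacing variates, blocks and coins by ideal
  ones, \<open>\<beta>\<close> that of a shortage of acceptances. Each is paid twice: along the
  chain from the actual accepted list over the ideal one to \<open>\<nu>\<close>, and in bounding
  the probability, under the actual law, that the filler is used at all.\<close>

lemma stat_dist_sampler_pmf: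
  fixes p \<nu> :: "nat pmf"
  assumes fin: "finite (set_pmf p)"
    and M: "M = 2 * J + L" and J: "J = num_tries \<kappa> t M" and x1: "length x1 = J"
    and R: "R = num_blocks x1" and G: "G = M div (4 * R)" "0 < G" and K: "K = cutoff \<kappa> G" and S: "S = nat \<lceil>\<kappa>\<rceil>"
    and m: "m = num_out \<kappa> t M"
    and \<nu>: "\<And>x. pmf p x * accept_rate (real G * pmf p x) = a * pmf \<nu> x"
    and \<delta>: "real R * ((real K + 1) / 2 ^ S + exp (real G) / 2 ^ Suc K)
        + measure_pmf.prob (replicate_pmf R (poisson_pmf (real G))) {ws. L < sum_list ws}
        + real J * (1 / 2 ^ S) + measure_pmf.prob (replicate_pmf J p) {ys. R < max_count ys} \<le> \<delta>"
    and \<beta>: "measure_pmf.prob (replicate_pmf J (try_pmf (\<lambda>x. accept_rate (real G * pmf p x)) p))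
        {zs. length (filter snd zs) < m} \<le> \<beta>"
  shows "stat_dist (bind_pmf (replicate_pmf J p) (\<lambda>ys. bind_pmf (replicate_pmf L p)
      (\<lambda>pool. sampler_pmf \<kappa> t (x1 @ ys @ pool)))) (replicate_pmf m \<nu>) \<le> 2 * \<delta> + 2 * \<beta>"
proof -
  let ?W = "map_pmf (inverse_cdf G K) (draw_pmf S)"
  let ?b = "\<lambda>n. map_pmf (\<lambda>u. u < accept_prob n) (draw_pmf S)"
  let ?q = "\<lambda>x. accept_rate (real G * pmf p x)"
  let ?bl = "\<lambda>ys pool ws. blocks (nth0 ((x1 @ ys) @ pool)) (2 * J) ws"
  let ?F = "\<lambda>ys bs. map_pmf (accepted ys) (mapM_pmf ?b (try_counts bs ys))"
  \<comment> \<open>The pool is kept beside the accepted list, because the filler depends on the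
    samples that decided the acceptances.\<close>
  define \<Omega> where "\<Omega> = bind_pmf (replicate_pmf J p) (\<lambda>ys. bind_pmf (replicate_pmf L p) (\<lambda>pool.
      bind_pmf (replicate_pmf R ?W) (\<lambda>ws. map_pmf (\<lambda>z. (z, pool)) (?F ys (?bl ys pool ws)))))"
  define Z where "Z = map_pmf fst \<Omega>"
  define Z' where "Z' = map_pmf (\<lambda>zs. map fst (filter snd zs)) (replicate_pmf J (try_pmf ?q p))"
  have D: "bind_pmf (replicate_pmf J p) (\<lambda>ys. bind_pmf (replicate_pmf L p) (\<lambda>pool. sampler_pmf \<kappa> t (x1 @ ys @ pool)))
      = map_pmf (\<lambda>(z, pool). take m (z @ pool)) \<Omega>"
    unfolding \<Omega>_def map_bind_pmf
  proof (intro bind_pmf_cong refl)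
    fix ys pool
    assume "ys \<in> set_pmf (replicate_pmf J p)" "pool \<in> set_pmf (replicate_pmf L p)"
    then have len: "length ys = J" "length pool = L" by (simp_all add: set_replicate_pmf)
    then have lx: "length (x1 @ ys @ pool) = M" using x1 M by simp
    have eqs: "take J (x1 @ ys @ pool) = x1" "take J (drop J (x1 @ ys @ pool)) = ys" "drop (2 * J) (x1 @ ys @ pool) = pool"
      using x1 len by simp_all
    show "sampler_pmf \<kappa> t (x1 @ ys @ pool) = bind_pmf (replicate_pmf R ?W) (\<lambda>ws.
        map_pmf (\<lambda>(z, pool). take m (z @ pool)) (map_pmf (\<lambda>z. (z, pool)) (?F ys (?bl ys pool ws))))"
      unfolding sampler_pmf_def Let_def lx J[symmetric] eqs R[symmetric] G(1)[symmetric] K[symmetric] S[symmetric] m[symmetric]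
      by (simp add: map_pmf_def bind_assoc_pmf bind_return_pmf)
  qed
  have per_ys: "stat_dist (bind_pmf (replicate_pmf R ?W) (\<lambda>ws. bind_pmf (replicate_pmf L p) (\<lambda>pool. ?F ys (?bl ys pool ws))))
      (map_pmf (accepted ys) (mapM_pmf (\<lambda>x. bernoulli_pmf (?q x)) ys))
      \<le> real R * ((real K + 1) / 2 ^ S + exp (real G) / 2 ^ Suc K)
        + measure_pmf.prob (replicate_pmf R (poisson_pmf (real G))) {ws. L < sum_list ws} + real J * (1 / 2 ^ S)"
    if ys: "ys \<in> set_pmf (replicate_pmf J p)" and mc: "max_count ys \<le> R" for ys
  proof -
    have len: "length ys = J" and sub: "set ys \<subseteq> set_pmf p" using ys by (auto simp: set_replicate_pmf)
    let ?E = "\<lambda>ws. bind_pmf (replicate_pmf L p) (\<lambda>pool. ?F ys (?bl ys pool ws))"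
    let ?P = "replicate_pmf R (poisson_pmf (real G))"
    let ?E' = "\<lambda>ws. bind_pmf (mapM_pmf (\<lambda>w. replicate_pmf w p) ws) (?F ys)"
    let ?PL = "replicate_pmf R (poisson_list_pmf (real G) p)"
    \<comment> \<open>The replacements in order: Poisson variates for the sampled ones, fresh blocks
      for stretches of the pool unless these overflow, exact coins for dyadic ones, and finally
      independent coins with averaged bias.\<close>
    have 1: "stat_dist (bind_pmf (replicate_pmf R ?W) ?E) (bind_pmf ?P ?E)
        \<le> real R * ((real K + 1) / 2 ^ S + exp (real G) / 2 ^ Suc K)"
      using stat_dist_replicate[of R ?W "poisson_pmf (real G)"] stat_dist_inverse_cdf[OF G(2), of K S]
      by (intro order.trans[OF stat_dist_bind_left])
         (meson mult_left_mono of_nat_0_le_iff order.trans)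
    have 2: "stat_dist (bind_pmf ?P ?E) (bind_pmf ?P ?E') \<le> 0 + measure_pmf.prob ?P {ws. L < sum_list ws}"
    proof (rule stat_dist_bind_right)
      fix ws assume "ws \<notin> {ws. L < sum_list ws}"
      then have "sum_list ws \<le> L" by simp
      from map_blocks_replicate_pmf[OF this, of "x1 @ ys" p]
      have mb: "map_pmf (\<lambda>pool. ?bl ys pool ws) (replicate_pmf L p) = mapM_pmf (\<lambda>w. replicate_pmf w p) ws"
        using x1 len by (simp add: mult_2)
      have "?E ws = ?E' ws"
        unfolding mb[symmetric] bind_map_pmf ..
      then show "stat_dist (?E ws) (?E' ws) \<le> 0" by simp
    qed simp
    have 3: "bind_pmf ?P ?E' = bind_pmf ?PL (?F ys)"
      unfolding poisson_list_pmf_def bind_replicate_mapM_pmf[symmetric] by (simp add: bind_assoc_pmf)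
    have 4: "stat_dist (bind_pmf ?PL (?F ys))
        (bind_pmf ?PL (\<lambda>bs. map_pmf (accepted ys) (mapM_pmf (\<lambda>n. bernoulli_pmf (accept_prob n)) (try_counts bs ys))))
        \<le> real J * (1 / 2 ^ S)"
    proof (rule stat_dist_bind_right')
      fix bs
      have "stat_dist (mapM_pmf ?b (try_counts bs ys)) (mapM_pmf (\<lambda>n. bernoulli_pmf (accept_prob n)) (try_counts bs ys))
          \<le> real (length (try_counts bs ys)) * (1 / 2 ^ S)"
        using accept_prob_bounds by (intro stat_dist_mapM stat_dist_bernoulli_draw) (auto simp: less_imp_le)
      then show "stat_dist (?F ys bs) (map_pmf (accepted ys) (mapM_pmf (\<lambda>n. bernoulli_pmf (accept_prob n)) (try_counts bs ys)))
          \<le> real J * (1 / 2 ^ S)"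
        using len by (intro order.trans[OF stat_dist_map]) (simp add: try_counts_def)
    qed simp
    have 5: "bind_pmf ?PL (\<lambda>bs. map_pmf (accepted ys) (mapM_pmf (\<lambda>n. bernoulli_pmf (accept_prob n)) (try_counts bs ys)))
        = map_pmf (accepted ys) (mapM_pmf (\<lambda>x. bernoulli_pmf (?q x)) ys)"
      by (subst map_bind_pmf[symmetric], subst acceptance_independent[OF fin _ sub mc]) (use G(2) in simp_all)
    show ?thesis
      using 1 2 4 stat_dist_triangle[of "bind_pmf (replicate_pmf R ?W) ?E" "bind_pmf ?P ?E'" "bind_pmf ?P ?E"]
        stat_dist_triangle[of "bind_pmf (replicate_pmf R ?W) ?E"
          "map_pmf (accepted ys) (mapM_pmf (\<lambda>x. bernoulli_pmf (?q x)) ys)" "bind_pmf ?P ?E'"]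
      unfolding 3 5 by linarith
  qed
  have Z: "Z = bind_pmf (replicate_pmf J p) (\<lambda>ys. bind_pmf (replicate_pmf R ?W) (\<lambda>ws.
      bind_pmf (replicate_pmf L p) (\<lambda>pool. ?F ys (?bl ys pool ws))))"
    unfolding Z_def \<Omega>_def map_bind_pmf
    by (rule bind_pmf_cong[OF refl], rule trans[OF bind_commute_pmf]) (simp add: pmf.map_comp o_def)
  have Z': "Z' = bind_pmf (replicate_pmf J p) (\<lambda>ys. map_pmf (accepted ys) (mapM_pmf (\<lambda>x. bernoulli_pmf (?q x)) ys))"
    unfolding Z'_def try_pmf_def bind_replicate_zip_mapM_pmf[symmetric] map_bind_pmf accepted_def[abs_def]
    by (simp add: pmf.map_comp o_def)
  have ZZ': "stat_dist Z Z' \<le> \<delta>"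
    unfolding Z Z'
    by (rule order.trans[OF stat_dist_bind_right[of _ "{ys. R < max_count ys}" _ _
        "real R * ((real K + 1) / 2 ^ S + exp (real G) / 2 ^ Suc K)
        + measure_pmf.prob (replicate_pmf R (poisson_pmf (real G))) {ws. L < sum_list ws} + real J * (1 / 2 ^ S)"]])
       (use per_ys \<delta> in \<open>auto simp: not_less\<close>)
  have \<beta>': "measure_pmf.prob Z' {z. length z < m} \<le> \<beta>"
    using \<beta> by (simp add: Z'_def vimage_def)
  have "stat_dist (map_pmf (\<lambda>(z, pool). take m (z @ pool)) \<Omega>) (map_pmf (\<lambda>z. take m (fst z)) \<Omega>)
      \<le> measure_pmf.prob \<Omega> {\<omega>. (case \<omega> of (z, pool) \<Rightarrow> take m (z @ pool)) \<noteq> take m (fst \<omega>)}"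
    by (rule stat_dist_map_map_le)
  also have "\<dots> \<le> measure_pmf.prob \<Omega> (fst -` {z. length z < m})"
    by (rule measure_pmf.finite_measure_mono) auto
  also have "\<dots> = measure_pmf.prob Z {z. length z < m}"
    by (simp add: Z_def)
  also have "\<dots> \<le> \<delta> + \<beta>"
    using prob_le_stat_dist[of Z "{z. length z < m}" Z'] ZZ' \<beta>' by linarith
  finally have A: "stat_dist (map_pmf (\<lambda>(z, pool). take m (z @ pool)) \<Omega>) (map_pmf (take m) Z) \<le> \<delta> + \<beta>"
    by (simp add: Z_def pmf.map_comp o_def)
  have B: "stat_dist (map_pmf (take m) Z) (map_pmf (take m) Z') \<le> \<delta>"
    using stat_dist_map ZZ' by (rule order.trans)
  have C: "stat_dist (map_pmf (take m) Z') (replicate_pmf m \<nu>) \<le> \<beta>"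
    using order.trans[OF stat_dist_rejection_sampling[OF fin accept_rate_bounds \<nu>] \<beta>]
    by (simp add: Z'_def pmf.map_comp o_def)
  show ?thesis
    unfolding D
    using A B C stat_dist_triangle[of "map_pmf (\<lambda>(z, pool). take m (z @ pool)) \<Omega>" "replicate_pmf m \<nu>" "map_pmf (take m) Z"]
      stat_dist_triangle[of "map_pmf (take m) Z" "replicate_pmf m \<nu>" "map_pmf (take m) Z'"] by linarith
qed

text \<open>\<open>\<nu>\<close> is \<open>s\<close> reweighted by the nearly constant
  \<open>g\<close>. The normalizer \<open>b\<close> is the mean of \<open>g\<close> under
  \<open>s\<close>, hence at least \<open>\<gamma>\<close>, and no weight grows by more than the
  factor \<open>1 + e\<close>.\<close>

lemma stat_dist_reweighted:
  fixes p s \<nu> :: "'a pmf"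
  assumes fin: "finite A" and A: "set_pmf s \<subseteq> A" "set_pmf \<nu> \<subseteq> A"
    and \<nu>: "\<And>x. pmf \<nu> x * b = pmf s x * g x" and b: "0 < b"
    and g: "0 < \<gamma>" "\<And>x. x \<in> A \<Longrightarrow> \<gamma> \<le> g x" "\<And>x. x \<in> A \<Longrightarrow> g x \<le> \<gamma> * (1 + e)"
  shows "stat_dist \<nu> s \<le> e"
proof (rule stat_dist_le)
  have sum1: "(\<Sum>x\<in>A. pmf r x) = 1" if "set_pmf r \<subseteq> A" for r :: "'a pmf"
    using that fin by (rule sum_pmf_eq_1[rotated])
  have "\<gamma> = (\<Sum>x\<in>A. pmf s x * \<gamma>)"
    using sum1[OF A(1)] by (simp flip: sum_distrib_right)
  also have "\<dots> \<le> (\<Sum>x\<in>A. pmf s x * g x)"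
    using g by (intro sum_mono mult_left_mono) auto
  also have "\<dots> = b"
    using sum1[OF A(2)] by (simp flip: \<nu> sum_distrib_right)
  finally have "\<gamma> \<le> b" .
  obtain y where "y \<in> A" using A set_pmf_not_empty[of s] by blast
  then have "\<gamma> \<le> \<gamma> * (1 + e)" using g(2,3) by (meson order.trans)
  then have e: "0 \<le> e" using g(1) by (simp add: distrib_left zero_le_mult_iff)
  have le: "pmf \<nu> x \<le> pmf s x * (1 + e)" for x
  proof (cases "x \<in> A")
    case True
    have "pmf \<nu> x * b = pmf s x * g x" by (rule \<nu>)
    also have "\<dots> \<le> pmf s x * (\<gamma> * (1 + e))" using g True by (intro mult_left_mono) auto
    also have "\<dots> \<le> pmf s x * (b * (1 + e))" using \<open>\<gamma> \<le> b\<close> e by (intro mult_left_mono mult_right_mono) auto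
    finally have "pmf \<nu> x * b \<le> (pmf s x * (1 + e)) * b" by (simp add: mult_ac)
    then show ?thesis using b by (simp only: mult_le_cancel_right_pos)
  next
    case False
    then have "x \<notin> set_pmf \<nu>" using A by blast
    then have "pmf \<nu> x = 0" by (simp add: set_pmf_iff)
    then show ?thesis using e by simp
  qed
  fix B
  have pr: "measure_pmf.prob r B = (\<Sum>x\<in>A \<inter> B. pmf r x)" if "set_pmf r \<subseteq> A" for r :: "'a pmf"
  proof -
    have "measure_pmf.prob r B = measure_pmf.prob r (A \<inter> B)"
      using that by (intro measure_pmf.finite_measure_eq_AE) (auto intro!: AE_pmfI)
    then show ?thesis using fin by (simp add: measure_measure_pmf_finite)
  qed
  have "measure_pmf.prob \<nu> B \<le> (\<Sum>x\<in>A \<inter> B. pmf s x * (1 + e))"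
    unfolding pr[OF A(2)] by (intro sum_mono le)
  also have "\<dots> = measure_pmf.prob s B + measure_pmf.prob s B * e"
    by (simp add: pr[OF A(1)] distrib_left sum.distrib flip: sum_distrib_right)
  also have "measure_pmf.prob s B * e \<le> 1 * e"
    using e by (intro mult_right_mono) auto
  finally show "measure_pmf.prob \<nu> B \<le> measure_pmf.prob s B + e" by simp
qed

lemma ex_accepted_pmf:
  assumes fin: "finite (set_pmf p)" and q: "\<And>x. 0 \<le> q x" and a: "a = (\<Sum>x\<in>set_pmf p. pmf p x * q x)" "0 < a"
  shows "\<exists>\<nu>. \<forall>x. pmf p x * q x = a * pmf \<nu> x"
proof -
  let ?f = "\<lambda>x. pmf p x * q x / a"
  have nonneg: "0 \<le> ?f x" for x using q a by simp
  have "(\<integral>\<^sup>+x. ennreal (?f x) \<partial>count_space UNIV) = (\<integral>\<^sup>+x. ennreal (?f x) \<partial>count_space (set_pmf p))"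
    by (rule nn_integral_count_space_eq) (auto simp: set_pmf_iff)
  also have "\<dots> = ennreal (\<Sum>x\<in>set_pmf p. ?f x)"
    using fin nonneg by (simp add: nn_integral_count_space_finite sum_ennreal)
  also have "(\<Sum>x\<in>set_pmf p. ?f x) = 1"
    using a by (simp flip: sum_divide_distrib)
  finally have "pmf (embed_pmf ?f) x = ?f x" for x
    using nonneg by (intro pmf_embed_pmf) auto
  then have "\<forall>x. pmf p x * q x = a * pmf (embed_pmf ?f) x"
    using a by simp
  then show ?thesis by blast
qed

section \<open>Concentration of multiplicities\<close>

lemma count_list_eq_filter: "count_list xs x = length (filter (\<lambda>y. y = x) xs)"
  by (induction xs) auto

lemma ln2_bounds: "2 / 3 \<le> ln (2 :: real)" "ln (2 :: real) \<le> 25 / 36"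
  by (rule ln2_ge_two_thirds, rule ln2_le_25_over_36)

lemma two_power_eq_exp: "(2::real) ^ n = exp (real n * ln 2)"
  by (simp add: exp_of_nat_mult)

text \<open>Twice the mean is far enough for base 2: the exponent is at most
  \<open>J * P - 2 * J * P * (2 / 3)\<close>.\<close>

lemma prob_count_list_gt:
  fixes p :: "'a pmf"
  assumes "pmf p x \<le> P" "2 * real J * P \<le> B"
  shows "measure_pmf.prob (replicate_pmf J p) {xs. B < real (count_list xs x)} \<le> exp (- (real J * P) / 3)"
proof -
  let ?k = "nat \<lceil>B\<rceil>"
  have "{x'. x' = x} = {x}" by auto
  then have q: "measure_pmf.prob p {x'. x' = x} = pmf p x" by (simp add: measure_pmf_single)
  have "measure_pmf.prob (replicate_pmf J p) {xs. B < real (count_list xs x)}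
      \<le> measure_pmf.prob (replicate_pmf J p) {xs. ?k \<le> length (filter (\<lambda>y. y = x) xs)}"
    by (rule measure_pmf.finite_measure_mono) (auto simp: count_list_eq_filter nat_le_iff ceiling_le_iff)
  also have "\<dots> \<le> exp (real J * pmf p x) / 2 ^ ?k"
    using prob_filter_ge[of J p ?k "\<lambda>y. y = x"] by (simp only: q)
  also have "\<dots> = exp (real J * pmf p x - real ?k * ln 2)"
    by (simp add: two_power_eq_exp exp_diff)
  also have "\<dots> \<le> exp (- (real J * P) / 3)"
  proof -
    have "real J * pmf p x \<le> real J * P" using assms(1) by (intro mult_left_mono) auto
    moreover have "2 * real J * P * (2 / 3) \<le> real ?k * ln 2"
    proof (rule mult_mono)
      show "2 * real J * P \<le> real ?k" using assms(2) by linarith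
    qed (use ln2_bounds in auto)
    ultimately show ?thesis by simp
  qed
  finally show ?thesis .
qed

text \<open>A union bound over the support suffices: as \<open>B \<ge> 0\<close>, a value whose
  count exceeds \<open>B\<close> does occur and thus lies in the support.\<close>

lemma prob_max_count_gt:
  fixes p :: "'a pmf"
  assumes fin: "finite (set_pmf p)" and P: "\<And>x. pmf p x \<le> P" and B: "2 * real J * P \<le> B" "0 \<le> B"
  shows "measure_pmf.prob (replicate_pmf J p) {xs. B < real (max_count xs)} \<le> real (card (set_pmf p)) * exp (- (real J * P) / 3)"
proof -
  let ?Q = "replicate_pmf J p"
  have "measure_pmf.prob ?Q {xs. B < real (max_count xs)} \<le> measure_pmf.prob ?Q (\<Union>x\<in>set_pmf p. {xs. B < real (count_list xs x)})"
  proof (rule measure_pmf.finite_measure_mono_AE)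
    show "AE xs in measure_pmf ?Q. xs \<in> {xs. B < real (max_count xs)} \<longrightarrow> xs \<in> (\<Union>x\<in>set_pmf p. {xs. B < real (count_list xs x)})"
    proof (rule AE_pmfI, rule impI)
      fix xs assume xs: "xs \<in> set_pmf ?Q" "xs \<in> {xs. B < real (max_count xs)}"
      obtain x where x: "max_count xs = count_list xs x" by (rule max_count_obtains)
      have "count_list xs x \<noteq> 0" using xs(2) x B(2) by auto
      then have "x \<in> set xs" by (auto simp: count_list_0_iff)
      then have "x \<in> set_pmf p" using xs(1) by (auto simp: set_replicate_pmf)
      then show "xs \<in> (\<Union>x\<in>set_pmf p. {xs. B < real (count_list xs x)})" using xs(2) x by auto
    qed
  qed simp
  also have "\<dots> \<le> (\<Sum>x\<in>set_pmf p. measure_pmf.prob ?Q {xs. B < real (count_list xs x)})"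
    using fin by (intro measure_pmf.finite_measure_subadditive_finite) auto
  also have "\<dots> \<le> (\<Sum>x\<in>set_pmf p. exp (- (real J * P) / 3))"
    using P B(1) by (intro sum_mono prob_count_list_gt)
  finally show ?thesis by simp
qed

text \<open>A single value \<open>x\<close> already bounds the maximum from below. The exponent is
  at most \<open>- (1 / 2) * (1 - 25 / 36) * J * P\<close>, and
  \<open>11 / 72 \<ge> 1 / 8\<close>.\<close>

lemma prob_max_count_lt:
  fixes p :: "'a pmf"
  assumes "pmf p x = P"
  shows "measure_pmf.prob (replicate_pmf J p) {xs. real (max_count xs) < real J * P / 2} \<le> exp (- (real J * P) / 8)"
proof -
  let ?k = "nat \<lfloor>real J * P / 2\<rfloor>"
  have P: "0 \<le> P" using assms by auto
  have "{x'. x' = x} = {x}" by auto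
  then have q: "measure_pmf.prob p {x'. x' = x} = P" using assms by (simp add: measure_pmf_single)
  have "measure_pmf.prob (replicate_pmf J p) {xs. real (max_count xs) < real J * P / 2}
      \<le> measure_pmf.prob (replicate_pmf J p) {xs. length (filter (\<lambda>y. y = x) xs) \<le> ?k}"
  proof (rule measure_pmf.finite_measure_mono)
    show "{xs. real (max_count xs) < real J * P / 2} \<subseteq> {xs. length (filter (\<lambda>y. y = x) xs) \<le> ?k}"
    proof safe
      fix xs :: "'a list" assume "real (max_count xs) < real J * P / 2"
      then have "real (count_list xs x) < real J * P / 2"
        using count_list_le_max_count[of xs x] by linarith
      then show "length (filter (\<lambda>y. y = x) xs) \<le> ?k"
        unfolding count_list_eq_filter by linarith
    qed
  qed simp
  also have "\<dots> \<le> exp (- (real J * P) / 2) * 2 ^ ?k"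
    using prob_filter_le[of J p "\<lambda>y. y = x" ?k] by (simp only: q)
  also have "\<dots> = exp (- (real J * P) / 2 + real ?k * ln 2)"
    by (simp only: two_power_eq_exp exp_add)
  also have "\<dots> \<le> exp (- (real J * P) / 8)"
  proof -
    have "real ?k * ln 2 \<le> (real J * P / 2) * (25 / 36)"
    proof (rule mult_mono)
      have "0 \<le> real J * P" using P by simp
      then show "real ?k \<le> real J * P / 2" "0 \<le> real J * P / 2" by linarith+
    qed (use ln2_bounds in auto)
    moreover have "0 \<le> real J * P" using P by simp
    ultimately show ?thesis by simp
  qed
  finally show ?thesis .
qed

section \<open>The choice of the parameters\<close>

text \<open>\<open>P\<close> is the largest probability, attained at \<open>i\<close>. The threshold
  121 is the square of 11: with \<open>sqrt \<kappa> \<ge> 11\<close> the powers of \<kappa> beat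
  the constants 1080 and 540 that arise in counting acceptances.\<close>

locale large_input =
  fixes \<kappa> t P :: real and p :: "nat pmf" and M J L S m i :: nat
  assumes \<kappa>: "121 \<le> \<kappa>" and t: "1 \<le> t"
    and fin: "finite (set_pmf p)" and P: "\<And>x. pmf p x \<le> P" and i: "pmf p i = P"
    and ratio: "\<And>x. x \<in> set_pmf p \<Longrightarrow> P \<le> t * pmf p x"
    and M: "4 * \<kappa> ^ 4 * t ^ 2 \<le> real M * P"
    and J_eq: "J = num_tries \<kappa> t M" and L_eq: "L = M - 2 * J"
    and S_eq: "S = nat \<lceil>\<kappa>\<rceil>" and m_eq: "m = num_out \<kappa> t M"
begin

lemma P_pos: "0 < P" and P_le_1: "P \<le> 1"
proof -
  obtain x where "x \<in> set_pmf p" using set_pmf_not_empty[of p] by blast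
  then have "0 < pmf p x" by (rule pmf_positive)
  then show "0 < P" using P[of x] by linarith
  show "P \<le> 1" using i pmf_le_1[of p i] by simp
qed

lemma kt: "\<kappa> \<le> \<kappa> * t" "100 \<le> \<kappa> * t" "0 < \<kappa> * t"
proof -
  show *: "\<kappa> \<le> \<kappa> * t" using \<kappa> t mult_left_mono[of 1 t \<kappa>] by simp
  then show "100 \<le> \<kappa> * t" "0 < \<kappa> * t" using \<kappa> by linarith+
qed

lemma MP_le: "real M * P \<le> real M"
  using P_pos P_le_1 by (simp add: mult_left_le)

lemma MP_ge: "40000 * (\<kappa> * t) * (\<kappa> * t) \<le> real M * P"
proof -
  have "100 * 100 * ((\<kappa> * t) * (\<kappa> * t)) \<le> \<kappa> * \<kappa> * ((\<kappa> * t) * (\<kappa> * t))"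
    using \<kappa> t by (intro mult_mono) auto
  then show ?thesis using M by (simp add: power2_eq_square power4_eq_xxxx mult_ac)
qed

lemma J_bounds: "72 * (\<kappa> * t) * real J \<le> real M" "real M \<le> 144 * (\<kappa> * t) * real J"
proof -
  let ?X = "real M / (72 * \<kappa> * t)"
  have X: "0 \<le> ?X" using kt by simp
  then have "real J \<le> ?X"
    unfolding J_eq num_tries_def by linarith
  then show "72 * (\<kappa> * t) * real J \<le> real M"
    using kt by (simp add: field_simps)
  have "40000 * (\<kappa> * t) * 100 \<le> 40000 * (\<kappa> * t) * (\<kappa> * t)"
    using kt(2,3) by (intro mult_left_mono) auto
  then have "144 * (\<kappa> * t) \<le> real M"
    using MP_ge MP_le kt(3) by linarith
  then have "2 \<le> ?X"
    using kt by (simp add: field_simps)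
  \<comment> \<open>The floor loses at most a factor 2, hence 144 next to 72.\<close>
  moreover have "x / 2 \<le> real (nat \<lfloor>x\<rfloor>)" if "2 \<le> x" for x :: real
    using that by linarith
  ultimately have "?X / 2 \<le> real J"
    unfolding J_eq num_tries_def by blast
  then show "real M \<le> 144 * (\<kappa> * t) * real J"
    using kt by (simp add: field_simps)
qed

text \<open>The mean multiplicity of the most likely value dominates \<kappa>, which makes all
  deviations of counts exponentially unlikely. The constant uses
  \<open>40000 / 144 \<ge> 200\<close>.\<close>

lemma JP_ge: "200 * (\<kappa> * t) \<le> real J * P"
proof -
  have "40000 * (\<kappa> * t) * (\<kappa> * t) \<le> 144 * (\<kappa> * t) * real J * P"
    using MP_ge J_bounds(2) P_pos by (meson less_imp_le mult_right_mono order.trans)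
  then have "(\<kappa> * t) * (40000 * (\<kappa> * t)) \<le> (\<kappa> * t) * (144 * (real J * P))"
    by (simp add: mult_ac)
  then have "40000 * (\<kappa> * t) \<le> 144 * (real J * P)"
    using kt(3) by (simp only: mult_le_cancel_left_pos)
  then show ?thesis using kt(3) by linarith
qed

lemma J_le_M: "7200 * real J \<le> real M"
proof -
  have "72 * 100 * real J \<le> 72 * (\<kappa> * t) * real J"
    using kt by (intro mult_right_mono) auto
  then show ?thesis using J_bounds(1) by linarith
qed

lemma M_split: "M = 2 * J + L"
proof -
  have "2 * J \<le> M" using J_le_M by linarith
  then show ?thesis by (simp add: L_eq)
qed

lemma M_ge: "1000 * \<kappa> \<le> real M"
proof -
  have "real J * P \<le> real J" using P_le_1 by (simp add: mult_left_le)
  then show ?thesis using J_le_M JP_ge kt \<kappa> by linarith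
qed

lemma S_bound: "1 / 2 ^ S \<le> exp (- \<kappa> / 2)"
proof -
  have "\<kappa> \<le> real S" unfolding S_eq by linarith
  then have "\<kappa> * (2 / 3) \<le> real S * ln 2"
    using \<kappa> ln2_bounds by (intro mult_mono) auto
  then have "\<kappa> / 2 \<le> real S * ln 2" using \<kappa> by linarith
  then have "exp (\<kappa> / 2) \<le> 2 ^ S" by (simp add: two_power_eq_exp)
  then have "1 / 2 ^ S \<le> 1 / exp (\<kappa> / 2)" by (intro divide_left_mono) auto
  then show ?thesis by (simp add: exp_minus field_simps)
qed

lemma tail_JP: "exp (- (real J * P) / 3) \<le> exp (- \<kappa> / 2)" "exp (- (real J * P) / 8) \<le> exp (- \<kappa> / 2)"
  unfolding exp_le_cancel_iff using JP_ge kt \<kappa> by linarith+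

lemma good_first_part:
  "measure_pmf.prob (replicate_pmf J p)
     {xs. \<not> (real J * P / 2 \<le> real (max_count xs) \<and> real (max_count xs) \<le> 2 * real J * P)}
   \<le> (real (card (set_pmf p)) + 1) * exp (- \<kappa> / 2)"
proof -
  let ?Q = "measure_pmf.prob (replicate_pmf J p)"
  have "?Q {xs. \<not> (real J * P / 2 \<le> real (max_count xs) \<and> real (max_count xs) \<le> 2 * real J * P)}
      \<le> ?Q ({xs. real (max_count xs) < real J * P / 2} \<union> {xs. 2 * real J * P < real (max_count xs)})"
    by (rule measure_pmf.finite_measure_mono) auto
  also have "\<dots> \<le> ?Q {xs. real (max_count xs) < real J * P / 2} + ?Q {xs. 2 * real J * P < real (max_count xs)}"
    by (rule measure_Un_le) auto
  also have "?Q {xs. real (max_count xs) < real J * P / 2} \<le> exp (- (real J * P) / 8)"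
    using i by (rule prob_max_count_lt)
  also have "?Q {xs. 2 * real J * P < real (max_count xs)} \<le> real (card (set_pmf p)) * exp (- (real J * P) / 3)"
    using fin P P_pos by (intro prob_max_count_gt) auto
  also have "exp (- (real J * P) / 8) + real (card (set_pmf p)) * exp (- (real J * P) / 3)
      \<le> exp (- \<kappa> / 2) + real (card (set_pmf p)) * exp (- \<kappa> / 2)"
    using tail_JP by (intro add_mono mult_left_mono) auto
  finally show ?thesis by (simp add: algebra_simps)
qed

section \<open>Error bounds for a fixed, typical first part of the input\<close>

context
  fixes x1 :: "nat list" and R G K :: nat
  assumes x1: "length x1 = J" "real J * P / 2 \<le> real (max_count x1)" "real (max_count x1) \<le> 2 * real J * P"
    and R_eq: "R = num_blocks x1" and G_eq: "G = M div (4 * R)" and K_eq: "K = cutoff \<kappa> G"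
begin

lemma R_bounds: "2 * real J * P \<le> real R" "real R \<le> 9 * (real J * P)" "0 < R"
  using x1 JP_ge kt by (simp_all add: R_eq num_blocks_def)

lemma RG_le: "4 * (real R * real G) \<le> real M"
proof -
  have "4 * R * G \<le> M" unfolding G_eq by (rule times_div_less_eq_dividend)
  then have "real (4 * R * G) \<le> real M" by (simp only: of_nat_le_iff)
  then show ?thesis by simp
qed

text \<open>From \<open>M < 4 * R * (G + 1)\<close> and \<open>R \<le> 9 * J * P\<close> follows
  \<open>M < 36 * (G + 1) * P * J\<close>, while \<open>M \<ge> 72 * \<kappa> * t * J\<close>. This
  gives twice the required mean, and the spare half absorbs the rounding of
  \<open>G\<close>.\<close>

lemma GP_ge: "\<kappa> * t \<le> real G * P"
proof -
  have "M < 4 * R * Suc G"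
    unfolding G_eq using R_bounds(3) dividend_less_times_div[of "4 * R" M] by simp
  then have "real M < real (4 * R * Suc G)" by (simp only: of_nat_less_iff)
  also have "\<dots> = 4 * (real G + 1) * real R" by (simp add: algebra_simps)
  also have "\<dots> \<le> 4 * (real G + 1) * (9 * (real J * P))"
    using R_bounds(2) by (intro mult_left_mono) auto
  finally have "72 * (\<kappa> * t) * real J < 36 * (real G + 1) * P * real J"
    using J_bounds(1) by (simp add: algebra_simps)
  then have "72 * (\<kappa> * t) < 36 * (real G + 1) * P"
    by (rule mult_right_less_imp_less) simp
  then have "2 * (\<kappa> * t) < real G * P + P" by (simp add: algebra_simps)
  then show ?thesis using P_le_1 kt by linarith
qed

lemma G_pos: "0 < G"
  using GP_ge kt P_pos by (cases "G = 0") auto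

lemma GP_le: "real G * P \<le> 18 * (\<kappa> * t)"
proof -
  have J: "0 < real J" using JP_ge kt P_pos by (cases "J = 0") auto
  have "4 * (2 * real J * P * real G) \<le> 4 * (real R * real G)"
    using R_bounds(1) by (intro mult_left_mono mult_right_mono) auto
  also have "\<dots> \<le> 144 * (\<kappa> * t) * real J" using RG_le J_bounds(2) by linarith
  finally have "(8 * (real G * P)) * real J \<le> (144 * (\<kappa> * t)) * real J" by (simp add: mult_ac)
  then have "8 * (real G * P) \<le> 144 * (\<kappa> * t)"
    using J by (simp only: mult_le_cancel_right_pos)
  then show ?thesis by linarith
qed

text \<open>The smallest probability is at least \<open>P / t\<close>, so a mean of
  \<open>\<kappa> * t\<close> for the most likely value leaves at least \<kappa> for every other
  one.\<close>

lemma rate_bounds: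
  assumes "x \<in> set_pmf p"
  shows "\<kappa> \<le> real G * pmf p x" "real G * pmf p x \<le> 18 * (\<kappa> * t)"
proof -
  have "\<kappa> * t \<le> real G * (t * pmf p x)"
    using GP_ge ratio[OF assms] by (meson mult_left_mono of_nat_0_le_iff order.trans)
  then have "\<kappa> * t \<le> (real G * pmf p x) * t" by (simp add: mult_ac)
  then show "\<kappa> \<le> real G * pmf p x" using t by simp
  show "real G * pmf p x \<le> 18 * (\<kappa> * t)"
    using GP_le P[of x] by (meson mult_left_mono of_nat_0_le_iff order.trans)
qed

lemma K_bounds: "2 * real G + 2 * \<kappa> \<le> real K" "real K \<le> 2 * real G + 2 * \<kappa> + 1"
  using \<kappa> unfolding K_eq cutoff_def by linarith+

lemma R_le_M: "8 * \<kappa> * real R \<le> real M"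
proof -
  have "real J * P \<le> real J" using P_le_1 by (simp add: mult_left_le)
  then have "8 * \<kappa> * real R \<le> 8 * \<kappa> * (9 * real J)"
    using R_bounds(2) \<kappa> by (intro mult_left_mono) auto
  also have "\<dots> = 72 * (\<kappa> * real J)" by simp
  also have "\<dots> \<le> 72 * ((\<kappa> * t) * real J)"
    using kt(1) by (intro mult_left_mono mult_right_mono) auto
  also have "\<dots> = 72 * (\<kappa> * t) * real J" by simp
  also have "\<dots> \<le> real M" by (rule J_bounds)
  finally show ?thesis .
qed

text \<open>Each of the \<open>R\<close> variates costs about \<open>K\<close> grid errors. The sum
  is at most \<open>M\<close> of them because \<open>4 * R * G \<le> M\<close> and
  \<open>8 * \<kappa> * R \<le> M\<close>.\<close>

lemma poisson_error:
  "real R * ((real K + 1) / 2 ^ S + exp (real G) / 2 ^ Suc K) \<le> real M * exp (- \<kappa> / 2)"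
proof -
  let ?E = "exp (- \<kappa> / 2)"
  have "(real K + 1) * (1 / 2 ^ S) \<le> (real K + 1) * ?E"
    using S_bound by (intro mult_left_mono) auto
  moreover have "exp (real G) / 2 ^ Suc K \<le> ?E"
  proof -
    have "(2 * real G + 2 * \<kappa>) * (2 / 3) \<le> real (Suc K) * ln 2"
      using K_bounds(1) \<kappa> ln2_bounds by (intro mult_mono) auto
    then have "real G + \<kappa> / 2 \<le> real (Suc K) * ln 2" using \<kappa> by simp
    then have "real G - real (Suc K) * ln 2 \<le> - \<kappa> / 2" by linarith
    then show ?thesis by (simp add: two_power_eq_exp flip: exp_diff del: power_Suc of_nat_Suc)
  qed
  ultimately have "real R * ((real K + 1) / 2 ^ S + exp (real G) / 2 ^ Suc K) \<le> real R * ((real K + 2) * ?E)"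
    by (intro mult_left_mono) (simp_all add: algebra_simps)
  also have "\<dots> \<le> real M * ?E"
  proof -
    have "real R * (real K + 2) \<le> real R * (2 * real G + 3 * \<kappa>)"
      using K_bounds(2) \<kappa> by (intro mult_left_mono) auto
    also have "\<dots> = 2 * (real R * real G) + 3 * (\<kappa> * real R)" by (simp add: algebra_simps)
    also have "\<dots> \<le> real M" using RG_le R_le_M by simp
    finally show ?thesis by (simp add: mult_right_mono flip: mult.assoc)
  qed
  finally show ?thesis .
qed

text \<open>The blocks have mean total length \<open>R * G \<le> M / 4\<close>, while the pool has
  at least \<open>3 / 4 * M\<close> samples; base 2 leaves the exponent
  \<open>M / 4 - M / 2\<close>.\<close>

lemma overflow_error:
  "measure_pmf.prob (replicate_pmf R (poisson_pmf (real G))) {ws. L < sum_list ws} \<le> exp (- \<kappa> / 2)"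
proof -
  have "measure_pmf.prob (replicate_pmf R (poisson_pmf (real G))) {ws. L < sum_list ws}
      \<le> measure_pmf.prob (replicate_pmf R (poisson_pmf (real G))) {ws. L \<le> sum_list ws}"
    by (rule measure_pmf.finite_measure_mono) auto
  also have "\<dots> \<le> exp (real R * real G) / 2 ^ L"
    using G_pos by (intro prob_sum_poisson_ge) simp
  also have "\<dots> = exp (real R * real G - real L * ln 2)"
    by (simp add: two_power_eq_exp exp_diff)
  also have "\<dots> \<le> exp (- \<kappa> / 2)"
  proof -
    have "3 / 4 * real M \<le> real L" using J_le_M M_split by simp
    then have "(3 / 4 * real M) * (2 / 3) \<le> real L * ln 2"
      using ln2_bounds by (intro mult_mono) auto
    then show ?thesis using RG_le M_ge \<kappa> by simp
  qed
  finally show ?thesis .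
qed

lemma multiplicity_error:
  "measure_pmf.prob (replicate_pmf J p) {ys. R < max_count ys} \<le> real (card (set_pmf p)) * exp (- \<kappa> / 2)"
proof -
  have "measure_pmf.prob (replicate_pmf J p) {ys. real R < real (max_count ys)}
      \<le> real (card (set_pmf p)) * exp (- (real J * P) / 3)"
    using R_bounds by (intro prob_max_count_gt fin P) auto
  also have "\<dots> \<le> real (card (set_pmf p)) * exp (- \<kappa> / 2)"
    using tail_JP by (intro mult_left_mono) auto
  finally show ?thesis by simp
qed

abbreviation "rate x \<equiv> accept_rate (real G * pmf p x)"
abbreviation "acc \<equiv> (\<Sum>x\<in>set_pmf p. pmf p x * rate x)"

lemma sum_pmf: "(\<Sum>x\<in>set_pmf p. pmf p x) = 1"
  using fin by (rule sum_pmf_eq_1) simp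

lemma rate_eq: "rate x = gauss_integral (real G * pmf p x) / sqrt (real G * pmf p x)" if "x \<in> set_pmf p"
proof -
  have "sqrt (real G * pmf p x) \<noteq> 0" using rate_bounds(1)[OF that] \<kappa> by (simp only: real_sqrt_eq_0_iff)
  then show ?thesis
    unfolding gauss_integral_def by (rule nonzero_mult_div_cancel_left[symmetric])
qed

text \<open>The constant is \<open>15 = 3 * 5\<close>: the numerator of each rate is at least
  \<open>exp (- 1) \<ge> 1 / 3\<close>, and the root of a mean at most
  \<open>18 * \<kappa> * t \<le> 25 * \<kappa> * t\<close> is at most
  \<open>5 * sqrt (\<kappa> * t)\<close>.\<close>

lemma acc_ge: "1 / (15 * sqrt (\<kappa> * t)) \<le> acc"
proof -
  have "1 / (15 * sqrt (\<kappa> * t)) \<le> rate x" if x: "x \<in> set_pmf p" for x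
  proof -
    let ?y = "real G * pmf p x"
    have y: "1 \<le> ?y" "?y \<le> 25 * (\<kappa> * t)" using rate_bounds[OF x] \<kappa> kt by linarith+
    have "sqrt ?y \<le> sqrt (25 * (\<kappa> * t))" using y by (intro real_sqrt_le_mono)
    also have "\<dots> = 5 * sqrt (\<kappa> * t)" using real_sqrt_unique[of 5 25] by (simp add: real_sqrt_mult)
    finally have s: "sqrt ?y \<le> 5 * sqrt (\<kappa> * t)" .
    have "1 / 3 \<le> exp (- 1 :: real)"
      using exp_le by (simp add: exp_minus field_simps)
    also have "\<dots> \<le> gauss_integral ?y" using y(1) by (rule gauss_integral_ge)
    finally have g: "1 / 3 \<le> gauss_integral ?y" .
    have "1 / (15 * sqrt (\<kappa> * t)) = (1 / 3) / (5 * sqrt (\<kappa> * t))" by simp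
    also have "\<dots> \<le> gauss_integral ?y / sqrt ?y"
      using g s y by (intro frac_le) auto
    finally show ?thesis using rate_eq[OF x] by simp
  qed
  then have "(\<Sum>x\<in>set_pmf p. pmf p x * (1 / (15 * sqrt (\<kappa> * t)))) \<le> acc"
    by (intro sum_mono mult_left_mono) auto
  then show ?thesis
    unfolding sum_distrib_right[symmetric] sum_pmf by simp
qed

lemma acc_pos: "0 < acc"
  using acc_ge kt by (intro less_le_trans[OF _ acc_ge]) simp

lemma prob_try: "measure_pmf.prob (try_pmf rate p) {z. snd z} = acc"
proof -
  have "measure_pmf.prob (try_pmf rate p) {z. snd z} = measure_pmf.expectation p rate"
  proof -
    have "{b. b} = {True}" by auto
    then show ?thesis
      unfolding try_pmf_def prob_bind_pmf
      using accept_rate_bounds by (simp add: vimage_def measure_pmf_single)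
  qed
  also have "\<dots> = (\<Sum>x\<in>set_pmf p. rate x * pmf p x)"
    using fin by (intro integral_measure_pmf_real) auto
  finally show ?thesis by (simp add: mult.commute)
qed

lemma m_bound: "16 * \<kappa> ^ 3 * (t * sqrt t) * real m \<le> real M"
proof -
  have "t powr (3 / 2) = t * sqrt t"
    using t powr_add[of t 1 "1 / 2"] by (simp add: powr_half_sqrt)
  moreover have "0 < 16 * \<kappa> ^ 3 * (t * sqrt t)" using \<kappa> t by simp
  moreover have "real m \<le> real M / (16 * \<kappa> ^ 3 * t powr (3 / 2))"
  proof -
    have "0 \<le> real M / (16 * \<kappa> ^ 3 * t powr (3 / 2))" using \<kappa> by simp
    then show ?thesis unfolding m_eq num_out_def by linarith
  qed
  ultimately show ?thesis by (simp add: pos_le_divide_eq mult_ac)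
qed

text \<open>At the rate \<open>1 / (15 * sqrt (\<kappa> * t))\<close> both claims reduce to powers
  of \<kappa>. From \<open>M \<ge> 4 * \<kappa>^4 * t^2\<close> follows
  \<open>J \<ge> \<kappa>^3 * t / 36\<close>, and then
  \<open>1080 * sqrt \<kappa> \<le> \<kappa>^2\<close> is needed; from
  \<open>m \<le> 9 * J / (\<kappa>^2 * sqrt t)\<close> the second claim needs
  \<open>540 * sqrt \<kappa> \<le> \<kappa>^2\<close>.\<close>

lemma J_acc_ge: "2 * \<kappa> \<le> real J * acc" "4 * real m \<le> real J * acc"
proof -
  let ?w = "sqrt (\<kappa> * t)" and ?s = "sqrt \<kappa>" and ?r = "sqrt t"
  have w: "?w = ?s * ?r" by (rule real_sqrt_mult)
  have s: "11 \<le> ?s" using \<kappa> by (intro real_le_rsqrt) simp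
  have r: "1 \<le> ?r" using t by simp
  have ss: "?s * ?s = \<kappa>" and rr: "?r * ?r = t" using \<kappa> t by simp_all
  have Ja: "real J / (15 * ?w) \<le> real J * acc"
    using mult_left_mono[OF acc_ge, of "real J"] by simp
  have wp: "0 < ?w" using kt by simp
  have "2 * \<kappa> * (15 * ?w) = 30 * (\<kappa> * ?s * ?r)" by (simp add: w)
  also have "\<dots> \<le> 30 * (\<kappa> * t * ?s)"
  proof -
    have "?r \<le> t" using r mult_left_mono[of 1 ?r ?r] rr by simp
    then have "\<kappa> * ?s * ?r \<le> \<kappa> * ?s * t" using \<kappa> by (intro mult_left_mono) auto
    then show ?thesis by (simp add: mult_ac)
  qed
  finally have 1: "2 * \<kappa> * (15 * ?w) \<le> 30 * (\<kappa> * t * ?s)" .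
  have J2: "\<kappa> ^ 3 * t \<le> 36 * real J"
  proof -
    have "4 * \<kappa> ^ 4 * t ^ 2 \<le> 144 * (\<kappa> * t) * real J"
      using M MP_le J_bounds(2) by linarith
    then have "(\<kappa> * t) * (4 * (\<kappa> ^ 3 * t)) \<le> (\<kappa> * t) * (144 * real J)"
      by (simp add: power2_eq_square power4_eq_xxxx power3_eq_cube mult_ac)
    then have "4 * (\<kappa> ^ 3 * t) \<le> 144 * real J"
      using kt(3) by (simp only: mult_le_cancel_left_pos)
    then show ?thesis by linarith
  qed
  have "36 * (30 * (\<kappa> * t * ?s)) \<le> \<kappa> ^ 3 * t"
  proof -
    have "1080 * ?s \<le> \<kappa> * \<kappa>"
    proof -
      have "121 * 11 \<le> \<kappa> * ?s" using \<kappa> s by (intro mult_mono) auto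
      then have "1080 * ?s \<le> (\<kappa> * ?s) * ?s" using s \<kappa> by (intro mult_right_mono) auto
      then show ?thesis using ss \<kappa> by (simp add: mult.assoc)
    qed
    then have "(\<kappa> * t) * (1080 * ?s) \<le> (\<kappa> * t) * (\<kappa> * \<kappa>)" using kt by (intro mult_left_mono) auto
    then show ?thesis by (simp add: power3_eq_cube mult_ac)
  qed
  then have "2 * \<kappa> * (15 * ?w) \<le> real J" using 1 J2 by linarith
  then have "2 * \<kappa> \<le> real J / (15 * ?w)" using wp by (simp add: pos_le_divide_eq)
  then show "2 * \<kappa> \<le> real J * acc" using Ja by linarith
  have "16 * \<kappa> ^ 3 * (t * ?r) * real m \<le> 144 * (\<kappa> * t) * real J"
    using m_bound J_bounds(2) by linarith
  then have "(\<kappa> * t) * (16 * (\<kappa> * \<kappa>) * ?r * real m) \<le> (\<kappa> * t) * (144 * real J)"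
    by (simp add: power3_eq_cube mult_ac)
  then have m1: "16 * (\<kappa> * \<kappa>) * ?r * real m \<le> 144 * real J"
    using kt(3) by (simp only: mult_le_cancel_left_pos)
  have "60 * ?s * 9 \<le> \<kappa> * \<kappa>"
  proof -
    have "?s * 10 \<le> ?s * ?s" using s \<kappa> by (intro mult_left_mono) auto
    moreover have "100 * \<kappa> \<le> \<kappa> * \<kappa>" using \<kappa> by (intro mult_right_mono) auto
    ultimately show ?thesis using ss s \<kappa> by linarith
  qed
  then have "(60 * ?s * 9) * (?r * real m) \<le> (\<kappa> * \<kappa>) * (?r * real m)"
    using r by (intro mult_right_mono) auto
  then have "4 * real m * (15 * ?w) \<le> real J" using m1 by (simp add: w mult_ac)
  then have "4 * real m \<le> real J / (15 * ?w)" using wp by (simp add: pos_le_divide_eq)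
  then show "4 * real m \<le> real J * acc" using Ja by linarith
qed

text \<open>Since \<open>m\<close> is at most a quarter of the mean number of acceptances, the
  exponent is at most minus another quarter of that mean, which is at least
  \<open>\<kappa> / 2\<close>.\<close>

lemma few_accepted_error:
  "measure_pmf.prob (replicate_pmf J (try_pmf rate p)) {zs. length (filter snd zs) < m} \<le> exp (- \<kappa> / 2)"
proof -
  have "measure_pmf.prob (replicate_pmf J (try_pmf rate p)) {zs. length (filter snd zs) < m}
      \<le> measure_pmf.prob (replicate_pmf J (try_pmf rate p)) {zs. length (filter snd zs) \<le> m}"
    by (rule measure_pmf.finite_measure_mono) auto
  also have "\<dots> \<le> exp (- (real J * acc) / 2) * 2 ^ m"
    using prob_filter_le[of J "try_pmf rate p" snd m] by (simp only: prob_try)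
  also have "\<dots> = exp (- (real J * acc) / 2 + real m * ln 2)"
    by (simp only: two_power_eq_exp exp_add)
  also have "\<dots> \<le> exp (- \<kappa> / 2)"
  proof -
    have "real m * ln 2 \<le> real m * 1" using ln2_bounds by (intro mult_left_mono) auto
    then show ?thesis using J_acc_ge by simp
  qed
  finally show ?thesis .
qed

text \<open>On the support \<open>p x * rate x\<close> equals
  \<open>sqrt (p x) * gauss_integral (G * p x) / sqrt G\<close>, so \<open>\<nu>\<close> reweights
  the square root law by the Gaussian integral. This varies by at most
  \<open>exp (- \<kappa>)\<close> beyond \<kappa> and is at least 1/3 there, whence the factor
  3.\<close>

lemma sqrt_error:
  assumes \<nu>: "\<And>x. pmf p x * rate x = acc * pmf \<nu> x"
  shows "stat_dist \<nu> (sqrt_pmf p) \<le> 3 * exp (- \<kappa>)"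
proof -
  let ?A = "set_pmf p"
  define q where "q = (\<Sum>j\<in>?A. sqrt (pmf p j))"
  define g where "g = (\<lambda>x. gauss_integral (real G * pmf p x))"
  have sq: "pmf (sqrt_pmf p) x = sqrt (pmf p x) / q" for x
    unfolding q_def using fin by (rule pmf_sqrt_pmf)
  have q: "0 < q"
    unfolding q_def using fin set_pmf_not_empty[of p] by (intro sum_pos) (auto simp: pmf_positive_iff)
  have G: "0 < sqrt (real G)" using G_pos by simp
  have "pmf \<nu> x * (acc * sqrt (real G) / q) = pmf (sqrt_pmf p) x * g x" for x
  proof (cases "x \<in> ?A")
    case True
    then have px: "0 < pmf p x" by (rule pmf_positive)
    have "acc * pmf \<nu> x * sqrt (real G) = pmf p x * (g x / (sqrt (real G) * sqrt (pmf p x))) * sqrt (real G)"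
      by (simp add: \<nu>[symmetric] rate_eq[OF True] g_def real_sqrt_mult)
    also have "\<dots> = sqrt (pmf p x) * g x"
      using G px real_sqrt_mult_self[of "pmf p x"] by (simp add: field_simps)
    finally show ?thesis by (simp add: sq mult_ac)
  next
    case False
    then have "pmf p x = 0" by (simp add: set_pmf_iff)
    moreover from this have "pmf \<nu> x = 0" using \<nu>[of x] acc_pos by simp
    ultimately show ?thesis by (simp add: sq)
  qed
  moreover have "0 < acc * sqrt (real G) / q" using acc_pos G q by simp
  moreover have "set_pmf (sqrt_pmf p) \<subseteq> ?A"
    using sq q by (auto simp: set_pmf_iff)
  moreover have "set_pmf \<nu> \<subseteq> ?A"
  proof
    fix x assume "x \<in> set_pmf \<nu>"
    then have "acc * pmf \<nu> x \<noteq> 0" using acc_pos by (auto simp: set_pmf_iff)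
    then show "x \<in> ?A" using \<nu>[of x] by (auto simp: set_pmf_iff)
  qed
  moreover have g\<kappa>: "1 / 3 \<le> gauss_integral \<kappa>"
  proof -
    have "1 / 3 \<le> exp (- 1 :: real)"
      using exp_le by (simp add: exp_minus field_simps)
    then show ?thesis using gauss_integral_ge[of \<kappa>] \<kappa> by linarith
  qed
  moreover have "gauss_integral \<kappa> \<le> g x" if "x \<in> ?A" for x
    unfolding g_def using rate_bounds[OF that] \<kappa> by (intro gauss_integral_mono) auto
  moreover have "g x \<le> gauss_integral \<kappa> * (1 + 3 * exp (- \<kappa>))" if "x \<in> ?A" for x
  proof -
    have "g x \<le> gauss_integral \<kappa> + exp (- \<kappa>)"
      unfolding g_def using rate_bounds[OF that] \<kappa> by (intro gauss_integral_le) auto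
    moreover have "1 / 3 * (3 * exp (- \<kappa>)) \<le> gauss_integral \<kappa> * (3 * exp (- \<kappa>))"
      using g\<kappa> by (intro mult_right_mono) auto
    moreover have "gauss_integral \<kappa> * (1 + 3 * exp (- \<kappa>)) = gauss_integral \<kappa> + gauss_integral \<kappa> * (3 * exp (- \<kappa>))"
      by (simp add: distrib_left)
    ultimately show ?thesis by linarith
  qed
  ultimately show ?thesis
    using fin by (intro stat_dist_reweighted[of ?A "sqrt_pmf p" \<nu> "acc * sqrt (real G) / q" g "gauss_integral \<kappa>"]) auto
qed

text \<open>The coefficient of \<open>M\<close> is \<open>7 = 4 + 3\<close>: twice the simulation
  error \<open>2 * M\<close>, and \<open>3 * exp (- \<kappa>)\<close> for each of at most
  \<open>M\<close> output samples.\<close>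

lemma stat_dist_fixed_first_part:
  "stat_dist (bind_pmf (replicate_pmf J p) (\<lambda>ys. bind_pmf (replicate_pmf L p)
      (\<lambda>pool. sampler_pmf \<kappa> t (x1 @ ys @ pool)))) (replicate_pmf m (sqrt_pmf p))
   \<le> (7 * real M + 2 * real (card (set_pmf p)) + 4) * exp (- \<kappa> / 2)"
proof -
  let ?E = "exp (- \<kappa> / 2)" and ?N = "real (card (set_pmf p))"
  obtain \<nu> where \<nu>: "\<And>x. pmf p x * rate x = acc * pmf \<nu> x"
    using ex_accepted_pmf[OF fin accept_rate_bounds(1) refl acc_pos] by blast
  have "real J * (1 / 2 ^ S) \<le> real M * ?E"
    using S_bound J_le_M by (intro mult_mono) auto
  then have \<delta>: "real R * ((real K + 1) / 2 ^ S + exp (real G) / 2 ^ Suc K)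
        + measure_pmf.prob (replicate_pmf R (poisson_pmf (real G))) {ws. L < sum_list ws}
        + real J * (1 / 2 ^ S) + measure_pmf.prob (replicate_pmf J p) {ys. R < max_count ys}
      \<le> (2 * real M + ?N + 1) * ?E"
    using poisson_error overflow_error multiplicity_error by (simp add: algebra_simps)
  have 1: "stat_dist (bind_pmf (replicate_pmf J p) (\<lambda>ys. bind_pmf (replicate_pmf L p)
      (\<lambda>pool. sampler_pmf \<kappa> t (x1 @ ys @ pool)))) (replicate_pmf m \<nu>)
      \<le> 2 * ((2 * real M + ?N + 1) * ?E) + 2 * ?E"
    by (rule stat_dist_sampler_pmf[OF fin M_split J_eq x1(1) R_eq G_eq G_pos K_eq S_eq m_eq \<nu> \<delta> few_accepted_error])
  have "real m \<le> real M"
  proof -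
    have "acc \<le> 1"
      using measure_pmf.prob_le_1[of "try_pmf rate p" "{z. snd z}"] by (simp only: prob_try)
    then have "real J * acc \<le> real J * 1" by (intro mult_left_mono) auto
    then have "4 * real m \<le> real J" using J_acc_ge(2) by linarith
    then show ?thesis using J_le_M by linarith
  qed
  then have "stat_dist (replicate_pmf m \<nu>) (replicate_pmf m (sqrt_pmf p)) \<le> real M * (3 * ?E)"
  proof (intro order.trans[OF stat_dist_replicate] mult_mono)
    have "exp (- \<kappa>) \<le> ?E" using \<kappa> by simp
    then show "stat_dist \<nu> (sqrt_pmf p) \<le> 3 * ?E"
      using sqrt_error[OF \<nu>] by linarith
  qed (auto simp: stat_dist_nonneg)
  then show ?thesis
    using 1 stat_dist_triangle[of "bind_pmf (replicate_pmf J p) (\<lambda>ys. bind_pmf (replicate_pmf L p)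
      (\<lambda>pool. sampler_pmf \<kappa> t (x1 @ ys @ pool)))" "replicate_pmf m (sqrt_pmf p)" "replicate_pmf m \<nu>"]
    by (simp add: algebra_simps)
qed

end

text \<open>Conditioning on the first part makes the number and mean length of the blocks constants;
  an untypical first part adds the remaining \<open>N + 1\<close> units.\<close>

theorem stat_dist_large_input:
  "stat_dist (bind_pmf (replicate_pmf M p) (sampler_pmf \<kappa> t)) (replicate_pmf m (sqrt_pmf p))
   \<le> (7 * real M + 3 * real (card (set_pmf p)) + 5) * exp (- \<kappa> / 2)"
proof -
  let ?good = "\<lambda>xs. real J * P / 2 \<le> real (max_count xs) \<and> real (max_count xs) \<le> 2 * real J * P"
  have "bind_pmf (replicate_pmf M p) (sampler_pmf \<kappa> t)
      = bind_pmf (replicate_pmf J p) (\<lambda>x1. bind_pmf (replicate_pmf J p) (\<lambda>ys. bind_pmf (replicate_pmf L p)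
          (\<lambda>pool. sampler_pmf \<kappa> t (x1 @ ys @ pool))))"
    unfolding M_split[unfolded mult_2 add.assoc] replicate_pmf_distrib[of J] by (simp add: bind_assoc_pmf bind_return_pmf)
  moreover have "stat_dist (bind_pmf (replicate_pmf J p) (\<lambda>x1. bind_pmf (replicate_pmf J p) (\<lambda>ys. bind_pmf (replicate_pmf L p)
          (\<lambda>pool. sampler_pmf \<kappa> t (x1 @ ys @ pool))))) (bind_pmf (replicate_pmf J p) (\<lambda>_. replicate_pmf m (sqrt_pmf p)))
      \<le> (7 * real M + 2 * real (card (set_pmf p)) + 4) * exp (- \<kappa> / 2)
        + measure_pmf.prob (replicate_pmf J p) {xs. \<not> ?good xs}"
  proof (rule stat_dist_bind_right)
    fix x1 assume "x1 \<in> set_pmf (replicate_pmf J p)" "x1 \<notin> {xs. \<not> ?good xs}"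
    then have "length x1 = J" "real J * P / 2 \<le> real (max_count x1)" "real (max_count x1) \<le> 2 * real J * P"
      by (auto simp: set_replicate_pmf)
    then show "stat_dist (bind_pmf (replicate_pmf J p) (\<lambda>ys. bind_pmf (replicate_pmf L p)
          (\<lambda>pool. sampler_pmf \<kappa> t (x1 @ ys @ pool)))) (replicate_pmf m (sqrt_pmf p))
        \<le> (7 * real M + 2 * real (card (set_pmf p)) + 4) * exp (- \<kappa> / 2)"
      by (rule stat_dist_fixed_first_part[OF _ _ _ refl refl refl])
  qed simp
  ultimately show ?thesis
    using good_first_part by (simp add: algebra_simps)
qed

end

section \<open>All values of \<kappa>, the case of one element, and the conclusion\<close>

lemma stat_dist_sampler:
  fixes p :: "nat pmf"
  assumes \<kappa>: "\<kappa> \<ge> 2" and t: "t \<ge> 1" and N: "N \<ge> 2" and A: "set_pmf p = {1..N}"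
    and M: "real M \<ge> 4 * \<kappa> ^ 4 * t ^ 2 / (MAX i \<in> {1..N}. pmf p i)"
    and tmax: "t \<ge> (MAX (i, j) \<in> {1..N} \<times> {1..N}. pmf p i / pmf p j)"
  shows "stat_dist (bind_pmf (replicate_pmf M p) (sampler_pmf \<kappa> t)) (replicate_pmf (num_out \<kappa> t M) (sqrt_pmf p))
    \<le> exp 61 * real M * real N * ln (real N) * exp (- (1 / 2) * \<kappa>)"
proof -
  define P where "P = (MAX i \<in> {1..N}. pmf p i)"
  have "P \<in> pmf p ` {1..N}"
    unfolding P_def using N by (intro Max_in) auto
  then obtain i where i: "i \<in> {1..N}" "pmf p i = P" by auto
  have P_pos: "0 < P"
    using i A pmf_positive[of i p] by simp
  have P: "pmf p x \<le> P" for x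
  proof (cases "x \<in> {1..N}")
    case True
    then show ?thesis unfolding P_def by (intro Max_ge) auto
  next
    case False
    then have "x \<notin> set_pmf p" using A by simp
    then have "pmf p x = 0" by (simp add: set_pmf_iff)
    then show ?thesis using P_pos by simp
  qed
  have MP: "4 * \<kappa> ^ 4 * t ^ 2 \<le> real M * P"
    using M P_pos unfolding P_def[symmetric] by (simp add: divide_le_eq)
  have ratio: "P \<le> t * pmf p x" if "x \<in> set_pmf p" for x
  proof -
    have "(case (i, x) of (i, j) \<Rightarrow> pmf p i / pmf p j) \<le> (MAX (i, j) \<in> {1..N} \<times> {1..N}. pmf p i / pmf p j)"
      using i that A by (intro Max_ge) auto
    from order.trans[OF this tmax] have "P / pmf p x \<le> t" using i by simp
    then show ?thesis using pmf_positive[OF that] by (simp add: divide_le_eq)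
  qed
  have M1: "1 \<le> real M"
  proof -
    have "0 < 4 * \<kappa> ^ 4 * t ^ 2" using \<kappa> t by simp
    then have "0 < real M * P" using MP by linarith
    then have "M \<noteq> 0" by (cases "M = 0") auto
    then show ?thesis by simp
  qed
  have lnN: "2 / 3 \<le> ln (real N)"
    using ln2_bounds(1) N ln_le_cancel_iff[of 2 "real N"] by linarith
  let ?E = "exp (- (1 / 2) * \<kappa>)"
  have MN: "1 \<le> real M * real N" using mult_mono[of 1 "real M" 1 "real N"] M1 N by simp
  show ?thesis
  proof (cases "121 \<le> \<kappa>")
    case True
    interpret large_input \<kappa> t P p M "num_tries \<kappa> t M" "M - 2 * num_tries \<kappa> t M" "nat \<lceil>\<kappa>\<rceil>" "num_out \<kappa> t M" i
      using True t A P i ratio MP by unfold_locales auto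
    have "stat_dist (bind_pmf (replicate_pmf M p) (sampler_pmf \<kappa> t)) (replicate_pmf (num_out \<kappa> t M) (sqrt_pmf p))
        \<le> (7 * real M + 3 * real N + 5) * ?E"
      using stat_dist_large_input A by simp
    also have "\<dots> \<le> (exp 61 * (real M * real N) * ln (real N)) * ?E"
    proof (rule mult_right_mono)
      have "real M \<le> real M * real N" "real N \<le> real M * real N"
        using M1 N mult_left_mono[of 1 "real N" "real M"] mult_right_mono[of 1 "real M" "real N"] by auto
      then have "7 * real M + 3 * real N + 5 \<le> 15 * (real M * real N)" using MN by linarith
      also have "\<dots> \<le> (exp 61 * ln (real N)) * (real M * real N)"
      proof (rule mult_right_mono)
        have "62 \<le> exp (61 :: real)" using exp_ge_add_one_self[of 61] by simp
        then have "62 * (2 / 3) \<le> exp 61 * ln (real N)" using lnN by (intro mult_mono) auto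
        then show "15 \<le> exp 61 * ln (real N)" by linarith
      qed simp
      finally show "7 * real M + 3 * real N + 5 \<le> exp 61 * (real M * real N) * ln (real N)" by (simp add: mult_ac)
    qed simp
    finally show ?thesis by (simp add: mult_ac)
  next
    case False
    \<comment> \<open>For \<open>\<kappa> < 121\<close> the claim is trivial:
      \<open>61 = 121 / 2 + 1 / 2\<close> leaves the factor \<open>exp (1 / 2) \<ge> 3 / 2\<close>,
      which compensates \<open>ln N \<ge> 2 / 3\<close>.\<close>
    have "stat_dist (bind_pmf (replicate_pmf M p) (sampler_pmf \<kappa> t)) (replicate_pmf (num_out \<kappa> t M) (sqrt_pmf p)) \<le> 1"
      by (rule stat_dist_le_1)
    also have "1 \<le> exp (1 / 2 :: real) * (2 / 3)"
      using exp_ge_add_one_self[of "1 / 2 :: real"] by simp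
    also have "exp (1 / 2) * (2 / 3) \<le> (exp 61 * ?E) * ((real M * real N) * ln (real N))"
    proof (rule mult_mono)
      have "1 / 2 \<le> 61 - 1 / 2 * \<kappa>" using False by simp
      then show "exp (1 / 2) \<le> exp 61 * ?E" by (simp flip: exp_add)
      show "2 / 3 \<le> (real M * real N) * ln (real N)"
        using mult_mono[OF MN lnN] MN by simp
    qed auto
    finally show ?thesis by (simp add: mult_ac)
  qed
qed

lemma output_dist_sampler_eq:
  assumes "\<kappa> \<ge> 2" "t \<ge> 1"
  shows "output_dist sampler (init_state \<kappa> t xs) = sampler_pmf \<kappa> t xs"
  using sampler_input_self[OF assms, of xs] by (blast intro: sampler_input.output_dist_sampler)

lemma sampler_pmf_support_self:
  assumes "\<kappa> \<ge> 2" "t \<ge> 1" "zs \<in> set_pmf (sampler_pmf \<kappa> t xs)"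
  shows "count_list zs x \<le> count_list xs x" "length zs = num_out \<kappa> t (length xs)"
  using sampler_input_self[OF assms(1,2), of xs] assms(3)
  by (blast intro: sampler_input.sampler_pmf_support)+

lemma set_subset_of_count_list_le:
  assumes "\<And>x. count_list zs x \<le> count_list xs x"
  shows "set zs \<subseteq> set xs"
proof
  fix x assume "x \<in> set zs"
  then have "count_list zs x \<noteq> 0" by (simp add: count_list_0_iff)
  then have "count_list xs x \<noteq> 0" using assms[of x] by linarith
  then show "x \<in> set xs" by (simp add: count_list_0_iff)
qed

lemma replicate_return_pmf: "replicate_pmf n (return_pmf x) = return_pmf (replicate n x)"
  by (induction n) (simp_all add: bind_return_pmf)

text \<open>For a single element the error bound vanishes with \<open>ln N\<close>, so the laws must
  be equal. They are, because every output has length exactly \<open>m\<close> and contains only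
  input elements.\<close>

lemma sampler_pmf_single_element:
  fixes p :: "nat pmf"
  assumes "\<kappa> \<ge> 2" "t \<ge> 1" and A: "set_pmf p = {x}"
  shows "bind_pmf (replicate_pmf M p) (sampler_pmf \<kappa> t) = replicate_pmf (num_out \<kappa> t M) (sqrt_pmf p)"
proof -
  let ?m = "num_out \<kappa> t M"
  have p: "p = return_pmf x" using A set_pmf_subset_singleton[of p x] by simp
  have fin: "finite (set_pmf p)" using A by simp
  have "set_pmf (sqrt_pmf p) \<subseteq> set_pmf p"
  proof
    fix y assume "y \<in> set_pmf (sqrt_pmf p)"
    then have "pmf (sqrt_pmf p) y \<noteq> 0" by (rule set_pmf_iff[THEN iffD1])
    then have "pmf p y \<noteq> 0" unfolding pmf_sqrt_pmf[OF fin] by auto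
    then show "y \<in> set_pmf p" by (rule set_pmf_iff[THEN iffD2])
  qed
  then have "set_pmf (sqrt_pmf p) \<subseteq> {x}" using A by simp
  then have s: "sqrt_pmf p = return_pmf x" by (simp add: set_pmf_subset_singleton)
  have "zs = replicate ?m x" if "zs \<in> set_pmf (sampler_pmf \<kappa> t (replicate M x))" for zs
  proof -
    have "set zs \<subseteq> set (replicate M x)"
      using sampler_pmf_support_self(1)[OF assms(1,2) that] by (rule set_subset_of_count_list_le)
    moreover have "length zs = ?m"
      using sampler_pmf_support_self(2)[OF assms(1,2) that] by simp
    ultimately show ?thesis by (intro replicate_eqI) (auto split: if_splits)
  qed
  then have "sampler_pmf \<kappa> t (replicate M x) = return_pmf (replicate ?m x)"
    using set_pmf_subset_singleton[of "sampler_pmf \<kappa> t (replicate M x)" "replicate ?m x"] by blast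
  then show ?thesis
    unfolding s unfolding p replicate_return_pmf by (simp add: bind_return_pmf)
qed

theorem theorem5p4:
  shows "\<exists>(C\<^sub>1::real) (C\<^sub>2::real) (A::com).
    C\<^sub>1 > 0 \<and> C\<^sub>2 > 0 \<and>
    (\<forall>(\<kappa>::real) (t::real) (N::nat) (xs::nat list).
       \<kappa> \<ge> 2 \<and> t \<ge> 1 \<and> set xs \<subseteq> {1..N} \<longrightarrow>
         halts A (init_state \<kappa> t xs) \<and>
         (\<forall>ys \<in> set_pmf (output_dist A (init_state \<kappa> t xs)). set ys \<subseteq> {1..N})) \<and>
    (\<exists>P :: real poly poly poly. \<forall>(\<kappa>::real) (t::real) (N::nat) (xs::nat list).
       \<kappa> \<ge> 2 \<and> t \<ge> 1 \<and> xs \<noteq> [] \<and> set xs \<subseteq> {1..N} \<longrightarrow>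
         real (running_time A (init_state \<kappa> t xs)) \<le> real (length xs) * poly3 P (ln (real N)) \<kappa> t) \<and>
    (\<forall>(\<kappa>::real) (t::real) (N::nat) (xs::nat list).
       \<kappa> \<ge> 2 \<and> t \<ge> 1 \<and> set xs \<subseteq> {1..N} \<longrightarrow>
         (\<forall>ys \<in> set_pmf (output_dist A (init_state \<kappa> t xs)).
            \<forall>i \<in> {1..N}. count_list ys i \<le> count_list xs i)) \<and>
    (\<forall>(\<kappa>::real) (t::real) (N::nat) (M::nat) (p::nat pmf).
       \<kappa> \<ge> 2 \<and> t \<ge> 1 \<and> set_pmf p = {1..N} \<and>
       real M \<ge> 4 * \<kappa> ^ 4 * t ^ 2 / (MAX i \<in> {1..N}. pmf p i) \<and>
       t \<ge> (MAX (i, j) \<in> {1..N} \<times> {1..N}. pmf p i / pmf p j) \<longrightarrow>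
         stat_dist (bind_pmf (replicate_pmf M p) (\<lambda>xs. output_dist A (init_state \<kappa> t xs)))
                   (replicate_pmf (nat \<lfloor>real M / (16 * \<kappa> ^ 3 * t powr (3 / 2))\<rfloor>) (sqrt_pmf p))
           \<le> C\<^sub>1 * real M * real N * ln (real N) * exp (- C\<^sub>2 * \<kappa>))"
proof (rule exI[of _ "exp 61"], rule exI[of _ "1 / 2"], rule exI[of _ sampler], intro conjI allI impI)
  show "exp 61 > (0::real)" "1 / 2 > (0::real)" by simp_all
next
  fix \<kappa> t :: real and N :: nat and xs :: "nat list"
  assume *: "\<kappa> \<ge> 2 \<and> t \<ge> 1 \<and> set xs \<subseteq> {1..N}"
  then show "halts sampler (init_state \<kappa> t xs)"
    using sampler_input_self[of \<kappa> t xs] by (blast intro: sampler_input.halts_sampler)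
  have "set ys \<subseteq> set xs" if "ys \<in> set_pmf (output_dist sampler (init_state \<kappa> t xs))" for ys
    using that * output_dist_sampler_eq sampler_pmf_support_self(1) by (intro set_subset_of_count_list_le) auto
  then show "\<forall>ys \<in> set_pmf (output_dist sampler (init_state \<kappa> t xs)). set ys \<subseteq> {1..N}"
    using * by blast
next
  \<comment> \<open>The middle variable of \<open>poly3\<close> is \<kappa>; the bound is constant
    in \<open>ln N\<close> and \<open>t\<close>.\<close>
  let ?P = "[:[:[:200:], [:100:]:]:] :: real poly poly poly"
  have "poly3 ?P x y z = 200 + 100 * y" for x y z
    by (simp add: poly3_def)
  moreover have "real (running_time sampler (init_state \<kappa> t xs)) \<le> real (length xs) * (200 + 100 * \<kappa>)"
    if "\<kappa> \<ge> 2" "t \<ge> 1" "xs \<noteq> []" for \<kappa> t :: real and xs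
    using sampler_input_self[OF that(1,2), of xs] that(3)
    by (blast intro: sampler_input.running_time_sampler)
  ultimately show "\<exists>P :: real poly poly poly. \<forall>(\<kappa>::real) (t::real) (N::nat) (xs::nat list).
       \<kappa> \<ge> 2 \<and> t \<ge> 1 \<and> xs \<noteq> [] \<and> set xs \<subseteq> {1..N} \<longrightarrow>
         real (running_time sampler (init_state \<kappa> t xs)) \<le> real (length xs) * poly3 P (ln (real N)) \<kappa> t"
    by (intro exI[of _ ?P]) simp
next
  fix \<kappa> t :: real and N :: nat and xs :: "nat list"
  assume "\<kappa> \<ge> 2 \<and> t \<ge> 1 \<and> set xs \<subseteq> {1..N}"
  then show "\<forall>ys \<in> set_pmf (output_dist sampler (init_state \<kappa> t xs)). \<forall>i \<in> {1..N}. count_list ys i \<le> count_list xs i"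
    using output_dist_sampler_eq sampler_pmf_support_self(1) by auto
next
  fix \<kappa> t :: real and N M :: nat and p :: "nat pmf"
  assume *: "\<kappa> \<ge> 2 \<and> t \<ge> 1 \<and> set_pmf p = {1..N} \<and>
       real M \<ge> 4 * \<kappa> ^ 4 * t ^ 2 / (MAX i \<in> {1..N}. pmf p i) \<and>
       t \<ge> (MAX (i, j) \<in> {1..N} \<times> {1..N}. pmf p i / pmf p j)"
  then have \<kappa>: "\<kappa> \<ge> 2" and t: "t \<ge> 1" and A: "set_pmf p = {1..N}" by auto
  have "N \<noteq> 0" using A set_pmf_not_empty[of p] by (cases N) auto
  have eq: "bind_pmf (replicate_pmf M p) (\<lambda>xs. output_dist sampler (init_state \<kappa> t xs))
      = bind_pmf (replicate_pmf M p) (sampler_pmf \<kappa> t)"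
    using output_dist_sampler_eq[OF \<kappa> t] by simp
  show "stat_dist (bind_pmf (replicate_pmf M p) (\<lambda>xs. output_dist sampler (init_state \<kappa> t xs)))
                   (replicate_pmf (nat \<lfloor>real M / (16 * \<kappa> ^ 3 * t powr (3 / 2))\<rfloor>) (sqrt_pmf p))
           \<le> exp 61 * real M * real N * ln (real N) * exp (- (1 / 2) * \<kappa>)"
    unfolding eq num_out_def[symmetric]
  proof (cases "N = 1")
    case True
    then show "stat_dist (bind_pmf (replicate_pmf M p) (sampler_pmf \<kappa> t)) (replicate_pmf (num_out \<kappa> t M) (sqrt_pmf p))
           \<le> exp 61 * real M * real N * ln (real N) * exp (- (1 / 2) * \<kappa>)"
      using sampler_pmf_single_element[OF \<kappa> t, of p 1 M] A by simp
  next
    case False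
    then have "N \<ge> 2" using \<open>N \<noteq> 0\<close> by linarith
    then show "stat_dist (bind_pmf (replicate_pmf M p) (sampler_pmf \<kappa> t)) (replicate_pmf (num_out \<kappa> t M) (sqrt_pmf p))
           \<le> exp 61 * real M * real N * ln (real N) * exp (- (1 / 2) * \<kappa>)"
      using * by (intro stat_dist_sampler) auto
  qed
qed

end
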